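(* Let $g\in C_0^\infty(\mathbb R)$ be even. For $u\ge 0$ put $\rho(u)=2\,\mathrm{arcsinh}\sqrt u$ and define $$f_e(u)=-\frac{1}{2\sqrt2}\int_{\rho(u)}^\infty\frac{g'(t)\,dt}{\sqrt{\cosh t-1-2u}},\qquad f_o(u)=g(\rho(u)).$$ Then for every integer $m\ge0$ the following inversion formulae hold: $$f_e(u)=\frac1{\Gamma(m+1)^2}\int_{\mathbb R}\left[\int_0^\infty f_e(v)\,{}_2F_1\!\left(\tfrac12+m+it,\tfrac12+m-it,m+1,-v\right)(v^2+v)^m\,dv\right]{}_2F_1\!\left(\tfrac12+m+it,\tfrac12+m-it,m+1,-u\right)\tanh(\pi t)\,t\left(\tfrac12+it\right)_m\left(\tfrac12-it\right)_m dt,$$ $$f_o(u)=\frac1{\Gamma(m+\frac12)^2}\int_{\mathbb R}\left[\int_0^\infty f_o(v)\,{}_2F_1\!\left(m+it,m-it,m+\tfrac12,-v\right)(v^2+v)^{m-\frac12}\,dv\right]{}_2F_1\!\left(m+it,m-it,m+\tfrac12,-u\right)(it)_m(-it)_m\,dt.$$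
   Context: ${}_2F_1(\alpha,\beta,\gamma,z)$ is the Gauss hypergeometric function (analytically continued to $\mathbb C\setminus[1,\infty)$), and $(x)_m=\Gamma(x+m)/\Gamma(x)=x(x+1)\cdots(x+m-1)$ is the Pochhammer symbol, with $(x)_0=1$. *)

theory Defs
  imports "HOL-Complex_Analysis.Complex_Analysis"
begin

text \<open>The principal domain \<open>\<complex> - [1,\<infinity>)\<close> of the Gauss hypergeometric function.\<close>

definition hyp2F1_domain :: "complex set" where
  "hyp2F1_domain = - (complex_of_real ` {1..})"

definition hyp2F1_continuation ::
    "complex \<Rightarrow> complex \<Rightarrow> complex \<Rightarrow> (complex \<Rightarrow> complex) \<Rightarrow> bool" where
  "hyp2F1_continuation a b c F \<longleftrightarrow>
     F holomorphic_on hyp2F1_domain \<and>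
     (\<forall>z. norm z < 1 \<longrightarrow> F z = eval_fps (fps_hypergeo [a, b] [c] 1) z)"

text \<open>The continuation is unique on the domain (see \<open>hyp2F1_eqI\<close> below), so the choice
  operator only leaves the values on \<open>[1,\<infinity>)\<close> unspecified.  As usual, the definition is
  meant for \<open>c\<close> different from \<open>0, -1, -2, \<dots>\<close>.\<close>

definition hyp2F1 :: "complex \<Rightarrow> complex \<Rightarrow> complex \<Rightarrow> complex \<Rightarrow> complex" where
  "hyp2F1 a b c = (SOME F. hyp2F1_continuation a b c F)"

text \<open>\<open>C\<^sub>0\<^sup>\<infinity>(\<real>)\<close>, complex-valued.\<close>

definition smooth_real :: "(real \<Rightarrow> complex) \<Rightarrow> bool" where
  "smooth_real g \<longleftrightarrow>
     (\<forall>n x. (((\<lambda>h t. vector_derivative h (at t)) ^^ n) g) differentiable (at x))"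

definition test_function :: "(real \<Rightarrow> complex) \<Rightarrow> bool" where
  "test_function g \<longleftrightarrow> smooth_real g \<and> compact (closure {x. g x \<noteq> 0})"

definition rho :: "real \<Rightarrow> real" where
  "rho u = 2 * arsinh (sqrt u)"

definition f_even :: "(real \<Rightarrow> complex) \<Rightarrow> real \<Rightarrow> complex" where
  "f_even g u = - (1 / (2 * complex_of_real (sqrt 2))) *
     (LBINT t:{rho u<..}.
        vector_derivative g (at t) / complex_of_real (sqrt (cosh t - 1 - 2 * u)))"

definition f_odd :: "(real \<Rightarrow> complex) \<Rightarrow> real \<Rightarrow> complex" where
  "f_odd g u = g (rho u)"

definition hyp_even :: "nat \<Rightarrow> real \<Rightarrow> real \<Rightarrow> complex" where
  "hyp_even m t v =
     hyp2F1 (1/2 + of_nat m + \<i> * of_real t) (1/2 + of_nat m - \<i> * of_real t)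
       (of_nat m + 1) (- of_real v)"

definition hyp_odd :: "nat \<Rightarrow> real \<Rightarrow> real \<Rightarrow> complex" where
  "hyp_odd m t v =
     hyp2F1 (of_nat m + \<i> * of_real t) (of_nat m - \<i> * of_real t)
       (of_nat m + 1/2) (- of_real v)"

definition inner_even :: "nat \<Rightarrow> (real \<Rightarrow> complex) \<Rightarrow> real \<Rightarrow> real \<Rightarrow> complex" where
  "inner_even m f t v = f v * hyp_even m t v * of_real ((v\<^sup>2 + v) ^ m)"

definition inner_odd :: "nat \<Rightarrow> (real \<Rightarrow> complex) \<Rightarrow> real \<Rightarrow> real \<Rightarrow> complex" where
  "inner_odd m f t v = f v * hyp_odd m t v * of_real ((v\<^sup>2 + v) powr (real m - 1/2))"

definition outer_even :: "nat \<Rightarrow> (real \<Rightarrow> complex) \<Rightarrow> real \<Rightarrow> real \<Rightarrow> complex" where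
  "outer_even m f u t =
     (LBINT v:{0..}. inner_even m f t v) * hyp_even m t u * of_real (tanh (pi * t) * t)
       * pochhammer (1/2 + \<i> * of_real t) m * pochhammer (1/2 - \<i> * of_real t) m"

definition outer_odd :: "nat \<Rightarrow> (real \<Rightarrow> complex) \<Rightarrow> real \<Rightarrow> real \<Rightarrow> complex" where
  "outer_odd m f u t =
     (LBINT v:{0..}. inner_odd m f t v) * hyp_odd m t u
       * pochhammer (\<i> * of_real t) m * pochhammer (- (\<i> * of_real t)) m"

lemma open_hyp2F1_domain: "open hyp2F1_domain"
proof -
  have "complex_of_real ` {1..} = \<real> \<inter> {z. Re z \<ge> 1}"
    by (auto simp: complex_is_Real_iff complex_eq_iff image_iff)
  moreover have "closed ((\<real> :: complex set) \<inter> {z. Re z \<ge> 1})"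
    by (intro closed_Int closed_complex_Reals closed_halfspace_Re_ge)
  ultimately show ?thesis
    unfolding hyp2F1_domain_def by (metis open_Compl)
qed

lemma connected_hyp2F1_domain: "connected hyp2F1_domain"
proof -
  have "closed_segment 0 z \<subseteq> hyp2F1_domain" if "z \<in> hyp2F1_domain" for z
  proof
    fix w assume "w \<in> closed_segment 0 z"
    then obtain s where s: "0 \<le> s" "s \<le> 1" "w = of_real s * z"
      by (auto simp: in_segment scaleR_conv_of_real)
    have False if "w = of_real x" "x \<ge> 1" for x
    proof -
      have "s > 0" "z = of_real (x / s)"
        using s that by (auto simp: field_simps less_le)
      moreover have "x / s \<ge> 1"
        using s that \<open>s > 0\<close> by (simp add: field_simps)
      ultimately show False
        using \<open>z \<in> hyp2F1_domain\<close>
        by (auto simp: hyp2F1_domain_def simp del: of_real_divide)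
    qed
    then show "w \<in> hyp2F1_domain"
      by (auto simp: hyp2F1_domain_def)
  qed
  moreover have "0 \<in> hyp2F1_domain"
    by (auto simp: hyp2F1_domain_def)
  ultimately show ?thesis
    by (intro starlike_imp_connected) (auto simp: starlike_def)
qed

lemma hyp2F1_eqI:
  assumes F: "hyp2F1_continuation a b c F" and z: "z \<in> hyp2F1_domain"
  shows "hyp2F1 a b c z = F z"
proof -
  have G: "hyp2F1_continuation a b c (hyp2F1 a b c)"
    unfolding hyp2F1_def using F by (metis someI_ex)
  have sub: "ball 0 1 \<subseteq> hyp2F1_domain"
    by (auto simp: hyp2F1_domain_def)
  show ?thesis
  proof (rule analytic_continuation_open[where s = "ball 0 1" and s' = hyp2F1_domain
        and f = "hyp2F1 a b c" and g = F])
    show "hyp2F1 a b c w = F w" if "w \<in> ball 0 1" for w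
      using F G that by (simp add: hyp2F1_continuation_def)
  qed (use F G z sub open_hyp2F1_domain connected_hyp2F1_domain in
        \<open>auto simp: hyp2F1_continuation_def\<close>)
qed

end

theory Submission
  imports Defs "HOL-Probability.Sinc_Integral" "HOL-Probability.Characteristic_Functions"
    "HOL-Real_Asymp.Real_Asymp"
begin

text \<open>
  Put \<open>\<phi>(c,t,v) = \<^sub>2F\<^sub>1(c - 1/2 + it, c - 1/2 - it; c; -v)\<close> and \<open>w = v\<^sup>2 + v\<close>; the two formulae are the
  cases \<open>c = m + 1\<close> and \<open>c = m + 1/2\<close> of one inversion formula with weight \<open>w powr (c - 1)\<close>.  The relations
  \<open>d/dv \<phi>(c) = -((c - 1/2)\<^sup>2 + t\<^sup>2)/c \<cdot> \<phi>(c+1)\<close> and \<open>d/dv (w powr c \<cdot> \<phi>(c+1)) = c \<cdot> w powr (c - 1) \<cdot> \<phi>(c)\<close>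
  turn the formula at \<open>c\<close> for a primitive of \<open>f\<close> into the formula at \<open>c + 1\<close> for \<open>f\<close>: differentiate it, and
  integrate by parts in the inner integral.  Both families of functions are closed under primitives, so
  only \<open>m = 0\<close> remains.

  At \<open>c = 1/2\<close>, \<open>\<phi>\<close> is \<open>cos (t \<cdot> rho v)\<close>, and the formula is cosine Fourier inversion.  At \<open>c = 1\<close>, the substitution
  \<open>rho (u + x\<^sup>2)\<close> for the integration variable exhibits \<open>f\<^sub>e\<close> as an Abel transform; its Jacobi transform is again
  a multiple of the cosine transform of \<open>g\<close>, since the half-order integral of \<open>\<phi>(1)\<close> is a primitive of
  \<open>\<phi>(1/2)\<close> against its weight.  Inserting the derivative of the cosine inversion formula into \<open>f\<^sub>e\<close> then
  leaves Mehler's integral of \<open>t \<cdot> sin (t \<cdot> r) / sinh r\<close>, \<open>r = rho (u + x\<^sup>2)\<close>, over \<open>x > 0\<close>.  It equals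
  \<open>(\<pi>/4) \<cdot> t \<cdot> tanh (\<pi> t) \<cdot> \<phi>(1,t,u)\<close>, because both sides are bounded solutions of the same differential
  equation, singular at \<open>u = 0\<close>, and agree at \<open>u = 0\<close>.
\<close>

subsection \<open>Hypergeometric functions on the slit plane\<close>

text \<open>The first obstacle is that \<open>hyp2F1\<close> is a bare choice, so the existence of a
  continuation to the slit plane has to be proved. At c = 1/2 it is an explicit function of Arcsin
  and square roots, at c = 1 an average of such functions, and differentiation carries existence
  upwards. A primitive of a compactly supported function is in general only constant near infinity.
  In the coordinate r = rho v, that is v = sinh(r/2)^2, integrating in v means integrating g(r)
  sinh(r)/2 in r. For even g this density is odd, its total integral is 0, and the primitive is
  again even with compact support; hence both families are closed under primitives. Each raising
  step multiplies the spectral density by (c - 1/2)^2 + t^2, and the product of these factors is the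
  pair of Pochhammer symbols. It also produces 1/c^2, which turns 1/Gamma(c)^2 into 1/Gamma(c+1)^2.
  The factor tanh(pi t) enters at a single place: at u = 0 Mehler's integral becomes the sine
  transform of 1/sinh(r/2), which the partial fractions of tanh evaluate.\<close>

abbreviation hgf :: "complex \<Rightarrow> complex \<Rightarrow> complex \<Rightarrow> complex fps" where
  "hgf a b c \<equiv> fps_hypergeo [a, b] [c] 1"

text \<open>The power series condition is a condition on the germ at \<open>0\<close> only; unlike the sum formula on the unit disc it is
  compatible with products and derivatives, so that identities between continuations reduce to comparing coefficients.\<close>

definition HG :: "complex \<Rightarrow> complex \<Rightarrow> complex \<Rightarrow> (complex \<Rightarrow> complex) \<Rightarrow> bool" where
  "HG a b c F \<longleftrightarrow> F holomorphic_on hyp2F1_domain \<and> F has_fps_expansion hgf a b c"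

lemma hypergeo_nth_Suc:
  assumes "\<And>n. c + of_nat n \<noteq> 0"
  shows "hgf a b c $ Suc n = (a + of_nat n) * (b + of_nat n) / ((c + of_nat n) * of_nat (Suc n)) * hgf a b c $ n"
  unfolding fps_hypergeo_rec by (simp add: mult_ac)

lemma hypergeo_nth_Suc_shift:
  assumes "c \<noteq> 0"
  shows "c * (of_nat (Suc n) * hgf a b c $ Suc n) = a * b * hgf (a+1) (b+1) (c+1) $ n"
proof -
  have "hgf a b c $ Suc n = (a * pochhammer (a+1) n) * (b * pochhammer (b+1) n) /
      ((c * pochhammer (c+1) n) * (of_nat (Suc n) * fact n))"
    unfolding fps_hypergeo_nth by (auto simp: pochhammer_rec algebra_simps)
  then show ?thesis using assms
    by (simp del: of_nat_Suc)
qed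

lemma ball_subset_hyp2F1_domain: "ball 0 1 \<subseteq> hyp2F1_domain"
  by (auto simp: hyp2F1_domain_def)

lemma zero_in_hyp2F1_domain [simp]: "0 \<in> hyp2F1_domain"
  by (auto simp: hyp2F1_domain_def)

lemma hyp2F1_domain_altdef: "z \<in> hyp2F1_domain \<longleftrightarrow> Im z \<noteq> 0 \<or> Re z < 1"
proof -
  have "z \<in> complex_of_real ` {1..} \<longleftrightarrow> Im z = 0 \<and> Re z \<ge> 1"
    by (auto simp: image_iff complex_eq_iff intro: bexI[of _ "Re z"])
  then show ?thesis by (auto simp: hyp2F1_domain_def)
qed

lemma HG_eq_hyp2F1:
  assumes "HG a b c F" "z \<in> hyp2F1_domain"
  shows "hyp2F1 a b c z = F z"
proof (rule hyp2F1_eqI[OF _ assms(2)])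
  have "F holomorphic_on ball 0 1"
    using assms ball_subset_hyp2F1_domain holomorphic_on_subset unfolding HG_def by blast
  then show "hyp2F1_continuation a b c F"
    using assms has_fps_expansion_imp_eval_fps_eq[of F "hgf a b c" _ 1]
    unfolding HG_def hyp2F1_continuation_def by auto
qed

text \<open>The slit plane is connected, so a vanishing germ at 0 forces the function to vanish
  everywhere. The relations between continuations below feed their coefficient identities into
  this.\<close>

lemma HG_identity:
  assumes "F has_fps_expansion 0" "F holomorphic_on hyp2F1_domain" "z \<in> hyp2F1_domain"
  shows "F z = 0"
  using has_fps_expansion_0_analytic_continuation[OF assms(1,2) open_hyp2F1_domain
      connected_hyp2F1_domain _ assms(3)] by simp

text \<open>Meant for construction: it produces a continuation with all three parameters raised, at
  the price of dividing by \<open>a * b\<close>.\<close>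

lemma HG_deriv:
  assumes F: "HG a b c F" and ab: "a * b \<noteq> 0" and c: "c \<noteq> 0"
  shows "HG (a+1) (b+1) (c+1) (\<lambda>z. c / (a * b) * deriv F z)"
proof -
  have "fps_const (c / (a * b)) * fps_deriv (hgf a b c) = hgf (a+1) (b+1) (c+1)"
  proof (rule fps_ext)
    fix n
    show "(fps_const (c / (a * b)) * fps_deriv (hgf a b c)) $ n = hgf (a+1) (b+1) (c+1) $ n"
      using hypergeo_nth_Suc_shift[OF c, of n a b] ab
      by (simp add: divide_simps del: of_nat_Suc fps_hypergeo_nth)
  qed
  moreover have "(\<lambda>z. c / (a * b) * deriv F z) has_fps_expansion
      fps_const (c / (a * b)) * fps_deriv (hgf a b c)"
    using F unfolding HG_def by (intro has_fps_expansion_cmult_left has_fps_expansion_deriv) auto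
  ultimately show ?thesis
    using F unfolding HG_def
    by (auto intro!: holomorphic_intros open_hyp2F1_domain)
qed

text \<open>The same relation free of division, so that it survives a vanishing upper parameter; in
  return the raised continuation must be supplied.\<close>

lemma HG_deriv_eq:
  assumes F: "HG a b c F" and G: "HG (a+1) (b+1) (c+1) G" and c: "c \<noteq> 0"
    and z: "z \<in> hyp2F1_domain"
  shows "c * deriv F z = a * b * G z"
proof -
  have "fps_const c * fps_deriv (hgf a b c) - fps_const (a * b) * hgf (a+1) (b+1) (c+1) = 0"
  proof (rule fps_ext)
    fix n
    show "(fps_const c * fps_deriv (hgf a b c) - fps_const (a * b) * hgf (a+1) (b+1) (c+1)) $ n = 0 $ n"
      using hypergeo_nth_Suc_shift[OF c, of n a b] by (simp add: mult_ac del: of_nat_Suc fps_hypergeo_nth)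
  qed
  moreover have "(\<lambda>z. c * deriv F z - (a * b) * G z) has_fps_expansion
      fps_const c * fps_deriv (hgf a b c) - fps_const (a * b) * hgf (a+1) (b+1) (c+1)"
    using F G unfolding HG_def
    by (intro has_fps_expansion_diff has_fps_expansion_cmult_left has_fps_expansion_deriv) auto
  ultimately have e: "(\<lambda>z. c * deriv F z - (a * b) * G z) has_fps_expansion 0" by simp
  have h: "(\<lambda>z. c * deriv F z - (a * b) * G z) holomorphic_on hyp2F1_domain"
    using F G unfolding HG_def by (intro holomorphic_intros open_hyp2F1_domain) auto
  from HG_identity[OF e h z] show ?thesis by simp
qed

text \<open>The operator z d/dz + c multiplies the n-th coefficient by c + n, and (c + n)/(c + 1)_n
  = c/(c)_n.\<close>

lemma HG_lower:
  assumes F: "HG a b c F" and G: "HG a b (c+1) G" and c: "\<And>n. c + of_nat n \<noteq> 0"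
    and z: "z \<in> hyp2F1_domain"
  shows "z * deriv G z + c * G z = c * F z"
proof -
  have nz: "pochhammer c n \<noteq> 0" "pochhammer (c+1) n \<noteq> 0" "c \<noteq> 0" for n
  proof -
    have "c + 1 + of_nat k \<noteq> 0" for k using c[of "Suc k"] by (simp add: add_ac)
    then show "pochhammer c n \<noteq> 0" "pochhammer (c+1) n \<noteq> 0" "c \<noteq> 0"
      using c c[of 0] by (auto simp: pochhammer_eq_0_iff add_eq_0_iff2)
  qed
  have eq: "fps_X * fps_deriv (hgf a b (c+1)) + fps_const c * hgf a b (c+1) - fps_const c * hgf a b c = 0"
  proof (rule fps_ext)
    fix n
    have "pochhammer c n * (c + of_nat n) = c * pochhammer (c+1) n"
      by (metis pochhammer_Suc pochhammer_rec)
    then have "(of_nat n + c) / pochhammer (c+1) n = c / pochhammer c n"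
      using nz by (simp add: field_simps)
    then have "(of_nat n + c) / pochhammer (c+1) n * (pochhammer a n * pochhammer b n / fact n)
       = c / pochhammer c n * (pochhammer a n * pochhammer b n / fact n)"
      by simp
    then have "(of_nat n + c) * hgf a b (c+1) $ n = c * hgf a b c $ n"
      by (simp add: mult_ac)
    then show "(fps_X * fps_deriv (hgf a b (c+1)) + fps_const c * hgf a b (c+1) - fps_const c * hgf a b c) $ n = 0 $ n"
      by (cases n) (simp_all add: distrib_right del: of_nat_Suc fps_hypergeo_nth)
  qed
  have "(\<lambda>z. z * deriv G z + c * G z - c * F z) has_fps_expansion
      fps_X * fps_deriv (hgf a b (c+1)) + fps_const c * hgf a b (c+1) - fps_const c * hgf a b c"
    using F G unfolding HG_def
    by (intro has_fps_expansion_diff has_fps_expansion_add has_fps_expansion_mult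
        has_fps_expansion_fps_X has_fps_expansion_cmult_left has_fps_expansion_deriv) auto
  then have e: "(\<lambda>z. z * deriv G z + c * G z - c * F z) has_fps_expansion 0"
    by (simp only: eq)
  have h: "(\<lambda>z. z * deriv G z + c * G z - c * F z) holomorphic_on hyp2F1_domain"
    using F G unfolding HG_def by (intro holomorphic_intros open_hyp2F1_domain) auto
  from HG_identity[OF e h z] show ?thesis by simp
qed

text \<open>This is the derivative of (z (1 - z))^c G with the power divided out, which keeps
  everything holomorphic on the whole domain. Because 2c = a + b + 1, the coefficient of order n = k
  + 1 reduces to a multiple of n^2 - k n - n = 0.\<close>

lemma HG_weighted_deriv:
  assumes F: "HG a b c F" and G: "HG (a+1) (b+1) (c+1) G" and c: "\<And>n. c + of_nat n \<noteq> 0"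
    and abc: "a + b + 1 = 2 * c" and z: "z \<in> hyp2F1_domain"
  shows "z * (1 - z) * deriv G z + c * (1 - 2 * z) * G z = c * F z"
proof -
  have c': "c + 1 + of_nat n \<noteq> 0" for n
    using c[of "Suc n"] by (simp add: algebra_simps)
  define E where "E = hgf (a+1) (b+1) (c+1)"
  have F_Suc: "c * hgf a b c $ Suc n = a * b * E $ n / of_nat (Suc n)" for n
    using hypergeo_nth_Suc_shift[of c n a b] c[of 0]
    by (simp add: E_def field_simps del: of_nat_Suc fps_hypergeo_nth)
  have E_Suc: "(c + of_nat (Suc n)) * E $ Suc n =
      (a + of_nat (Suc n)) * (b + of_nat (Suc n)) / of_nat (Suc n) * E $ n" for n
    unfolding E_def using c[of "Suc n"]
    by (subst hypergeo_nth_Suc[OF c']) (simp add: divide_simps add_ac)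
  have eq: "fps_X * (1 - fps_X) * fps_deriv E + fps_const c * (1 - 2 * fps_X) * E - fps_const c * hgf a b c = 0"
    (is "?L = 0")
  proof (rule fps_ext)
    fix n
    show "?L $ n = 0 $ n"
    proof (cases n)
      case 0
      then show ?thesis by (simp add: E_def)
    next
      case (Suc k)
      have 1: "(fps_X * (1 - fps_X) * fps_deriv E) $ Suc k = of_nat (Suc k) * E $ Suc k - of_nat k * E $ k"
        by (cases k) (simp_all add: algebra_simps)
      have 2: "(fps_const c * (1 - 2 * fps_X) * E) $ Suc k = c * E $ Suc k - 2 * c * E $ k"
      proof -
        have "fps_const c * (1 - 2 * fps_X) * E = fps_const c * E - fps_const (2 * c) * (fps_X * E)"
          by (simp add: algebra_simps flip: numeral_fps_const fps_const_mult)
        then show ?thesis by (simp del: fps_const_mult)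
      qed
      have "?L $ Suc k = (c + of_nat (Suc k)) * E $ Suc k - (of_nat k + 2 * c) * E $ k - c * hgf a b c $ Suc k"
        unfolding fps_sub_nth fps_add_nth 1 2 by (simp add: algebra_simps)
      also have "\<dots> = ((a + of_nat (Suc k)) * (b + of_nat (Suc k)) - (of_nat k + (a + b + 1)) * of_nat (Suc k) - a * b) / of_nat (Suc k) * E $ k"
        unfolding E_Suc F_Suc abc by (simp add: field_simps del: of_nat_Suc)
      also have "\<dots> = 0"
        by (simp add: algebra_simps)
      finally show ?thesis using Suc by simp
    qed
  qed
  have "(\<lambda>z. z * (1 - z) * deriv G z + c * (1 - 2 * z) * G z - c * F z) has_fps_expansion
     fps_X * (1 - fps_X) * fps_deriv E + fps_const c * (1 - 2 * fps_X) * E - fps_const c * hgf a b c"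
    using F G unfolding HG_def E_def
    by (intro has_fps_expansion_diff has_fps_expansion_add has_fps_expansion_mult
        has_fps_expansion_fps_X has_fps_expansion_const has_fps_expansion_deriv
        has_fps_expansion_1 has_fps_expansion_numeral) auto
  then have e: "(\<lambda>z. z * (1 - z) * deriv G z + c * (1 - 2 * z) * G z - c * F z) has_fps_expansion 0"
    by (simp only: eq)
  have h: "(\<lambda>z. z * (1 - z) * deriv G z + c * (1 - 2 * z) * G z - c * F z) holomorphic_on hyp2F1_domain"
    using F G unfolding HG_def by (intro holomorphic_intros open_hyp2F1_domain) auto
  from HG_identity[OF e h z] show ?thesis by simp
qed

text \<open>The origin is a singular point of the hypergeometric equation. As c + n never vanishes,
  the recursion determines the germ of a holomorphic solution from its value at 0. The equation may
  be checked on any small open set, since it propagates by analytic continuation.\<close>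

lemma HG_ode:
  assumes F: "F holomorphic_on hyp2F1_domain" and F0: "F 0 = 1" and c: "\<And>n. c + of_nat n \<noteq> 0"
    and U: "open U" "U \<noteq> {}" "U \<subseteq> hyp2F1_domain"
    and ode: "\<And>z. z \<in> U \<Longrightarrow> z * (1 - z) * deriv (deriv F) z + (c - (a + b + 1) * z) * deriv F z - a * b * F z = 0"
  shows "HG a b c F"
proof -
  let ?D = hyp2F1_domain
  note op = open_hyp2F1_domain
  have hol: "(\<lambda>z. z * (1 - z) * deriv (deriv F) z + (c - (a + b + 1) * z) * deriv F z - a * b * F z) holomorphic_on ?D"
    by (intro holomorphic_intros F op)
  have ode': "z * (1 - z) * deriv (deriv F) z + (c - (a + b + 1) * z) * deriv F z - a * b * F z = 0" if "z \<in> ?D" for z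
    by (rule analytic_continuation_open[OF U(1) op U(2) connected_hyp2F1_domain U(3) hol _ ode that]) auto
  have "F analytic_on {0}"
    using F op by (auto simp: analytic_at)
  then obtain G where G: "F has_fps_expansion G"
    using analytic_at_imp_has_fps_expansion_0 by blast
  have G0: "G $ 0 = 1"
    using has_fps_expansion_imp_0_eq_fps_nth_0[OF G] F0 by simp
  define L where "L = fps_X * (1 - fps_X) * fps_deriv (fps_deriv G) +
     (fps_const c - fps_const (a+b+1) * fps_X) * fps_deriv G - fps_const (a * b) * G"
  have "(\<lambda>z. z * (1 - z) * deriv (deriv F) z + (c - (a + b + 1) * z) * deriv F z - a * b * F z) has_fps_expansion L"
    unfolding L_def
    by (intro has_fps_expansion_diff has_fps_expansion_add has_fps_expansion_mult
        has_fps_expansion_fps_X has_fps_expansion_const has_fps_expansion_deriv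
        has_fps_expansion_1 G)
  moreover have "(\<lambda>z. z * (1 - z) * deriv (deriv F) z + (c - (a + b + 1) * z) * deriv F z - a * b * F z) has_fps_expansion 0"
    unfolding has_fps_expansion_0_iff using ode' eventually_nhds_in_open[OF op zero_in_hyp2F1_domain]
    by (auto elim: eventually_mono)
  ultimately have L0: "L = 0"
    using fps_expansion_unique_complex by blast
  have rec: "of_nat (Suc n) * (c + of_nat n) * G $ Suc n = (a + of_nat n) * (b + of_nat n) * G $ n" for n
  proof -
    have 1: "(fps_X * (1 - fps_X) * fps_deriv (fps_deriv G)) $ n
        = of_nat (Suc n) * of_nat n * G $ Suc n - of_nat n * (of_nat n - 1) * G $ n"
      by (cases n; cases "n - 1") (simp_all add: algebra_simps)
    have 2: "((fps_const c - fps_const (a+b+1) * fps_X) * fps_deriv G) $ n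
        = c * of_nat (Suc n) * G $ Suc n - (a+b+1) * of_nat n * G $ n"
      by (cases n) (simp_all add: algebra_simps)
    have "0 = L $ n" using L0 by simp
    also have "\<dots> = of_nat (Suc n) * (c + of_nat n) * G $ Suc n - (a + of_nat n) * (b + of_nat n) * G $ n"
      unfolding L_def fps_sub_nth fps_add_nth 1 2 by (simp add: algebra_simps)
    finally show ?thesis by simp
  qed
  have "G $ n = hgf a b c $ n" for n
  proof (induction n)
    case 0
    then show ?case using G0 by simp
  next
    case (Suc n)
    then have "(of_nat (Suc n) * (c + of_nat n)) * G $ Suc n = (a + of_nat n) * (b + of_nat n) * hgf a b c $ n"
      using rec[of n] by simp
    then have "G $ Suc n = (a + of_nat n) * (b + of_nat n) * hgf a b c $ n / (of_nat (Suc n) * (c + of_nat n))"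
      using c[of n] by (simp add: nonzero_eq_divide_eq mult_ac del: of_nat_Suc fps_hypergeo_nth)
    then show ?case
      unfolding hypergeo_nth_Suc[OF c] by (simp add: mult_ac)
  qed
  then have "G = hgf a b c" by (rule fps_ext)
  then show ?thesis using F G unfolding HG_def by simp
qed

lemma hyp2F1_domain_starlike:
  assumes "z \<in> hyp2F1_domain" "0 \<le> s" "s \<le> 1"
  shows "z * of_real s \<in> hyp2F1_domain"
proof (cases "s = 0 \<or> Im z \<noteq> 0")
  case True
  then show ?thesis using assms by (auto simp: hyp2F1_domain_altdef)
next
  case False
  then have "Re z * s < 1" using assms
    by (smt (verit, best) hyp2F1_domain_altdef mult_left_le mult_nonpos_nonneg)
  then show ?thesis by (auto simp: hyp2F1_domain_altdef)
qed

text \<open>Bateman's fractional integral: averaging \<open>F\<close> along rays multiplies the \<open>n\<close>-th coefficient by the \<open>n\<close>-th moment, and the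
  assumption \<open>M\<close> makes these moments \<open>(c)\<^sub>n / (d)\<^sub>n\<close>.\<close>

lemma HG_average:
  fixes w s :: "real \<Rightarrow> real"
  assumes F: "HG a b c F" and pq: "p \<le> q"
    and w: "continuous_on {p..q} w" and s: "continuous_on {p..q} s"
    and s01: "\<And>x. x \<in> {p..q} \<Longrightarrow> 0 \<le> s x \<and> s x \<le> 1"
    and M0: "integral {p..q} w = 1"
    and M: "\<And>n. (d + of_nat n) * of_real (integral {p..q} (\<lambda>x. w x * s x ^ Suc n)) =
        (c + of_nat n) * of_real (integral {p..q} (\<lambda>x. w x * s x ^ n))"
    and c: "\<And>n. c + of_nat n \<noteq> 0" and d: "\<And>n. d + of_nat n \<noteq> 0"
  shows "HG a b d (\<lambda>z. integral {p..q} (\<lambda>x. of_real (w x) * F (z * of_real (s x))))"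
    (is "HG _ _ _ ?\<Phi>")
proof -
  let ?D = hyp2F1_domain
  have Fh: "F holomorphic_on ?D" and Ff: "F has_fps_expansion hgf a b c"
    using F unfolding HG_def by auto
  have Fc: "continuous_on ?D F" and dFc: "continuous_on ?D (deriv F)"
    using Fh by (auto intro!: holomorphic_on_imp_continuous_on holomorphic_intros open_hyp2F1_domain)
  \<comment> \<open>Holomorphy is local, and on balls, which are convex, the Leibniz rule for
    parameter integrals applies.\<close>
  have "?\<Phi> holomorphic_on ball z0 e" if "ball z0 e \<subseteq> ?D" for z0 e
  proof -
    have in_D: "z * of_real (s x) \<in> ?D" if "z \<in> ball z0 e" "x \<in> {p..q}" for z x
      using that \<open>ball z0 e \<subseteq> ?D\<close> s01 by (intro hyp2F1_domain_starlike) auto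
    have "(\<lambda>z. integral (cbox p q) (\<lambda>x. of_real (w x) * F (z * of_real (s x)))) holomorphic_on ball z0 e"
    proof (rule leibniz_rule_holomorphic)
      fix z x assume zx: "z \<in> ball z0 e" "x \<in> cbox p q"
      then have "z * of_real (s x) \<in> ?D" using in_D by auto
      then have "(F has_field_derivative deriv F (z * of_real (s x))) (at (z * of_real (s x)))"
        using Fh holomorphic_derivI open_hyp2F1_domain by blast
      then have "((\<lambda>z. F (z * of_real (s x))) has_field_derivative deriv F (z * of_real (s x)) * of_real (s x)) (at z within ball z0 e)"
        by (rule DERIV_chain2) (auto intro!: derivative_eq_intros)
      then show "((\<lambda>z. of_real (w x) * F (z * of_real (s x))) has_field_derivative
          of_real (w x) * (deriv F (z * of_real (s x)) * of_real (s x))) (at z within ball z0 e)"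
        by (intro DERIV_cmult)
    next
      fix z assume "z \<in> ball z0 e"
      then show "(\<lambda>x. of_real (w x) * F (z * of_real (s x))) integrable_on cbox p q"
        using in_D w s
        by (intro integrable_continuous continuous_intros continuous_on_compose2[OF Fc]) auto
    next
      have w': "continuous_on (ball z0 e \<times> {p..q}) (\<lambda>y. w (snd y))"
        and s': "continuous_on (ball z0 e \<times> {p..q}) (\<lambda>y. s (snd y))"
        by (auto intro!: continuous_on_compose2[OF w] continuous_on_compose2[OF s] continuous_intros)
      show "continuous_on (ball z0 e \<times> cbox p q)
        (\<lambda>(z, x). of_real (w x) * (deriv F (z * of_real (s x)) * of_real (s x)))"
        unfolding case_prod_beta using in_D w' s'
        by (intro continuous_intros continuous_on_compose2[OF dFc]) auto
    qed auto
    then show ?thesis by simp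
  qed
  then have hol: "?\<Phi> holomorphic_on ?D"
    using open_hyp2F1_domain unfolding open_contains_ball
    by (smt (verit, best) analytic_on_holomorphic analytic_on_def analytic_imp_holomorphic)
  define m where "m n = integral {p..q} (\<lambda>x. w x * s x ^ n)" for n
  have coeff: "hgf a b c $ n * of_real (m n) = hgf a b d $ n" for n
  proof (induction n)
    case 0
    then show ?case using M0 by (simp add: m_def)
  next
    case (Suc n)
    have "of_real (m (Suc n)) = (c + of_nat n) * of_real (m n) / (d + of_nat n)"
      using M[of n] d[of n] by (simp add: m_def field_simps)
    then show ?case unfolding hypergeo_nth_Suc[OF c] hypergeo_nth_Suc[OF d] Suc.IH[symmetric] using c[of n] d[of n]
      by (simp add: divide_simps del: of_nat_Suc)
  qed
  obtain W where W: "\<And>x. x \<in> {p..q} \<Longrightarrow> \<bar>w x\<bar> \<le> W"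
    using compact_continuous_image[OF w] compact_imp_bounded bounded_real
    by (metis compact_Icc imageI)
  \<comment> \<open>The bound by 1 makes the power series sum to \<open>F\<close>; the bound by the
    radius of convergence gives the absolute summability for the M-test. Both hold near 0, which is
    enough for a germ.\<close>
  have "(\<lambda>n. hgf a b d $ n * u ^ n) sums ?\<Phi> u" if u: "norm u < 1" "ereal (norm u) < fps_conv_radius (hgf a b c)" for u
  proof -
    have Fs: "(\<lambda>n. hgf a b c $ n * z ^ n) sums F z" if "norm z < 1" for z
      using has_fps_expansion_imp_sums_complex[OF Ff, of 1 z] that Fh
        holomorphic_on_subset[OF Fh ball_subset_hyp2F1_domain] by (simp add: one_ereal_def)
    let ?f = "\<lambda>n x. of_real (w x) * (hgf a b c $ n * (u * of_real (s x)) ^ n)"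
    have us: "norm (u * of_real (s x)) < 1" if "x \<in> {p..q}" for x
      using s01[OF that] u(1) by (simp add: norm_mult) (smt (verit) mult_left_le norm_ge_zero)
    have uni: "uniform_limit {p..q} (\<lambda>n x. \<Sum>i<n. ?f i x) (\<lambda>x. suminf (\<lambda>n. ?f n x)) sequentially"
    proof (rule Weierstrass_m_test)
      fix n x assume x: "x \<in> {p..q}"
      have "norm (?f n x) = \<bar>w x\<bar> * (norm (hgf a b c $ n * u ^ n) * s x ^ n)"
        using s01[OF x] by (simp add: norm_mult norm_power power_mult_distrib del: fps_hypergeo_nth)
      also have "\<dots> \<le> W * (norm (hgf a b c $ n * u ^ n) * 1)"
        using s01[OF x] W[OF x] by (intro mult_mono power_le_one mult_nonneg_nonneg) auto
      finally show "norm (?f n x) \<le> W * norm (hgf a b c $ n * u ^ n)" by simp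
    next
      show "summable (\<lambda>n. W * norm (hgf a b c $ n * u ^ n))"
        by (intro summable_mult norm_summable_fps u)
    qed
    have lim: "uniform_limit {p..q} (\<lambda>n x. \<Sum>i<n. ?f i x) (\<lambda>x. of_real (w x) * F (u * of_real (s x))) sequentially"
    proof (rule uniform_limit_cong'[THEN iffD1, OF _ _ uni])
      fix x assume "x \<in> {p..q}"
      then show "suminf (\<lambda>n. ?f n x) = of_real (w x) * F (u * of_real (s x))"
        using sums_unique[OF sums_mult[OF Fs[OF us]]] by simp
    qed auto
    have int: "?f i integrable_on {p..q}" for i
      by (intro integrable_continuous_real continuous_intros w s)
    have "(\<lambda>n. integral {p..q} (\<lambda>x. \<Sum>i<n. ?f i x)) \<longlonglongrightarrow> ?\<Phi> u"
    proof -
      obtain I J where IJ: "\<And>n. ((\<lambda>x. \<Sum>i<n. ?f i x) has_integral I n) {p..q}"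
         "((\<lambda>x. of_real (w x) * F (u * of_real (s x))) has_integral J) {p..q}" "I \<longlonglongrightarrow> J"
        by (rule uniform_limit_integral[OF lim])
          (auto intro!: continuous_intros w s simp del: fps_hypergeo_nth)
      show ?thesis
        unfolding integral_unique[OF IJ(1)] integral_unique[OF IJ(2)] by (rule IJ(3))
    qed
    moreover have "integral {p..q} (?f i) = hgf a b d $ i * u ^ i" for i
    proof -
      have "((\<lambda>x. w x * s x ^ i) has_integral m i) {p..q}" unfolding m_def
        by (intro integrable_integral integrable_continuous_real continuous_intros w s)
      from has_integral_of_real[OF this, where 'b=complex]
      have "((\<lambda>x. (hgf a b c $ i * u ^ i) * of_real (w x * s x ^ i)) has_integral
          (hgf a b c $ i * u ^ i) * of_real (m i)) {p..q}"
        by (rule has_integral_mult_right)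
      then have "((\<lambda>x. ?f i x) has_integral (hgf a b c $ i * u ^ i) * of_real (m i)) {p..q}"
        by (rule has_integral_eq[rotated]) (simp add: power_mult_distrib mult_ac)
      then have "integral {p..q} (?f i) = (hgf a b c $ i * u ^ i) * of_real (m i)"
        by (rule integral_unique)
      then show ?thesis by (simp only: coeff[symmetric] mult_ac)
    qed
    then have "integral {p..q} (\<lambda>x. \<Sum>i<n. ?f i x) = (\<Sum>i<n. hgf a b d $ i * u ^ i)" for n
      by (subst integral_sum) (auto intro: int simp del: fps_hypergeo_nth)
    ultimately show ?thesis unfolding sums_def by (simp del: fps_hypergeo_nth)
  qed
  moreover have "eventually (\<lambda>u. u \<in> eball 0 (min 1 (fps_conv_radius (hgf a b c)))) (nhds 0)"
    using Ff unfolding has_fps_expansion_def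
    by (intro eventually_nhds_in_open) (auto simp: zero_ereal_def[symmetric])
  ultimately have "?\<Phi> has_fps_expansion hgf a b d"
    by (intro has_fps_expansionI) (auto elim!: eventually_mono simp: one_ereal_def)
  with hol show ?thesis unfolding HG_def by simp
qed

text \<open>Across the negative axis \<open>csqrt\<close> only changes its sign, which an even function does not see.\<close>

lemma even_holomorphic_csqrt:
  assumes K: "K holomorphic_on {w. w\<^sup>2 \<in> hyp2F1_domain}" and even: "\<And>w. K (- w) = K w"
  shows "(\<lambda>z. K (csqrt z)) holomorphic_on hyp2F1_domain"
proof -
  let ?D = hyp2F1_domain and ?k = "\<lambda>z. K (csqrt z)"
  have op: "open {w :: complex. w\<^sup>2 \<in> ?D}"
    using open_vimage[OF open_hyp2F1_domain, of "\<lambda>w. w\<^sup>2"] by (simp add: vimage_def continuous_intros)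
  \<comment> \<open>The second expression has its jump on the positive axis instead of the negative
    one. Together the two cover the domain except 0, where continuity removes the
    singularity.\<close>
  have alt: "K (csqrt z) = K (\<i> * csqrt (- z))" for z
  proof -
    have "(csqrt z)\<^sup>2 = (\<i> * csqrt (- z))\<^sup>2" by (simp add: power_mult_distrib)
    then have "csqrt z = \<i> * csqrt (- z) \<or> csqrt z = - (\<i> * csqrt (- z))" by (rule power2_eq_iff[THEN iffD1])
    then show ?thesis using even by metis
  qed
  have 1: "?k holomorphic_on ?D - \<real>\<^sub>\<le>\<^sub>0"
    by (rule holomorphic_on_compose_gen[OF _ K, unfolded o_def]) (auto intro!: holomorphic_intros)
  have "(\<lambda>z. K (\<i> * csqrt (- z))) holomorphic_on ?D - \<real>\<^sub>\<ge>\<^sub>0"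
    by (rule holomorphic_on_compose_gen[OF _ K, unfolded o_def])
       (auto intro!: holomorphic_intros simp: power_mult_distrib)
  then have 2: "?k holomorphic_on ?D - \<real>\<^sub>\<ge>\<^sub>0"
    by (simp add: alt)
  have eq: "?D - {0} = (?D - \<real>\<^sub>\<le>\<^sub>0) \<union> (?D - \<real>\<^sub>\<ge>\<^sub>0)"
    by (auto simp: complex_nonpos_Reals_iff complex_nonneg_Reals_iff complex_eq_iff)
  have 3: "?k holomorphic_on ?D - {0}"
    unfolding eq using 1 2 open_hyp2F1_domain
    by (intro holomorphic_on_Un) (auto intro!: open_Diff)
  have 4: "(?k \<longlongrightarrow> ?k 0) (at 0 within ?D)"
  proof -
    have "isCont K 0"
      using holomorphic_on_imp_continuous_on[OF K] continuous_on_eq_continuous_at[OF op, of K] by simp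
    moreover have "(csqrt \<longlongrightarrow> csqrt 0) (at 0)"
    proof -
      have "((\<lambda>z::complex. sqrt (norm z)) \<longlongrightarrow> sqrt (norm (0::complex))) (at 0)"
        by (rule tendsto_real_sqrt[OF tendsto_norm[OF tendsto_ident_at]])
      then have "((\<lambda>z. norm (csqrt z)) \<longlongrightarrow> 0) (at 0)" by simp
      then have "(csqrt \<longlongrightarrow> 0) (at 0)" by (rule tendsto_norm_zero_cancel)
      then show ?thesis by simp
    qed
    ultimately have "(?k \<longlongrightarrow> K (csqrt 0)) (at 0)"
      using isCont_tendsto_compose[of "csqrt 0" K] by simp
    then show ?thesis by (rule tendsto_within_subset) auto
  qed
  have 5: "(?k \<longlongrightarrow> ?k z) (at z within ?D)" if "z \<in> {0}" for z
    using that 4 by (simp only: singleton_iff)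
  show ?thesis
    by (rule no_isolated_singularity'[OF 5 3 open_hyp2F1_domain]) auto
qed

section \<open>Closed forms at lower parameter 1/2\<close>

text \<open>For z = sin^2 x this is cosh(2 t x), and at z = -v it becomes cos(t rho(v)).\<close>

definition cosArcsin :: "real \<Rightarrow> complex \<Rightarrow> complex" where
  "cosArcsin t z = cosh (2 * of_real t * Arcsin (csqrt z))"

text \<open>Arcsin(w) and Arcsin(-w) are -i times the logarithms of two mutually inverse numbers
  \<open>a\<close> and \<open>b\<close>. Their logarithms are opposite unless both lie on the
  negative axis, which is excluded since \<open>a + b\<close> is twice a principal square root and
  so has nonnegative real part.\<close>

lemma Arcsin_minus_eq:
  assumes "w\<^sup>2 \<in> hyp2F1_domain" shows "Arcsin (- w) = - Arcsin w"
proof -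
  define r where "r = csqrt (1 - w\<^sup>2)"
  define a b where "a = \<i> * w + r" and "b = - \<i> * w + r"
  have ab: "a * b = 1"
    unfolding a_def b_def r_def by (simp add: algebra_simps flip: power2_eq_square)
  have "a \<notin> \<real>\<^sub>\<le>\<^sub>0"
  proof
    assume *: "a \<in> \<real>\<^sub>\<le>\<^sub>0"
    have "inverse a = b" using ab by (simp add: inverse_unique)
    then have "b \<in> \<real>\<^sub>\<le>\<^sub>0" using * nonpos_Reals_inverse_iff by blast
    moreover have "a \<noteq> 0" "b \<noteq> 0" using ab by auto
    ultimately have "Re (a + b) < 0"
      using * by (auto simp: complex_nonpos_Reals_iff complex_eq_iff add_neg_neg less_le)
    moreover have "Re (a + b) = 2 * Re r" by (simp add: a_def b_def)
    moreover have "Re r \<ge> 0" unfolding r_def using csqrt_principal[of "1 - w\<^sup>2"] by auto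
    ultimately show False by simp
  qed
  moreover have "inverse a = b" using ab by (simp add: inverse_unique)
  ultimately have "Ln b = - Ln a" using Ln_inverse by metis
  then show ?thesis unfolding Arcsin_def a_def b_def r_def by simp
qed

lemma cosArcsin_holomorphic: "cosArcsin t holomorphic_on hyp2F1_domain"
proof -
  \<comment> \<open>Extended by 0 because \<open>even_holomorphic_csqrt\<close> asks for evenness at
    every point, while \<open>Arcsin_minus_eq\<close> gives it only where w^2 lies in the
    domain.\<close>
  define K where "K w = (if w\<^sup>2 \<in> hyp2F1_domain then cosh (2 * of_real t * Arcsin w) else 0)" for w
  have "K holomorphic_on {w. w\<^sup>2 \<in> hyp2F1_domain}"
  proof (subst holomorphic_cong[OF refl])
    show "K w = cosh (2 * of_real t * Arcsin w)" if "w \<in> {w. w\<^sup>2 \<in> hyp2F1_domain}" for w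
      using that by (simp add: K_def)
    have *: "\<bar>Re w\<bar> < 1" if "w\<^sup>2 \<in> hyp2F1_domain" "Im w = 0" for w
    proof -
      have "(Re w)\<^sup>2 < 1\<^sup>2" using that by (simp add: hyp2F1_domain_altdef)
      then show ?thesis using abs_square_less_1 by fastforce
    qed
    have "Arcsin holomorphic_on {w. w\<^sup>2 \<in> hyp2F1_domain}"
      by (intro holomorphic_on_Arcsin *) auto
    then show "(\<lambda>w. cosh (2 * of_real t * Arcsin w)) holomorphic_on {w. w\<^sup>2 \<in> hyp2F1_domain}"
      unfolding cosh_def
      by (intro holomorphic_on_scaleR holomorphic_on_add holomorphic_on_const holomorphic_on_mult holomorphic_on_exp' holomorphic_on_minus)
  qed
  moreover have "K (- w) = K w" for w
    by (simp add: K_def Arcsin_minus_eq)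
  ultimately have "(\<lambda>z. K (csqrt z)) holomorphic_on hyp2F1_domain"
    by (rule even_holomorphic_csqrt)
  then show ?thesis
    by (rule holomorphic_transform) (simp add: K_def cosArcsin_def)
qed

lemma cosArcsin_0 [simp]: "cosArcsin t 0 = 1"
  by (simp add: cosArcsin_def)

lemma cosArcsin_neg:
  assumes "v \<ge> 0" shows "cosArcsin t (- of_real v) = of_real (cos (t * rho v))"
proof -
  have "csqrt (- of_real v) = \<i> * of_real (sqrt v)"
    using assms csqrt_minus[of "of_real v"] by simp
  moreover have "Arcsin (\<i> * of_real x) = \<i> * of_real (arsinh x)" for x
  proof -
    have "csqrt (1 - (\<i> * of_real x)\<^sup>2) = of_real (sqrt (x\<^sup>2 + 1))"
    proof -
      have "1 - (\<i> * of_real x)\<^sup>2 = complex_of_real (x\<^sup>2 + 1)"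
        by (simp add: power_mult_distrib)
      then show ?thesis
        by (simp del: of_real_add)
    qed
    then have "\<i> * (\<i> * of_real x) + csqrt (1 - (\<i> * of_real x)\<^sup>2) = of_real (- x + sqrt (x\<^sup>2 + 1))"
      by (simp flip: mult.assoc)
    then have "Arcsin (\<i> * of_real x) = - \<i> * Ln (of_real (- x + sqrt (x\<^sup>2 + 1)))"
      unfolding Arcsin_def by (simp only:)
    also have "Ln (of_real (- x + sqrt (x\<^sup>2 + 1))) = of_real (ln (- x + sqrt (x\<^sup>2 + 1)))"
      using arsinh_real_aux[of "- x"] by (intro Ln_of_real) simp
    also have "ln (- x + sqrt (x\<^sup>2 + 1)) = - arsinh x"
      using arsinh_minus_real[of x] by (simp add: arsinh_real_def)
    finally show ?thesis by simp
  qed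
  ultimately have "cosArcsin t (- of_real v) = cosh (\<i> * of_real (t * rho v))"
    by (simp add: cosArcsin_def rho_def mult_ac)
  also have "\<dots> = of_real (cos (t * rho v))"
    by (simp add: cosh_conv_cos flip: mult.assoc of_real_mult cos_of_real)
  finally show ?thesis .
qed

text \<open>In the coordinate z = sin^2 x the equation says that the second x-derivative is 4 t^2
  times the function, which is clear for cosh(2 t x). It is verified on a disc around 1/2, away from
  the singular points 0 and 1 and from the cut of \<open>csqrt\<close>, and then continued.\<close>

lemma cosArcsin_ode:
  assumes "z \<in> hyp2F1_domain"
  shows "z * (1 - z) * deriv (deriv (cosArcsin t)) z + (1/2 - z) * deriv (cosArcsin t) z - of_real (t\<^sup>2) * cosArcsin t z = 0"
proof -
  let ?D = hyp2F1_domain and ?k = "cosArcsin t" and ?U = "ball (1/2) (1/4) :: complex set"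
  have hol: "(\<lambda>z. z * (1 - z) * deriv (deriv ?k) z + (1/2 - z) * deriv ?k z - of_real (t\<^sup>2) * ?k z) holomorphic_on ?D"
    by (intro holomorphic_intros cosArcsin_holomorphic open_hyp2F1_domain)
  have U: "z \<notin> \<real>\<^sub>\<le>\<^sub>0" "1 - z \<notin> \<real>\<^sub>\<le>\<^sub>0" "Re z < 1" "z \<noteq> 0" "z \<noteq> 1" if "z \<in> ?U" for z
  proof -
    have "\<bar>Re (1/2 - z)\<bar> < 1/4"
      using that abs_Re_le_cmod[of "1/2 - z"] by (simp add: dist_norm)
    then have "\<bar>1/2 - Re z\<bar> < 1/4" by simp
    then have *: "0 < Re z" "Re z < 1" by linarith+
    show "z \<notin> \<real>\<^sub>\<le>\<^sub>0" "1 - z \<notin> \<real>\<^sub>\<le>\<^sub>0" "Re z < 1" "z \<noteq> 0" "z \<noteq> 1"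
      using * by (auto simp: complex_nonpos_Reals_iff)
  qed
  define x where "x z = Arcsin (csqrt z)" for z
  have sx: "sin (2 * x z) \<noteq> 0" and sx2: "(sin (2 * x z))\<^sup>2 = 4 * z * (1 - z)"
    and cx: "cos (2 * x z) = 1 - 2 * z"
    and dx: "(x has_field_derivative 1 / sin (2 * x z)) (at z)" if z: "z \<in> ?U" for z
  proof -
    have s: "(sin (x z))\<^sup>2 = z" by (simp add: x_def)
    then have c: "(cos (x z))\<^sup>2 = 1 - z" by (simp add: cos_squared_eq)
    show 1: "(sin (2 * x z))\<^sup>2 = 4 * z * (1 - z)"
      unfolding sin_double by (simp add: power_mult_distrib s c)
    then show 2: "sin (2 * x z) \<noteq> 0" using U[OF z] by auto
    show "cos (2 * x z) = 1 - 2 * z" by (simp add: cos_double s c)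
    have Re_lt: "\<bar>Re w\<bar> < 1" if "Im w = 0" "w = csqrt z" for w
    proof -
      have "z = w\<^sup>2" using that by simp
      then have "Re z = (Re w)\<^sup>2 - (Im w)\<^sup>2" by (simp add: Re_power2)
      then have "(Re w)\<^sup>2 < 1" using that(1) U[OF z] by simp
      then show ?thesis using abs_square_less_1 by blast
    qed
    have "(x has_field_derivative inverse (cos (Arcsin (csqrt z))) * inverse (2 * csqrt z)) (at z)"
      unfolding x_def
      by (rule DERIV_chain2[OF has_field_derivative_Arcsin has_field_derivative_csqrt[OF U(1)[OF z]]])
         (rule Re_lt[OF _ refl])
    moreover have "sin (x z) = csqrt z" by (simp add: x_def)
    moreover have "Arcsin (csqrt z) = x z" by (simp only: x_def)
    moreover have "inverse (cos (x z)) * inverse (2 * sin (x z)) = 1 / sin (2 * x z)"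
      unfolding sin_double divide_inverse by (simp only: inverse_mult_distrib mult_1_left mult_ac)
    ultimately show "(x has_field_derivative 1 / sin (2 * x z)) (at z)" by (simp only:)
  qed
  have k: "?k = (\<lambda>z. cosh (2 * of_real t * x z))"
    by (auto simp: cosArcsin_def x_def)
  have d1: "(?k has_field_derivative 2 * of_real t * sinh (2 * of_real t * x z) / sin (2 * x z)) (at z)" if "z \<in> ?U" for z
    unfolding k by (rule derivative_eq_intros dx that refl)+ simp
  have d1': "deriv ?k z = 2 * of_real t * sinh (2 * of_real t * x z) / sin (2 * x z)" if "z \<in> ?U" for z
    using d1[OF that] by (rule DERIV_imp_deriv)
  have d2: "deriv (deriv ?k) z = (4 * of_real t ^ 2 * cosh (2 * of_real t * x z)
        - 4 * of_real t * sinh (2 * of_real t * x z) * cos (2 * x z) / sin (2 * x z)) / (sin (2 * x z))\<^sup>2"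
    if z: "z \<in> ?U" for z
  proof -
    have "((\<lambda>z. 2 * of_real t * sinh (2 * of_real t * x z) / sin (2 * x z)) has_field_derivative
       (4 * of_real t ^ 2 * cosh (2 * of_real t * x z)
        - 4 * of_real t * sinh (2 * of_real t * x z) * cos (2 * x z) / sin (2 * x z)) / (sin (2 * x z))\<^sup>2) (at z)"
      apply (rule derivative_eq_intros dx[OF z] refl sx[OF z])+
      using sx[OF z] by (simp add: field_simps power2_eq_square)
    then have "(deriv ?k has_field_derivative (4 * of_real t ^ 2 * cosh (2 * of_real t * x z)
        - 4 * of_real t * sinh (2 * of_real t * x z) * cos (2 * x z) / sin (2 * x z)) / (sin (2 * x z))\<^sup>2) (at z)"
      by (rule has_field_derivative_transform_within_open[OF _ _ z]) (auto simp: d1')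
    then show ?thesis by (rule DERIV_imp_deriv)
  qed
  have "z * (1 - z) * deriv (deriv ?k) z + (1/2 - z) * deriv ?k z - of_real (t\<^sup>2) * ?k z = 0" if z: "z \<in> ?U" for z
  proof -
    have "z * (1 - z) = (sin (2 * x z))\<^sup>2 / 4" using sx2[OF z] by simp
    moreover have "1/2 - z = cos (2 * x z) / 2" using cx[OF z] by simp
    moreover have "S\<^sup>2 / 4 * ((4 * \<tau>^2 * C - 4 * \<tau> * H * c / S) / S\<^sup>2) + c / 2 * (2 * \<tau> * H / S) - \<tau>\<^sup>2 * C = 0"
      if "S \<noteq> 0" for S \<tau> C H c :: complex
      using that by (simp add: field_simps power2_eq_square)
    ultimately show ?thesis
      unfolding d2[OF z] d1'[OF z] unfolding k using sx[OF z] by (simp only: of_real_power not_False_eq_True)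
  qed
  moreover have "?U \<subseteq> ?D"
    using U(3) by (auto simp: hyp2F1_domain_altdef)
  ultimately show ?thesis
    by (intro analytic_continuation_open[OF _ open_hyp2F1_domain _ connected_hyp2F1_domain _ hol _ _ assms, of ?U "\<lambda>_. 0"]) auto
qed

lemma hyp2F1_domain_nonempty [simp]: "hyp2F1_domain \<noteq> {}"
  using zero_in_hyp2F1_domain by blast

lemma HG_cosArcsin: "HG (\<i> * of_real t) (- (\<i> * of_real t)) (1/2) (cosArcsin t)"
proof (rule HG_ode[OF cosArcsin_holomorphic])
  show "1/2 + of_nat n \<noteq> (0::complex)" for n
    by (auto simp: complex_eq_iff)
  show "z * (1 - z) * deriv (deriv (cosArcsin t)) z + (1/2 - (\<i> * of_real t + - (\<i> * of_real t) + 1) * z) * deriv (cosArcsin t) z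
     - \<i> * of_real t * - (\<i> * of_real t) * cosArcsin t z = 0" if "z \<in> hyp2F1_domain" for z
  proof -
    have "\<i> * of_real t * - (\<i> * of_real t) = complex_of_real (t\<^sup>2)"
      by (simp add: complex_eq_iff power2_eq_square)
    then show ?thesis
      using cosArcsin_ode[OF that, of t] by simp
  qed
qed (use open_hyp2F1_domain zero_in_hyp2F1_domain in auto)

text \<open>Euler's transformation of \<open>cosArcsin\<close>: the factor (1 - z) to the power c -
  a - b = -1/2 turns the upper parameters into c - a and c - b. This gives the upper parameters of
  the case c = 1 while the lower one is still 1/2.\<close>

definition cosArcsin2 :: "real \<Rightarrow> complex \<Rightarrow> complex" where
  "cosArcsin2 t z = cosArcsin t z / csqrt (1 - z)"

lemma HG_cosArcsin2: "HG (1/2 + \<i> * of_real t) (1/2 - \<i> * of_real t) (1/2) (cosArcsin2 t)"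
proof -
  let ?k = "cosArcsin t"
  note op = open_hyp2F1_domain
  have q: "1 - z \<notin> \<real>\<^sub>\<le>\<^sub>0" "csqrt (1 - z) \<noteq> 0" "z \<noteq> 1" "(csqrt (1 - z))\<^sup>2 = 1 - z" if "z \<in> hyp2F1_domain" for z
    using that by (auto simp: hyp2F1_domain_altdef complex_nonpos_Reals_iff)
  have dk: "(?k has_field_derivative deriv ?k z) (at z)"
    "(deriv ?k has_field_derivative deriv (deriv ?k) z) (at z)" if "z \<in> hyp2F1_domain" for z
    by (rule holomorphic_derivI[OF cosArcsin_holomorphic op that]
          holomorphic_derivI[OF holomorphic_deriv[OF cosArcsin_holomorphic op] op that])+
  \<comment> \<open>Since r' = r^3 / 2 and z = 1 - 1/r^2, the differential equation becomes
    polynomial in \<open>r\<close> and 1/\<open>r\<close>.\<close>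
  define r where "r z = 1 / csqrt (1 - z)" for z
  have dr: "(r has_field_derivative r z ^ 3 / 2) (at z)" if z: "z \<in> hyp2F1_domain" for z
  proof -
    have "((\<lambda>z. csqrt (1 - z)) has_field_derivative (0 - 1) / (2 * csqrt (1 - z))) (at z)"
      by (intro has_field_derivative_csqrt' derivative_intros q(1)[OF z])
    from DERIV_inverse'[OF this q(2)[OF z]]
    have "((\<lambda>z. inverse (csqrt (1 - z))) has_field_derivative
        - (inverse (csqrt (1 - z)) * ((0 - 1) / (2 * csqrt (1 - z))) * inverse (csqrt (1 - z)))) (at z)" .
    moreover have "r = (\<lambda>z. inverse (csqrt (1 - z)))"
      by (simp add: r_def fun_eq_iff inverse_eq_divide)
    moreover have "- (inverse s * ((0 - 1) / (2 * s)) * inverse s) = inverse s ^ 3 / 2" for s :: complex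
      by (cases "s = 0") (simp_all add: field_simps eval_nat_numeral)
    ultimately show ?thesis by (simp only:)
  qed
  have k2: "cosArcsin2 t = (\<lambda>z. ?k z * r z)"
    by (auto simp: cosArcsin2_def r_def)
  have d1: "(cosArcsin2 t has_field_derivative deriv ?k z * r z + ?k z * r z ^ 3 / 2) (at z)"
    if z: "z \<in> hyp2F1_domain" for z
    unfolding k2 by (rule derivative_eq_intros dk[OF z] dr[OF z] refl)+ simp
  have d1': "deriv (cosArcsin2 t) z = deriv ?k z * r z + ?k z * r z ^ 3 / 2"
    if z: "z \<in> hyp2F1_domain" for z
    using d1[OF z] by (rule DERIV_imp_deriv)
  have d2: "deriv (deriv (cosArcsin2 t)) z = deriv (deriv ?k) z * r z + deriv ?k z * r z ^ 3 + 3 * ?k z * r z ^ 5 / 4"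
    if z: "z \<in> hyp2F1_domain" for z
  proof -
    have "((\<lambda>z. deriv ?k z * r z + ?k z * r z ^ 3 * (1 / 2)) has_field_derivative
      deriv (deriv ?k) z * r z + deriv ?k z * r z ^ 3 + 3 * ?k z * r z ^ 5 / 4) (at z)"
      by (rule derivative_eq_intros dk[OF z] dr[OF z] refl)+ (simp add: algebra_simps eval_nat_numeral)
    then have "(deriv (cosArcsin2 t) has_field_derivative
       deriv (deriv ?k) z * r z + deriv ?k z * r z ^ 3 + 3 * ?k z * r z ^ 5 / 4) (at z)"
      by (rule has_field_derivative_transform_within_open[OF _ op z]) (simp add: d1')
    then show ?thesis by (rule DERIV_imp_deriv)
  qed
  show ?thesis
  proof (rule HG_ode[OF _ _ _ op])
    show "cosArcsin2 t holomorphic_on hyp2F1_domain"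
      using d1 op by (auto simp: holomorphic_on_open)
    show "cosArcsin2 t 0 = 1" by (simp add: cosArcsin2_def)
    show "1/2 + of_nat n \<noteq> (0::complex)" for n
      by (auto simp: complex_eq_iff)
    fix z assume z: "z \<in> hyp2F1_domain"
    have s: "r z \<noteq> 0" "z = 1 - 1 / (r z)\<^sup>2"
      using q[OF z] by (auto simp: r_def power_divide)
    define K0 K1 K2 where "K0 = ?k z" "K1 = deriv ?k z" "K2 = deriv (deriv ?k) z"
    have e: "z * (1 - z) * K2 + (1/2 - z) * K1 = of_real (t\<^sup>2) * K0"
      using cosArcsin_ode[OF z, of t] by (simp add: K0_K1_K2_def)
    have alg: "(1 - 1/R\<^sup>2) * (1/R\<^sup>2) * (k2 * R + k1 * R ^ 3 + 3 * k0 * R ^ 5 / 4)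
        + (1/2 - 2 * (1 - 1/R\<^sup>2)) * (k1 * R + k0 * R ^ 3 / 2) - (1/4 + T) * (k0 * R)
      = ((1 - 1/R\<^sup>2) * (1/R\<^sup>2) * k2 + (1/2 - (1 - 1/R\<^sup>2)) * k1 - T * k0) * R"
      if "R \<noteq> 0" for R k0 k1 k2 T :: complex
      using that by (simp add: field_simps eval_nat_numeral)
    have "z * (1 - z) * (K2 * r z + K1 * r z ^ 3 + 3 * K0 * r z ^ 5 / 4) + (1/2 - 2 * z) * (K1 * r z + K0 * r z ^ 3 / 2)
        - (1/4 + of_real (t\<^sup>2)) * (K0 * r z) = (z * (1 - z) * K2 + (1/2 - z) * K1 - of_real (t\<^sup>2) * K0) * r z"
    proof -
      have e1: "1 - 1 / (r z)\<^sup>2 = z" using s(2) by (rule sym)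
      then have e2: "1 / (r z)\<^sup>2 = 1 - z" by (simp only: diff_eq_eq eq_diff_eq add.commute)
      show ?thesis
        using alg[OF s(1), of K2 K1 K0 "of_real (t\<^sup>2)"] unfolding e2 by (simp del: of_real_power)
    qed
    also have "\<dots> = 0" using e by simp
    finally have *: "z * (1 - z) * deriv (deriv (cosArcsin2 t)) z + (1/2 - 2 * z) * deriv (cosArcsin2 t) z
        - (1/4 + of_real (t\<^sup>2)) * cosArcsin2 t z = 0"
      unfolding d1'[OF z] d2[OF z] unfolding k2 K0_K1_K2_def[symmetric] .
    have ab: "(1/2 + \<i> * of_real t) * (1/2 - \<i> * of_real t) = 1/4 + of_real (t\<^sup>2)"
      by (simp add: algebra_simps power2_eq_square)
    show "z * (1 - z) * deriv (deriv (cosArcsin2 t)) z + (1/2 - ((1/2 + \<i> * of_real t) + (1/2 - \<i> * of_real t) + 1) * z) * deriv (cosArcsin2 t) z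
       - (1/2 + \<i> * of_real t) * (1/2 - \<i> * of_real t) * cosArcsin2 t z = 0"
      using * unfolding ab by simp
  qed (use zero_in_hyp2F1_domain in auto)
qed

lemma cosArcsin2_neg:
  assumes "v \<ge> 0" shows "cosArcsin2 t (- of_real v) = of_real (cos (t * rho v) / sqrt (1 + v))"
proof -
  have "csqrt (1 - - of_real v) = of_real (sqrt (1 + v))"
    using assms csqrt_of_real[of "1 + v"] by simp
  then show ?thesis unfolding cosArcsin2_def cosArcsin_neg[OF assms] by simp
qed

section \<open>Fractional integrals from 1/2 to 1 and from 1 to 3/2\<close>

text \<open>The difference of the two sides is the integral of the derivative of sin^(2n+1) cos,
  which vanishes at both ends. It is the moment recursion that \<open>HG_average\<close> demands for
  the passage from 1/2 to 1.\<close>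

lemma wallis_sin:
  "(2 * real n + 2) * integral {0..pi/2} (\<lambda>x. (sin x)\<^sup>2 ^ Suc n) = (2 * real n + 1) * integral {0..pi/2} (\<lambda>x. (sin x)\<^sup>2 ^ n)"
proof -
  have i: "(\<lambda>x::real. (sin x)\<^sup>2 ^ n) integrable_on {0..pi/2}" for n
    by (intro integrable_continuous_real continuous_intros)
  have "((\<lambda>x. (2 * real n + 1) * ((sin x)\<^sup>2 ^ n) - (2 * real n + 2) * ((sin x)\<^sup>2 ^ Suc n)) has_integral
      sin (pi/2) ^ (2 * n + 1) * cos (pi/2) - sin 0 ^ (2 * n + 1) * cos 0) {0..pi/2}"
  proof (rule fundamental_theorem_of_calculus)
    fix x :: real
    have "((\<lambda>x. sin x ^ (2 * n + 1) * cos x) has_real_derivative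
      (2 * real n + 1) * sin x ^ (2 * n) * cos x * cos x - sin x ^ (2 * n + 1) * sin x) (at x within {0..pi/2})"
      by (rule derivative_eq_intros refl)+ (simp add: algebra_simps)
    moreover have "(2 * real n + 1) * sin x ^ (2 * n) * cos x * cos x - sin x ^ (2 * n + 1) * sin x
       = (2 * real n + 1) * ((sin x)\<^sup>2 ^ n) - (2 * real n + 2) * ((sin x)\<^sup>2 ^ Suc n)"
    proof -
      have "cos x * cos x = 1 - (sin x)\<^sup>2" using sin_cos_squared_add[of x] by (simp add: power2_eq_square)
      then have "(2 * real n + 1) * sin x ^ (2 * n) * cos x * cos x = (2 * real n + 1) * sin x ^ (2 * n) * (1 - (sin x)\<^sup>2)"
        by (simp only: mult.assoc)
      then show ?thesis by (simp add: power_mult algebra_simps power2_eq_square)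
    qed
    ultimately show "((\<lambda>x. sin x ^ (2 * n + 1) * cos x) has_vector_derivative
       (2 * real n + 1) * ((sin x)\<^sup>2 ^ n) - (2 * real n + 2) * ((sin x)\<^sup>2 ^ Suc n)) (at x within {0..pi/2})"
      by (simp add: has_real_derivative_iff_has_vector_derivative)
  qed simp
  then have "integral {0..pi/2} (\<lambda>x. (2 * real n + 1) * ((sin x)\<^sup>2 ^ n) - (2 * real n + 2) * ((sin x)\<^sup>2 ^ Suc n)) = 0"
    by (simp add: integral_unique)
  moreover have "integral {0..pi/2} (\<lambda>x. (2 * real n + 1) * ((sin x)\<^sup>2 ^ n) - (2 * real n + 2) * ((sin x)\<^sup>2 ^ Suc n))
     = (2 * real n + 1) * integral {0..pi/2} (\<lambda>x. ((sin x)\<^sup>2 ^ n)) - (2 * real n + 2) * integral {0..pi/2} (\<lambda>x. ((sin x)\<^sup>2 ^ Suc n))"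
    by (subst integral_diff) (auto intro!: integrable_cmul[where 'b=real, unfolded real_scaleR_def] i simp del: power_Suc)
  ultimately show ?thesis by simp
qed

lemma wallis_poly:
  "(2 * real n + 3) * integral {0..1} (\<lambda>x::real. (1 - x\<^sup>2) ^ Suc n) = (2 * real n + 2) * integral {0..1} (\<lambda>x. (1 - x\<^sup>2) ^ n)"
proof -
  have i: "(\<lambda>x::real. (1 - x\<^sup>2) ^ n) integrable_on {0..1}" for n
    by (intro integrable_continuous_real continuous_intros)
  have "((\<lambda>x. (2 * real n + 3) * ((1 - x\<^sup>2) ^ Suc n) - (2 * real n + 2) * ((1 - x\<^sup>2) ^ n)) has_integral
      1 * (1 - 1\<^sup>2) ^ Suc n - 0 * (1 - 0\<^sup>2) ^ Suc n) {0..1}"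
  proof (rule fundamental_theorem_of_calculus)
    fix x :: real
    have "((\<lambda>x. x * (1 - x\<^sup>2) ^ Suc n) has_real_derivative
      (1 - x\<^sup>2) ^ Suc n - x * ((real n + 1) * (1 - x\<^sup>2) ^ n * (2 * x))) (at x within {0..1})"
      by (auto intro!: derivative_eq_intros simp del: power_Suc)
    moreover have "(1 - x\<^sup>2) ^ Suc n - x * ((real n + 1) * (1 - x\<^sup>2) ^ n * (2 * x))
       = (2 * real n + 3) * ((1 - x\<^sup>2) ^ Suc n) - (2 * real n + 2) * ((1 - x\<^sup>2) ^ n)"
      by (simp add: algebra_simps power2_eq_square)
    ultimately show "((\<lambda>x. x * (1 - x\<^sup>2) ^ Suc n) has_vector_derivative
       (2 * real n + 3) * ((1 - x\<^sup>2) ^ Suc n) - (2 * real n + 2) * ((1 - x\<^sup>2) ^ n)) (at x within {0..1})"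
      by (simp add: has_real_derivative_iff_has_vector_derivative)
  qed simp
  then have "integral {0..1} (\<lambda>x. (2 * real n + 3) * ((1 - x\<^sup>2) ^ Suc n) - (2 * real n + 2) * ((1 - x\<^sup>2) ^ n)) = 0"
    by (simp add: integral_unique)
  moreover have "integral {0..1} (\<lambda>x. (2 * real n + 3) * ((1 - x\<^sup>2) ^ Suc n) - (2 * real n + 2) * ((1 - x\<^sup>2) ^ n))
     = (2 * real n + 3) * integral {0..1} (\<lambda>x. ((1 - x\<^sup>2) ^ Suc n)) - (2 * real n + 2) * integral {0..1} (\<lambda>x. ((1 - x\<^sup>2) ^ n))"
    by (subst integral_diff) (auto intro!: integrable_cmul[where 'b=real, unfolded real_scaleR_def] i simp del: power_Suc)
  ultimately show ?thesis by simp
qed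

text \<open>The kernel s^(-1/2) (1 - s)^(-1/2) / pi on [0,1] is singular at both ends; the
  substitution s = sin^2 x makes it the constant 2/pi, hence a continuous weight.\<close>

lemma HG_half_to_one:
  assumes "HG a b (1/2) F"
  shows "HG a b 1 (\<lambda>z. integral {0..pi/2} (\<lambda>x. of_real (2/pi) * F (z * of_real ((sin x)\<^sup>2))))"
proof (rule HG_average[OF assms])
  show "(1 + of_nat n) * complex_of_real (integral {0..pi/2} (\<lambda>x. 2/pi * (sin x)\<^sup>2 ^ Suc n)) =
    (1/2 + of_nat n) * complex_of_real (integral {0..pi/2} (\<lambda>x. 2/pi * (sin x)\<^sup>2 ^ n))" for n
  proof -
    have "(1 + real n) * integral {0..pi/2} (\<lambda>x. 2/pi * (sin x)\<^sup>2 ^ Suc n) =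
      (1/2 + real n) * integral {0..pi/2} (\<lambda>x. 2/pi * (sin x)\<^sup>2 ^ n)"
      using wallis_sin[of n] unfolding integral_mult_right by (simp add: field_simps del: power_Suc)
    then have "complex_of_real ((1 + real n) * integral {0..pi/2} (\<lambda>x. 2/pi * (sin x)\<^sup>2 ^ Suc n)) =
      complex_of_real ((1/2 + real n) * integral {0..pi/2} (\<lambda>x. 2/pi * (sin x)\<^sup>2 ^ n))"
      by (simp only:)
    then show ?thesis by (simp del: power_Suc)
  qed
  show "1/2 + of_nat n \<noteq> (0::complex)" "1 + of_nat n \<noteq> (0::complex)" for n
    by (auto simp: complex_eq_iff)
qed (auto intro!: continuous_intros simp: abs_square_le_1)

text \<open>Here the kernel is (1 - s)^(-1/2) / 2, and s = 1 - x^2 makes it the constant 1.\<close>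

lemma HG_one_to_three_halves:
  assumes "HG a b 1 F"
  shows "HG a b (3/2) (\<lambda>z. integral {0..1} (\<lambda>x. of_real 1 * F (z * of_real (1 - x\<^sup>2))))"
proof (rule HG_average[OF assms])
  show "(3/2 + of_nat n) * complex_of_real (integral {0..1} (\<lambda>x. 1 * (1 - x\<^sup>2) ^ Suc n)) =
    (1 + of_nat n) * complex_of_real (integral {0..1} (\<lambda>x. 1 * (1 - x\<^sup>2) ^ n))" for n
  proof -
    have "(3/2 + real n) * integral {0..1} (\<lambda>x. 1 * (1 - x\<^sup>2) ^ Suc n) = (1 + real n) * integral {0..1} (\<lambda>x. 1 * (1 - x\<^sup>2) ^ n)"
      using wallis_poly[of n] by (simp add: field_simps del: power_Suc)
    then have "complex_of_real ((3/2 + real n) * integral {0..1} (\<lambda>x. 1 * (1 - x\<^sup>2) ^ Suc n)) =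
      complex_of_real ((1 + real n) * integral {0..1} (\<lambda>x. 1 * (1 - x\<^sup>2) ^ n))"
      by (simp only:)
    then show ?thesis by (simp del: power_Suc)
  qed
  show "3/2 + of_nat n \<noteq> (0::complex)" "1 + of_nat n \<noteq> (0::complex)" for n
    by (auto simp: complex_eq_iff)
qed (auto intro!: continuous_intros simp: power_le_one)

lemma HG_geometric: "HG 1 1 1 (\<lambda>z. 1 / (1 - z))"
proof -
  note op = open_hyp2F1_domain
  have q: "z \<noteq> 1" if "z \<in> hyp2F1_domain" for z
    using that by (auto simp: hyp2F1_domain_altdef)
  have d1: "((\<lambda>z. 1 / (1 - z)) has_field_derivative 1 / (1 - z)\<^sup>2) (at z)" if "z \<in> hyp2F1_domain" for z
    using q[OF that] by (auto intro!: derivative_eq_intros simp: power2_eq_square field_simps)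
  have d2: "((\<lambda>z. 1 / (1 - z)\<^sup>2) has_field_derivative 2 / (1 - z)^3) (at z)" if "z \<in> hyp2F1_domain" for z
    using q[OF that] by (auto intro!: derivative_eq_intros simp: power2_eq_square power3_eq_cube divide_simps)
  have d1': "deriv (\<lambda>z. 1 / (1 - z)) z = 1 / (1 - z)\<^sup>2" if "z \<in> hyp2F1_domain" for z
    using d1[OF that] by (rule DERIV_imp_deriv)
  have d2': "deriv (deriv (\<lambda>z. 1 / (1 - z))) z = 2 / (1 - z)^3" if "z \<in> hyp2F1_domain" for z
    by (rule DERIV_imp_deriv, rule has_field_derivative_transform_within_open[OF d2 op that])
       (use that d1' in auto)
  show ?thesis
  proof (rule HG_ode[OF _ _ _ op])
    show "(\<lambda>z. 1 / (1 - z)) holomorphic_on hyp2F1_domain"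
      using d1 op by (auto simp: holomorphic_on_open)
    show "1 + of_nat n \<noteq> (0::complex)" for n
      by (auto simp: complex_eq_iff)
    fix z assume z: "z \<in> hyp2F1_domain"
    define s where "s = 1 - z"
    have s: "z = 1 - s" "s \<noteq> 0" using q[OF z] by (auto simp: s_def)
    show "z * (1 - z) * deriv (deriv (\<lambda>z. 1 / (1 - z))) z + (1 - (1 + 1 + 1) * z) * deriv (\<lambda>z. 1 / (1 - z)) z - 1 * 1 * (1 / (1 - z)) = 0"
      unfolding d1'[OF z] d2'[OF z] unfolding s(1) using s(2)
      by (simp add: field_simps power2_eq_square power3_eq_cube)
  qed (use zero_in_hyp2F1_domain in auto)
qed

section \<open>Differentiation under the integral sign and substitution\<close>

lemma has_vector_derivative_iff_slope:
  fixes f :: "real \<Rightarrow> 'a :: real_normed_vector"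
  shows "(f has_vector_derivative D) (at x within S) \<longleftrightarrow> ((\<lambda>y. (f y - f x) /\<^sub>R (y - x)) \<longlongrightarrow> D) (at x within S)"
proof -
  have "((\<lambda>y. (f y - f x) /\<^sub>R (y - x)) \<longlongrightarrow> D) (at x within S) \<longleftrightarrow>
     ((\<lambda>y. norm ((f y - f x) /\<^sub>R (y - x) - D)) \<longlongrightarrow> 0) (at x within S)"
    by (subst LIM_zero_iff[symmetric]) (simp add: tendsto_norm_zero_iff)
  also have "\<dots> \<longleftrightarrow> ((\<lambda>y. norm ((1 / norm (y - x)) *\<^sub>R (f y - (f x + (y - x) *\<^sub>R D)))) \<longlongrightarrow> 0) (at x within S)"
  proof (rule tendsto_cong)
    have "norm ((f y - f x) /\<^sub>R (y - x) - D) = norm ((1 / norm (y - x)) *\<^sub>R (f y - (f x + (y - x) *\<^sub>R D)))" if "y \<noteq> x" for y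
    proof -
      have "(f y - f x) /\<^sub>R (y - x) - D = (f y - (f x + (y - x) *\<^sub>R D)) /\<^sub>R (y - x)"
      proof -
        have "(f y - f x) /\<^sub>R (y - x) - D = (f y - f x) /\<^sub>R (y - x) - ((y - x) *\<^sub>R D) /\<^sub>R (y - x)"
          using that by simp
        also have "\<dots> = (f y - f x - (y - x) *\<^sub>R D) /\<^sub>R (y - x)"
          by (rule scaleR_right_diff_distrib[symmetric])
        finally show ?thesis by (simp only: diff_diff_eq)
      qed
      then show ?thesis by (simp only: norm_scaleR) (simp add: divide_inverse)
    qed
    then show "\<forall>\<^sub>F y in at x within S. norm ((f y - f x) /\<^sub>R (y - x) - D) = norm ((1 / norm (y - x)) *\<^sub>R (f y - (f x + (y - x) *\<^sub>R D)))"
      by (auto simp: eventually_at_filter)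
  qed
  also have "\<dots> \<longleftrightarrow> (f has_vector_derivative D) (at x within S)"
    unfolding has_vector_derivative_def has_derivative_within tendsto_norm_zero_iff
    by (simp add: bounded_linear_scaleR_left)
  finally show ?thesis by blast
qed

text \<open>A bound on the derivative dominates the difference quotients by the mean value
  inequality on the convex set \<open>S\<close>, so dominated convergence applies. Derivatives
  relative to \<open>S\<close> make the endpoint of \<open>{0..}\<close> accessible.\<close>

lemma leibniz_dominated:
  fixes f f' :: "real \<Rightarrow> 'a \<Rightarrow> complex"
  assumes S: "convex S" and x: "x \<in> S"
    and der: "\<And>u w. u \<in> S \<Longrightarrow> w \<in> space M \<Longrightarrow> ((\<lambda>u. f u w) has_vector_derivative f' u w) (at u within S)"
    and int: "\<And>u. u \<in> S \<Longrightarrow> integrable M (f u)"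
    and K: "integrable M K" "\<And>u w. u \<in> S \<Longrightarrow> w \<in> space M \<Longrightarrow> norm (f' u w) \<le> K w"
    and meas: "f' x \<in> borel_measurable M"
  shows "((\<lambda>u. \<integral>w. f u w \<partial>M) has_vector_derivative (\<integral>w. f' x w \<partial>M)) (at x within S)"
    and "integrable M (f' x)"
proof -
  show "integrable M (f' x)"
    by (rule Bochner_Integration.integrable_bound[OF K(1) meas]) (use K(2)[OF x] in force)
  show "((\<lambda>u. \<integral>w. f u w \<partial>M) has_vector_derivative (\<integral>w. f' x w \<partial>M)) (at x within S)"
    unfolding has_vector_derivative_iff_slope tendsto_at_iff_sequentially
  proof (intro allI impI)
    fix X :: "nat \<Rightarrow> real" assume X: "\<forall>i. X i \<in> S - {x}" "X \<longlonglongrightarrow> x"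
    have "(\<lambda>i. \<integral>w. (f (X i) w - f x w) /\<^sub>R (X i - x) \<partial>M) \<longlonglongrightarrow> (\<integral>w. f' x w \<partial>M)"
    proof (rule integral_dominated_convergence[OF meas _ K(1)])
      show "(\<lambda>w. (f (X i) w - f x w) /\<^sub>R (X i - x)) \<in> borel_measurable M" for i
        using int[of "X i"] int[OF x] X by (auto intro!: borel_measurable_scaleR borel_measurable_diff)
      show "AE w in M. (\<lambda>i. (f (X i) w - f x w) /\<^sub>R (X i - x)) \<longlonglongrightarrow> f' x w"
      proof (rule AE_I2)
        fix w assume w: "w \<in> space M"
        have "((\<lambda>y. (f y w - f x w) /\<^sub>R (y - x)) \<longlongrightarrow> f' x w) (at x within S)"
          using der[OF x w] unfolding has_vector_derivative_iff_slope .
        then show "(\<lambda>i. (f (X i) w - f x w) /\<^sub>R (X i - x)) \<longlonglongrightarrow> f' x w"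
          using X unfolding tendsto_at_iff_sequentially by (auto simp: o_def)
      qed
      show "AE w in M. norm ((f (X i) w - f x w) /\<^sub>R (X i - x)) \<le> K w" for i
      proof (rule AE_I2)
        fix w assume w: "w \<in> space M"
        have "norm (f (X i) w - f x w) \<le> K w * norm (X i - x)"
        proof (rule differentiable_bound[OF S])
          fix u assume u: "u \<in> S"
          show "((\<lambda>u. f u w) has_derivative (\<lambda>h. h *\<^sub>R f' u w)) (at u within S)"
            using der[OF u w] by (simp add: has_vector_derivative_def)
          show "onorm (\<lambda>h. h *\<^sub>R f' u w) \<le> K w"
            using K(2)[OF u w] by (simp add: onorm_scaleR_left onorm_id bounded_linear_ident)
        qed (use X x in auto)
        moreover have "X i \<noteq> x" using X by auto
        ultimately show "norm ((f (X i) w - f x w) /\<^sub>R (X i - x)) \<le> K w"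
          by (simp only: norm_scaleR) (simp add: divide_simps mult_ac)
      qed
    qed
    moreover have "(\<integral>w. (f (X i) w - f x w) /\<^sub>R (X i - x) \<partial>M) = ((\<integral>w. f (X i) w \<partial>M) - (\<integral>w. f x w \<partial>M)) /\<^sub>R (X i - x)" for i
      unfolding integral_scaleR_right using int[of "X i"] int[OF x] X by (subst Bochner_Integration.integral_diff) auto
    ultimately have "(\<lambda>i. ((\<integral>w. f (X i) w \<partial>M) - (\<integral>w. f x w \<partial>M)) /\<^sub>R (X i - x)) \<longlonglongrightarrow> (\<integral>w. f' x w \<partial>M)"
      by (simp only:)
    then show "((\<lambda>y. ((\<integral>w. f y w \<partial>M) - (\<integral>w. f x w \<partial>M)) /\<^sub>R (y - x)) \<circ> X) \<longlonglongrightarrow> (\<integral>w. f' x w \<partial>M)"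
      by (simp add: o_def)
  qed
qed

lemma set_lborel_substitution:
  fixes f :: "real \<Rightarrow> complex" and g h :: "real \<Rightarrow> real"
  assumes S: "S \<in> sets borel" and gS: "g ` S \<in> sets borel"
    and der: "\<And>x. x \<in> S \<Longrightarrow> (g has_real_derivative h x) (at x within S)" and inj: "inj_on g S"
    and f: "(\<lambda>x. indicator (g ` S) x *\<^sub>R f x) \<in> borel_measurable borel"
    and fg: "(\<lambda>x. indicator S x *\<^sub>R (\<bar>h x\<bar> *\<^sub>R f (g x))) \<in> borel_measurable borel"
  shows "set_integrable lborel (g ` S) f \<longleftrightarrow> set_integrable lborel S (\<lambda>x. \<bar>h x\<bar> *\<^sub>R f (g x))"
    and "(LBINT x:g ` S. f x) = (LBINT x:S. \<bar>h x\<bar> *\<^sub>R f (g x))"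
proof -
  have leb: "set_integrable lebesgue T k \<longleftrightarrow> set_integrable lborel T k"
      "set_lebesgue_integral lebesgue T k = (LBINT x:T. k x)"
    if "(\<lambda>x. indicator T x *\<^sub>R k x) \<in> borel_measurable borel" for T and k :: "real \<Rightarrow> complex"
    using that unfolding set_integrable_def set_lebesgue_integral_def
    by (auto intro!: integrable_completion integral_completion)
  have SL: "S \<in> sets lebesgue" using S by auto
  show iff: "set_integrable lborel (g ` S) f \<longleftrightarrow> set_integrable lborel S (\<lambda>x. \<bar>h x\<bar> *\<^sub>R f (g x))"
    using absolutely_integrable_change_of_variables_real[OF SL der inj, of f]
    unfolding leb(1)[OF f] leb(1)[OF fg] .
  show "(LBINT x:g ` S. f x) = (LBINT x:S. \<bar>h x\<bar> *\<^sub>R f (g x))"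
  proof (cases "set_integrable lborel (g ` S) f")
    case True
    then have i: "f absolutely_integrable_on g ` S" "(\<lambda>x. \<bar>h x\<bar> *\<^sub>R f (g x)) absolutely_integrable_on S"
      using iff leb(1)[OF f] leb(1)[OF fg] by auto
    have "integral (g ` S) f = integral S (\<lambda>x. \<bar>h x\<bar> *\<^sub>R f (g x))"
      using has_absolute_integral_change_of_variables_real[OF SL der inj, of f "integral (g ` S) f"] i by auto
    then show ?thesis
      using set_lebesgue_integral_eq_integral(2)[OF i(1)] set_lebesgue_integral_eq_integral(2)[OF i(2)]
      unfolding leb(2)[OF f] leb(2)[OF fg] by simp
  next
    \<comment> \<open>The Bochner integral of a non-integrable function is 0 by convention, and by
      \<open>iff\<close> both sides are of this kind.\<close>
    case False
    then show ?thesis using iff unfolding set_integrable_def set_lebesgue_integral_def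
      by (simp add: not_integrable_integral_eq)
  qed
qed

subsection \<open>Jacobi functions with half-integer parameter\<close>

definition phi :: "real \<Rightarrow> real \<Rightarrow> real \<Rightarrow> complex" where
  "phi c t v = hyp2F1 (of_real c - 1/2 + \<i> * of_real t) (of_real c - 1/2 - \<i> * of_real t) (of_real c) (- of_real v)"

text \<open>The values are 1/2, 1, 3/2, 2 and so on: integers are included, so that the even and the
  odd family are treated together, and 0 is excluded.\<close>

definition half_integer :: "real \<Rightarrow> bool" where
  "half_integer c \<longleftrightarrow> (\<exists>n::nat. c = (real n + 1) / 2)"

lemma half_integer_pos: "half_integer c \<Longrightarrow> c \<ge> 1/2"
  by (auto simp: half_integer_def)

lemma half_integer_nz: "half_integer c \<Longrightarrow> complex_of_real c + of_nat n \<noteq> 0"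
  using half_integer_pos[of c] by (auto simp: complex_eq_iff)

lemma half_integer_Suc: "half_integer c \<Longrightarrow> half_integer (c + 1)"
  unfolding half_integer_def by (metis add.commute add_divide_distrib div_self group_cancel.add1 of_nat_numeral one_add_one zero_neq_numeral of_nat_add)

lemma half_integer_basic [simp]: "half_integer (1/2)" "half_integer 1" "half_integer (3/2)"
  unfolding half_integer_def by (rule exI[of _ 0], simp) (rule exI[of _ 1], simp, rule exI[of _ 2], simp)

lemma half_integer_add: "half_integer c \<Longrightarrow> half_integer (c + real m)"
proof (induction m)
  case (Suc m)
  then show ?case using half_integer_Suc[of "c + real m"] by (simp add: add_ac)
qed simp

lemma half_integer_induct [consumes 1, case_names half one step]:
  assumes "half_integer c" and half: "P (1/2)" and one: "P 1"
    and step: "\<And>c. half_integer c \<Longrightarrow> P c \<Longrightarrow> P (c + 1)"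
  shows "P c"
proof -
  have "P ((real n + 1) / 2)" for n
  proof (induction n rule: less_induct)
    case (less n)
    consider "n = 0" | "n = 1" | k where "n = Suc (Suc k)"
      by (metis One_nat_def not0_implies_Suc)
    then show ?case
    proof cases
      case 3
      have "half_integer ((real k + 1) / 2)" by (auto simp: half_integer_def)
      from step[OF this less.IH] 3 have "P ((real k + 1) / 2 + 1)" by simp
      moreover have "(real k + 1) / 2 + 1 = (real n + 1) / 2" using 3 by (simp add: field_simps)
      ultimately show ?thesis by (simp only:)
    qed (use half one in auto)
  qed
  then show ?thesis using assms(1) unfolding half_integer_def by blast
qed

lemma rho_continuous_on [continuous_intros]: "continuous_on S (f :: real \<Rightarrow> real) \<Longrightarrow> continuous_on S (\<lambda>x. rho (f x))"
  unfolding rho_def by (intro continuous_on_mult continuous_on_const continuous_on_arsinh' continuous_on_real_sqrt)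

lemma rho_measurable [measurable]: "rho \<in> borel_measurable borel"
  using rho_continuous_on[OF continuous_on_id] by (intro borel_measurable_continuous_onI) simp

text \<open>One witness is enough: the chosen function agrees with it on the domain and therefore
  inherits holomorphy and germ.\<close>

lemma HG_cong_hyp2F1:
  assumes "HG a b c F" shows "HG a b c (hyp2F1 a b c)"
proof -
  have "hyp2F1 a b c holomorphic_on hyp2F1_domain"
    using assms HG_eq_hyp2F1[OF assms] unfolding HG_def by (metis holomorphic_cong)
  moreover have "eventually (\<lambda>z. hyp2F1 a b c z = F z) (nhds 0)"
    using eventually_nhds_in_open[OF open_hyp2F1_domain zero_in_hyp2F1_domain] HG_eq_hyp2F1[OF assms]
    by (auto elim: eventually_mono)
  then have "hyp2F1 a b c has_fps_expansion hgf a b c"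
    using assms unfolding HG_def by (subst has_fps_expansion_cong) auto
  ultimately show ?thesis unfolding HG_def by blast
qed

text \<open>The derivative of the case \<open>c\<close> gives the case \<open>c + 1\<close> unless the product of the upper parameters vanishes, which
  happens for \<open>c = 1/2\<close>, \<open>t = 0\<close> only; there the geometric series takes over.\<close>

lemma HG_exists:
  "\<exists>F. HG (of_real ((real n + 1) / 2) - 1/2 + \<i> * of_real t) (of_real ((real n + 1) / 2) - 1/2 - \<i> * of_real t) (of_real ((real n + 1) / 2)) F"
proof (induction n rule: less_induct)
  case (less n)
  consider "n = 0" | "n = 1" | "n = 2" "t = 0" | k where "n = Suc (Suc k)" "n \<noteq> 2 \<or> t \<noteq> 0"
    by (metis One_nat_def Suc_1 not0_implies_Suc)
  then show ?case
  proof cases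
    case 1
    then show ?thesis using HG_cosArcsin[of t] by auto
  next
    case 2
    then show ?thesis using HG_half_to_one[OF HG_cosArcsin2[of t]] by auto
  next
    case 3
    then show ?thesis using HG_one_to_three_halves[OF HG_geometric] by auto
  next
    case 4
    let ?c = "complex_of_real ((real k + 1) / 2)"
    obtain F where F: "HG (?c - 1/2 + \<i> * of_real t) (?c - 1/2 - \<i> * of_real t) ?c F"
      using less.IH[of k] 4(1) by auto
    have "?c - 1/2 = of_real (real k / 2)" by (simp add: field_simps)
    then have "(?c - 1/2 + \<i> * of_real t) * (?c - 1/2 - \<i> * of_real t) \<noteq> 0" "?c \<noteq> 0"
      using 4 by (auto simp: complex_eq_iff)
    from HG_deriv[OF F this] obtain G where G: "HG (?c - 1/2 + \<i> * of_real t + 1) (?c - 1/2 - \<i> * of_real t + 1) (?c + 1) G"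
      by blast
    have "?c + 1 = of_real ((real n + 1) / 2)" using 4 by (simp add: field_simps)
    then have "?c - 1/2 + \<i> * of_real t + 1 = of_real ((real n + 1) / 2) - 1/2 + \<i> * of_real t"
      "?c - 1/2 - \<i> * of_real t + 1 = of_real ((real n + 1) / 2) - 1/2 - \<i> * of_real t" "?c + 1 = of_real ((real n + 1) / 2)"
      by (auto simp: algebra_simps)
    with G show ?thesis by metis
  qed
qed

lemma HG_phi:
  assumes "half_integer c"
  shows "HG (of_real c - 1/2 + \<i> * of_real t) (of_real c - 1/2 - \<i> * of_real t) (of_real c)
    (hyp2F1 (of_real c - 1/2 + \<i> * of_real t) (of_real c - 1/2 - \<i> * of_real t) (of_real c))"
  using assms HG_exists HG_cong_hyp2F1 unfolding half_integer_def by blast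

lemma neg_in_hyp2F1_domain: "v > -1 \<Longrightarrow> - complex_of_real v \<in> hyp2F1_domain"
  by (simp add: hyp2F1_domain_altdef)

text \<open>Both relations are evaluated at z = -v, which lies in the domain exactly for v > -1. In
  the second one the derivative of \<open>phi (c + 1)\<close> has already been replaced by the first
  and the power of w has been divided out, so it holds at v = 0 as well.\<close>

lemma phi_vderiv:
  assumes c: "half_integer c" and v: "v > -1"
  shows "(phi c t has_vector_derivative - of_real (((c - 1/2)\<^sup>2 + t\<^sup>2) / c) * phi (c + 1) t v) (at v)"
    and "of_real (v\<^sup>2 + v) * (- of_real (((c + 1/2)\<^sup>2 + t\<^sup>2) / (c + 1)) * phi (c + 2) t v)
        + of_real (c * (1 + 2 * v)) * phi (c + 1) t v = of_real c * phi c t v"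
proof -
  let ?a = "\<lambda>c. complex_of_real c - 1/2 + \<i> * of_real t" and ?b = "\<lambda>c. complex_of_real c - 1/2 - \<i> * of_real t"
  let ?F = "\<lambda>c. hyp2F1 (?a c) (?b c) (of_real c)"
  have HG: "HG (?a c) (?b c) (of_real c) (?F c)" if "half_integer c" for c
    using HG_phi[OF that] .
  have HG1: "HG (?a c + 1) (?b c + 1) (of_real c + 1) (?F (c+1))" if "half_integer c" for c
    using HG[OF half_integer_Suc[OF that]] by (simp add: algebra_simps)
  have ab: "?a c * ?b c = of_real ((c - 1/2)\<^sup>2 + t\<^sup>2)" for c
    by (simp add: algebra_simps power2_eq_square complex_eq_iff)
  have dF: "deriv (?F c) (- of_real v) = of_real (((c - 1/2)\<^sup>2 + t\<^sup>2) / c) * phi (c + 1) t v" if "half_integer c" for c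
    using HG_deriv_eq[OF HG[OF that] HG1[OF that] _ neg_in_hyp2F1_domain[OF v]] half_integer_pos[OF that]
    unfolding ab phi_def by (simp add: field_simps)
  have "(?F c has_field_derivative deriv (?F c) (- of_real v)) (at (- of_real v))"
    using HG[OF c] neg_in_hyp2F1_domain[OF v] open_hyp2F1_domain unfolding HG_def
    by (auto intro: holomorphic_derivI)
  then have "((\<lambda>x. ?F c (- x)) has_field_derivative deriv (?F c) (- of_real v) * (-1)) (at (of_real v))"
    by (intro DERIV_chain2[where g = uminus]) (auto intro!: derivative_eq_intros)
  from has_vector_derivative_real_field[OF this]
  show "(phi c t has_vector_derivative - of_real (((c - 1/2)\<^sup>2 + t\<^sup>2) / c) * phi (c + 1) t v) (at v)"
    unfolding dF[OF c] by (simp add: phi_def[abs_def])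
  have abc: "?a c + ?b c + 1 = 2 * of_real c" by simp
  have e: "c + 1 + 1 = c + 2" "c + 1 - 1/2 = c + 1/2" by simp_all
  define K where "K = complex_of_real (((c + 1/2)\<^sup>2 + t\<^sup>2) / (c + 1))"
  have "- of_real v * (1 - - of_real v) * (K * phi (c + 2) t v) + of_real c * (1 - 2 * - of_real v) * phi (c + 1) t v
     = of_real c * phi c t v"
    using HG_weighted_deriv[OF HG[OF c] HG1[OF c] half_integer_nz[OF c] abc neg_in_hyp2F1_domain[OF v]]
    unfolding dF[OF half_integer_Suc[OF c]] e K_def[symmetric] by (simp only: phi_def)
  then show "of_real (v\<^sup>2 + v) * (- of_real (((c + 1/2)\<^sup>2 + t\<^sup>2) / (c + 1)) * phi (c + 2) t v)
        + of_real (c * (1 + 2 * v)) * phi (c + 1) t v = of_real c * phi c t v"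
    unfolding K_def[symmetric] by (simp add: algebra_simps power2_eq_square)
qed

lemma phi_continuous_on: "half_integer c \<Longrightarrow> S \<subseteq> {-1<..} \<Longrightarrow> continuous_on S (phi c t)"
  using phi_vderiv(1) by (intro continuous_at_imp_continuous_on ballI has_vector_derivative_continuous) blast

lemma phi_0 [simp]: "half_integer c \<Longrightarrow> phi c t 0 = 1"
proof -
  assume "half_integer c"
  from HG_phi[OF this, of t]
  have "hyp2F1 (of_real c - 1/2 + \<i> * of_real t) (of_real c - 1/2 - \<i> * of_real t) (of_real c) has_fps_expansion
    hgf (of_real c - 1/2 + \<i> * of_real t) (of_real c - 1/2 - \<i> * of_real t) (of_real c)"
    by (simp add: HG_def)
  from has_fps_expansion_imp_0_eq_fps_nth_0[OF this]
  have "hyp2F1 (of_real c - 1/2 + \<i> * of_real t) (of_real c - 1/2 - \<i> * of_real t) (of_real c) 0 = 1"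
    by (simp only: fps_hypergeo_0)
  then show ?thesis by (simp add: phi_def)
qed

lemma phi_weighted_vderiv:
  assumes c: "half_integer c" and v: "v > 0"
  shows "((\<lambda>v. of_real ((v\<^sup>2 + v) powr c) * phi (c + 1) t v) has_vector_derivative
      of_real (c * (v\<^sup>2 + v) powr (c - 1)) * phi c t v) (at v)"
proof -
  have p: "v\<^sup>2 + v > 0" using v by (simp add: add_nonneg_pos)
  have "((\<lambda>v. (v\<^sup>2 + v) powr c) has_real_derivative c * (v\<^sup>2 + v) powr (c - 1) * (2 * v + 1)) (at v)"
    using p by (auto intro!: derivative_eq_intros)
  then have 1: "((\<lambda>v. complex_of_real ((v\<^sup>2 + v) powr c)) has_vector_derivative of_real (c * (v\<^sup>2 + v) powr (c - 1) * (2 * v + 1))) (at v)"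
    by (intro has_vector_derivative_of_real) (simp add: has_real_derivative_iff_has_vector_derivative)
  have e: "(v\<^sup>2 + v) powr c = (v\<^sup>2 + v) powr (c - 1) * (v\<^sup>2 + v)"
    using p by (simp add: powr_diff field_simps)
  have s: "c + 1 + 1 = c + 2" "c + 1 - 1/2 = c + 1/2" by simp_all
  have 2: "(phi (c + 1) t has_vector_derivative - of_real (((c + 1/2)\<^sup>2 + t\<^sup>2) / (c + 1)) * phi (c + 2) t v) (at v)"
    using phi_vderiv(1)[OF half_integer_Suc[OF c], of v t] v unfolding s by simp
  have "of_real ((v\<^sup>2 + v) powr c) * (- of_real (((c + 1/2)\<^sup>2 + t\<^sup>2) / (c + 1)) * phi (c + 2) t v) +
     of_real (c * (v\<^sup>2 + v) powr (c - 1) * (2 * v + 1)) * phi (c + 1) t v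
     = of_real ((v\<^sup>2 + v) powr (c - 1)) * (of_real (v\<^sup>2 + v) * (- of_real (((c + 1/2)\<^sup>2 + t\<^sup>2) / (c + 1)) * phi (c + 2) t v)
        + of_real (c * (1 + 2 * v)) * phi (c + 1) t v)"
    unfolding e by (simp add: algebra_simps)
  also have "\<dots> = of_real (c * (v\<^sup>2 + v) powr (c - 1)) * phi c t v"
    using phi_vderiv(2)[OF c, of v t] v by (simp add: mult_ac)
  finally show ?thesis
    using has_vector_derivative_mult[OF 1 2] by simp
qed

lemma phi_half: "v \<ge> 0 \<Longrightarrow> phi (1/2) t v = of_real (cos (t * rho v))"
  unfolding phi_def using HG_eq_hyp2F1[OF HG_cosArcsin neg_in_hyp2F1_domain, of v t] cosArcsin_neg[of v t]
  by simp

text \<open>The base case c = 1 of the bound and of measurability rests on this average of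
  cosines.\<close>

lemma phi_one:
  assumes v: "v \<ge> 0"
  shows "phi 1 t v = of_real (integral {0..pi/2} (\<lambda>x. 2/pi * (cos (t * rho (v * (sin x)\<^sup>2)) / sqrt (1 + v * (sin x)\<^sup>2))))"
proof -
  have "phi 1 t v = integral {0..pi/2} (\<lambda>x. of_real (2/pi) * cosArcsin2 t (- of_real v * of_real ((sin x)\<^sup>2)))"
    unfolding phi_def using HG_eq_hyp2F1[OF HG_half_to_one[OF HG_cosArcsin2] neg_in_hyp2F1_domain, of v t] v
    by simp
  also have "\<dots> = integral {0..pi/2} (\<lambda>x. of_real (2/pi * (cos (t * rho (v * (sin x)\<^sup>2)) / sqrt (1 + v * (sin x)\<^sup>2))))"
  proof (rule integral_cong)
    fix x
    show "of_real (2/pi) * cosArcsin2 t (- of_real v * of_real ((sin x)\<^sup>2)) = complex_of_real (2/pi * (cos (t * rho (v * (sin x)\<^sup>2)) / sqrt (1 + v * (sin x)\<^sup>2)))"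
      using cosArcsin2_neg[of "v * (sin x)\<^sup>2" t] v by simp
  qed
  also have "\<dots> = of_real (integral {0..pi/2} (\<lambda>x. 2/pi * (cos (t * rho (v * (sin x)\<^sup>2)) / sqrt (1 + v * (sin x)\<^sup>2))))"
  proof (intro integral_unique has_integral_of_real integrable_integral integrable_continuous_real)
    have "1 + v * (sin x)\<^sup>2 > 0" for x using v by (simp add: add_pos_nonneg)
    then have "1 + v * (sin x)\<^sup>2 \<noteq> 0" for x by (metis less_irrefl)
    then show "continuous_on {0..pi/2} (\<lambda>x. 2/pi * (cos (t * rho (v * (sin x)\<^sup>2)) / sqrt (1 + v * (sin x)\<^sup>2)))"
      unfolding rho_def by (intro continuous_intros) auto
  qed
  finally show ?thesis .
qed

text \<open>With w = v^2 + v, the derivative of w^c \<open>phi (c + 1)\<close> is c w^(c-1)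
  \<open>phi c\<close>. By induction it is dominated by c w^(c-1) (2 v + 1), the derivative of w^c;
  integrating from 0 yields w^c |\<open>phi (c + 1)\<close>| \<le> w^c. The base cases are a cosine
  and an average of damped cosines over total mass 1.\<close>

lemma phi_bound:
  assumes "half_integer c" "v \<ge> 0"
  shows "norm (phi c t v) \<le> 1"
proof -
  have step: "norm (phi (c + 1) t v) \<le> 1" if c: "half_integer c" and v: "v \<ge> 0"
    and IH: "\<And>v. v \<ge> 0 \<Longrightarrow> norm (phi c t v) \<le> 1" for c v
  proof (cases "v = 0")
    case True
    then show ?thesis using half_integer_Suc[OF c] by simp
  next
    case False
    then have v: "v > 0" using v by simp
    have c0: "c > 0" using half_integer_pos[OF c] by simp
    have p: "x\<^sup>2 + x > 0" if "x > 0" for x :: real using that by (simp add: add_nonneg_pos)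
    let ?f = "\<lambda>v. of_real ((v\<^sup>2 + v) powr c) * phi (c + 1) t v"
    have cont: "continuous_on {0..v} (\<lambda>v. (v\<^sup>2 + v) powr c)"
      by (rule continuous_on_powr') (use c0 in \<open>auto intro!: continuous_intros\<close>)
    have "norm (?f v - ?f 0) \<le> (v\<^sup>2 + v) powr c - (0\<^sup>2 + 0) powr c"
    proof (rule differentiable_bound_general[OF v _ cont])
      show "continuous_on {0..v} ?f"
        by (intro continuous_intros cont phi_continuous_on half_integer_Suc c) auto
      fix x assume x: "0 < x" "x < v"
      show "(?f has_vector_derivative of_real (c * (x\<^sup>2 + x) powr (c - 1)) * phi c t x) (at x)"
        by (rule phi_weighted_vderiv[OF c x(1)])
      have "((\<lambda>v. (v\<^sup>2 + v) powr c) has_real_derivative c * (x\<^sup>2 + x) powr (c - 1) * (2 * x + 1)) (at x)"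
        using p[OF x(1)] by (auto intro!: derivative_eq_intros)
      then show "((\<lambda>v. (v\<^sup>2 + v) powr c) has_vector_derivative c * (x\<^sup>2 + x) powr (c - 1) * (2 * x + 1)) (at x)"
        by (simp add: has_real_derivative_iff_has_vector_derivative)
      have K: "c * (x\<^sup>2 + x) powr (c - 1) \<ge> 0" using c0 by simp
      then have "norm (of_real (c * (x\<^sup>2 + x) powr (c - 1)) * phi c t x) = (c * (x\<^sup>2 + x) powr (c - 1)) * norm (phi c t x)"
        by (simp only: norm_mult norm_of_real abs_of_nonneg)
      also have "\<dots> \<le> (c * (x\<^sup>2 + x) powr (c - 1)) * 1"
        using IH[of x] x K by (intro mult_left_mono) auto
      also have "\<dots> \<le> c * (x\<^sup>2 + x) powr (c - 1) * (2 * x + 1)"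
        using x c0 by (intro mult_left_mono) auto
      finally show "norm (of_real (c * (x\<^sup>2 + x) powr (c - 1)) * phi c t x) \<le> c * (x\<^sup>2 + x) powr (c - 1) * (2 * x + 1)" .
    qed
    then have "(v\<^sup>2 + v) powr c * norm (phi (c + 1) t v) \<le> (v\<^sup>2 + v) powr c"
      by (simp add: norm_mult)
    then show ?thesis using p[OF v] by simp
  qed
  have half: "norm (phi (1/2) t v) \<le> 1" if "v \<ge> 0" for v
    using that by (simp add: phi_half)
  have one: "norm (phi 1 t v) \<le> 1" if v: "v \<ge> 0" for v
  proof -
    have "norm (integral {0..pi/2} (\<lambda>x. 2/pi * (cos (t * rho (v * (sin x)\<^sup>2)) / sqrt (1 + v * (sin x)\<^sup>2)))) \<le> 2/pi * (pi/2 - 0)"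
    proof (rule integral_bound)
      have pos: "1 + v * (sin x)\<^sup>2 \<ge> 1" for x using v by simp
      then have "1 + v * (sin x)\<^sup>2 \<noteq> 0" for x by (metis not_one_le_zero)
      then show "continuous_on {0..pi/2} (\<lambda>x. 2/pi * (cos (t * rho (v * (sin x)\<^sup>2)) / sqrt (1 + v * (sin x)\<^sup>2)))"
        unfolding rho_def by (intro continuous_intros) auto
      fix x
      have "\<bar>cos (t * rho (v * (sin x)\<^sup>2))\<bar> / sqrt (1 + v * (sin x)\<^sup>2) \<le> 1 / 1"
        using pos[of x] by (intro frac_le) auto
      then have "2/pi * \<bar>cos (t * rho (v * (sin x)\<^sup>2)) / sqrt (1 + v * (sin x)\<^sup>2)\<bar> \<le> 2/pi * 1"
        using pos[of x] by (intro mult_left_mono) (auto simp: abs_divide)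
      then show "norm (2/pi * (cos (t * rho (v * (sin x)\<^sup>2)) / sqrt (1 + v * (sin x)\<^sup>2))) \<le> 2/pi"
        by (simp add: abs_mult)
    qed simp
    then show ?thesis unfolding phi_one[OF v] by simp
  qed
  from assms(1) have "\<forall>v\<ge>0. norm (phi c t v) \<le> 1"
    by (induction rule: half_integer_induct) (use half one step in auto)
  then show ?thesis using assms(2) by blast
qed

text \<open>Measurability in t climbs from c to c + 1 because the v-derivative of
  \<open>phi c\<close> is a limit of difference quotients and equals \<open>phi (c + 1)\<close>
  times an explicit factor. That factor can vanish only at t = 0, and a single point is split off by
  the case distinction.\<close>

lemma phi_measurable:
  assumes "half_integer c" "v \<ge> 0"
  shows "(\<lambda>t. phi c t v) \<in> borel_measurable borel"
proof -
  have step: "(\<lambda>t. phi (c + 1) t v) \<in> borel_measurable borel" if c: "half_integer c" and v: "v \<ge> 0"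
    and IH: "\<And>v. v \<ge> 0 \<Longrightarrow> (\<lambda>t. phi c t v) \<in> borel_measurable borel" for c v
  proof -
    let ?d = "\<lambda>n t. (phi c t (v + 1 / real (Suc n)) - phi c t v) /\<^sub>R (1 / real (Suc n))"
    let ?L = "\<lambda>t. - of_real (((c - 1/2)\<^sup>2 + t\<^sup>2) / c) * phi (c + 1) t v"
    have "(\<lambda>n. ?d n t) \<longlonglongrightarrow> ?L t" for t
    proof -
      have "((\<lambda>y. (phi c t y - phi c t v) /\<^sub>R (y - v)) \<longlongrightarrow> ?L t) (at v)"
        using phi_vderiv(1)[OF c, of v t] v unfolding has_vector_derivative_iff_slope by simp
      moreover have "(\<lambda>n. v + 1 / real (Suc n)) \<longlonglongrightarrow> v"
        using tendsto_add[OF tendsto_const LIMSEQ_Suc[OF lim_1_over_n], of v] by simp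
      then have "filterlim (\<lambda>n. v + 1 / real (Suc n)) (at v) sequentially"
        by (intro filterlim_atI) auto
      ultimately show ?thesis by (auto dest: filterlim_compose)
    qed
    moreover have "?d n \<in> borel_measurable borel" for n
    proof -
      have [measurable]: "(\<lambda>t. phi c t v) \<in> borel_measurable borel" "(\<lambda>t. phi c t (v + 1 / real (Suc n))) \<in> borel_measurable borel"
        using IH v by auto
      show ?thesis by measurable
    qed
    ultimately have L: "?L \<in> borel_measurable borel"
      by (intro borel_measurable_LIMSEQ_metric[where f = ?d and g = ?L]) auto
    have "(\<lambda>t. if t = 0 then phi (c + 1) 0 v else ?L t / - of_real (((c - 1/2)\<^sup>2 + t\<^sup>2) / c)) \<in> borel_measurable borel"
      using L by measurable
    also have "(\<lambda>t. if t = 0 then phi (c + 1) 0 v else ?L t / - of_real (((c - 1/2)\<^sup>2 + t\<^sup>2) / c)) = (\<lambda>t. phi (c + 1) t v)"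
    proof
      fix t
      have "(c - 1/2)\<^sup>2 + t\<^sup>2 > 0" if "t \<noteq> 0" using that by (simp add: add_nonneg_pos)
      then have "- complex_of_real (((c - 1/2)\<^sup>2 + t\<^sup>2) / c) \<noteq> 0" if "t \<noteq> 0"
        unfolding neg_equal_0_iff_equal of_real_eq_0_iff divide_eq_0_iff
        using that half_integer_pos[OF c] by fastforce
      then show "(if t = 0 then phi (c + 1) 0 v else ?L t / - of_real (((c - 1/2)\<^sup>2 + t\<^sup>2) / c)) = phi (c + 1) t v"
        by (cases "t = 0") (simp_all only: if_True if_False nonzero_mult_div_cancel_left not_False_eq_True simp_thms)
    qed
    finally show ?thesis .
  qed
  have half: "(\<lambda>t. phi (1/2) t v) \<in> borel_measurable borel" if "v \<ge> 0" for v
    using that by (simp add: phi_half)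
  have one: "(\<lambda>t. phi 1 t v) \<in> borel_measurable borel" if v: "v \<ge> 0" for v
  proof -
    let ?h = "\<lambda>t x. 2/pi * (cos (t * rho (v * (sin x)\<^sup>2)) / sqrt (1 + v * (sin x)\<^sup>2))"
    have nz: "1 + v * (sin x)\<^sup>2 \<noteq> 0" for x using v by (smt (verit) mult_nonneg_nonneg zero_le_power2)
    have cont: "continuous_on {0..pi/2} (?h t)" for t
      using nz unfolding rho_def by (intro continuous_intros) auto
    have "integral {0..pi/2} (?h t) = (LBINT x:{0..pi/2}. ?h t x)" for t
      using cont by (intro set_borel_integral_eq_integral(2)[symmetric] borel_integrable_atLeastAtMost')
    moreover have "(\<lambda>t. LBINT x:{0..pi/2}. ?h t x) \<in> borel_measurable borel"
    proof -
      show ?thesis unfolding set_lebesgue_integral_def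
        by (rule lborel.borel_measurable_lebesgue_integral) measurable
    qed
    ultimately show ?thesis unfolding phi_one[OF v] by simp
  qed
  from assms(1) have "\<forall>v\<ge>0. (\<lambda>t. phi c t v) \<in> borel_measurable borel"
    by (induction rule: half_integer_induct) (use half one step in auto)
  then show ?thesis using assms(2) by blast
qed

text \<open>This is the hypergeometric function with the upper parameters of \<open>phi 1\<close>
  and lower parameter 3/2. Multiplied by sqrt y, it is the half-order integral of
  \<open>phi 1 t (y - x^2)\<close> over x between 0 and sqrt y.\<close>

definition chi :: "real \<Rightarrow> real \<Rightarrow> complex" where
  "chi t y = integral {0..1} (\<lambda>x. phi 1 t (y * (1 - x\<^sup>2)))"

text \<open>The left-hand derivative is (y chi' + chi/2) / sqrt y, and \<open>HG_lower\<close> at c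
  = 1/2 identifies the numerator with half of \<open>cosArcsin2\<close>. The result is half of
  \<open>phi (1/2)\<close> times its weight.\<close>

lemma chi_vderiv:
  assumes y: "y > 0"
  shows "((\<lambda>y. of_real (sqrt y) * chi t y) has_vector_derivative of_real (cos (t * rho y) / (2 * sqrt (y\<^sup>2 + y)))) (at y)"
proof -
  let ?a = "1/2 + \<i> * complex_of_real t" and ?b = "1/2 - \<i> * complex_of_real t"
  let ?F = "hyp2F1 ?a ?b 1" and ?G = "hyp2F1 ?a ?b (3/2)"
  have F: "HG ?a ?b 1 ?F" using HG_phi[of 1 t] by simp
  note G' = HG_one_to_three_halves[OF F]
  have G: "HG ?a ?b (3/2) ?G" by (rule HG_cong_hyp2F1[OF G'])
  have chi: "chi t y = ?G (- of_real y)" if "y > -1" for y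
  proof -
    have "?G (- of_real y) = integral {0..1} (\<lambda>x. of_real 1 * ?F (- of_real y * of_real (1 - x\<^sup>2)))"
      by (rule HG_eq_hyp2F1[OF G' neg_in_hyp2F1_domain[OF that]])
    then show ?thesis by (simp add: chi_def phi_def)
  qed
  have nz: "1/2 + of_nat n \<noteq> (0::complex)" for n by (auto simp: complex_eq_iff)
  have in_D: "- complex_of_real y \<in> hyp2F1_domain" using y by (intro neg_in_hyp2F1_domain) simp
  have G1: "HG ?a ?b (1/2 + 1) ?G"
  proof -
    have "(1/2 + 1 :: complex) = 3/2" by simp
    with G show ?thesis by (simp only:)
  qed
  have low: "- of_real y * deriv ?G (- of_real y) + 1/2 * ?G (- of_real y) = 1/2 * of_real (cos (t * rho y) / sqrt (1 + y))"
    using HG_lower[OF HG_cosArcsin2 G1 nz in_D] cosArcsin2_neg[of y t] y by simp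
  have "(?G has_field_derivative deriv ?G (- of_real y)) (at (- of_real y))"
    using G in_D open_hyp2F1_domain unfolding HG_def by (auto intro: holomorphic_derivI)
  then have "((\<lambda>x. ?G (- x)) has_field_derivative deriv ?G (- of_real y) * (-1)) (at (of_real y))"
    by (intro DERIV_chain2[where g = uminus]) (auto intro!: derivative_eq_intros)
  from has_vector_derivative_real_field[OF this]
  have "((\<lambda>y. ?G (- of_real y)) has_vector_derivative - deriv ?G (- of_real y)) (at y)"
    by simp
  then have 2: "(chi t has_vector_derivative - deriv ?G (- of_real y)) (at y)"
    by (rule has_vector_derivative_transform_within_open[of _ _ _ "{-1<..}"]) (use y chi in auto)
  have "(sqrt has_real_derivative 1 / (2 * sqrt y)) (at y)"
    using y by (auto intro!: derivative_eq_intros simp: field_simps)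
  then have 1: "((\<lambda>y. complex_of_real (sqrt y)) has_vector_derivative of_real (1 / (2 * sqrt y))) (at y)"
    by (intro has_vector_derivative_of_real) (simp add: has_real_derivative_iff_has_vector_derivative)
  have sy: "complex_of_real (sqrt y) * of_real (sqrt y) = of_real y" "sqrt y \<noteq> 0"
    using y by (simp_all flip: of_real_mult)
  have "of_real (sqrt y) * (- deriv ?G (- of_real y)) + of_real (1 / (2 * sqrt y)) * chi t y
     = (- of_real y * deriv ?G (- of_real y) + 1/2 * ?G (- of_real y)) / of_real (sqrt y)"
    using sy y by (simp add: chi field_simps)
  also have "\<dots> = of_real (cos (t * rho y) / (2 * sqrt (y\<^sup>2 + y)))"
  proof -
    have "sqrt (y\<^sup>2 + y) = sqrt y * sqrt (1 + y)"
      by (simp add: power2_eq_square algebra_simps flip: real_sqrt_mult)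
    then show ?thesis unfolding low by (simp add: mult_ac)
  qed
  finally show ?thesis using has_vector_derivative_mult[OF 1 2] by simp
qed

subsection \<open>Cosine transform of test functions\<close>

text \<open>Derivatives are quantified existentially instead of being iterates of
  \<open>vector_derivative\<close>; closure under sums and products is then a plain
  induction.\<close>

fun Ck :: "nat \<Rightarrow> (real \<Rightarrow> complex) \<Rightarrow> bool" where
  "Ck 0 f = continuous_on UNIV f"
| "Ck (Suc n) f = (\<exists>f'. (\<forall>x. (f has_vector_derivative f' x) (at x)) \<and> Ck n f')"

lemma Ck_SucI: "(\<And>x. (f has_vector_derivative f' x) (at x)) \<Longrightarrow> Ck n f' \<Longrightarrow> Ck (Suc n) f"
  by auto

lemma has_vector_derivative_minus_arg:
  assumes "(f has_vector_derivative f') (at (- x :: real))"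
  shows "((\<lambda>x. f (- x)) has_vector_derivative - f') (at x)"
proof -
  have "(uminus has_vector_derivative - 1) (at x)"
    by (rule has_vector_derivative_minus[OF has_vector_derivative_id])
  from vector_diff_chain_at[OF this assms] show ?thesis by (simp add: o_def)
qed

lemma Ck_SucD: "Ck (Suc n) f \<Longrightarrow> Ck n f"
proof (induction n arbitrary: f)
  case 0
  then show ?case
    by (auto intro!: continuous_at_imp_continuous_on dest: has_vector_derivative_continuous)
next
  case (Suc n)
  then show ?case by (metis Ck.simps(2))
qed

lemma Ck_add: "Ck n f \<Longrightarrow> Ck n g \<Longrightarrow> Ck n (\<lambda>x. f x + g x)"
proof (induction n arbitrary: f g)
  case 0
  then show ?case by (auto intro: continuous_intros)
next
  case (Suc n)
  then obtain f' g' where fg: "\<And>x. (f has_vector_derivative f' x) (at x)" "\<And>x. (g has_vector_derivative g' x) (at x)"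
    "Ck n f'" "Ck n g'" by auto
  have "((\<lambda>x. f x + g x) has_vector_derivative f' x + g' x) (at x)" for x
    by (intro has_vector_derivative_add fg)
  then show ?case by (rule Ck_SucI) (rule Suc.IH[OF fg(3,4)])
qed

lemma Ck_mult: "Ck n f \<Longrightarrow> Ck n g \<Longrightarrow> Ck n (\<lambda>x. f x * g x)"
proof (induction n arbitrary: f g)
  case 0
  then show ?case by (auto intro: continuous_intros)
next
  case (Suc n)
  obtain f' g' where fg: "\<And>x. (f has_vector_derivative f' x) (at x)" "\<And>x. (g has_vector_derivative g' x) (at x)"
    "Ck n f'" "Ck n g'" using Suc.prems by auto
  have "((\<lambda>x. f x * g x) has_vector_derivative f x * g' x + f' x * g x) (at x)" for x
    by (intro has_vector_derivative_mult fg)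
  then show ?case
    by (rule Ck_SucI) (intro Ck_add Suc.IH fg Ck_SucD[OF Suc.prems(1)] Ck_SucD[OF Suc.prems(2)])
qed

lemma Ck_const: "Ck n (\<lambda>x. c)"
proof (induction n arbitrary: c)
  case (Suc n)
  have "((\<lambda>x. c) has_vector_derivative 0) (at x)" for x :: real by simp
  then show ?case by (rule Ck_SucI) (rule Suc)
qed auto

lemma Ck_sinh: "Ck n (\<lambda>x. of_real (sinh x)) \<and> Ck n (\<lambda>x. of_real (cosh x))"
proof (induction n)
  case 0
  then show ?case by (auto intro!: continuous_intros)
next
  case (Suc n)
  have "((\<lambda>x. complex_of_real (sinh x)) has_vector_derivative of_real (cosh x)) (at x)"
    "((\<lambda>x. complex_of_real (cosh x)) has_vector_derivative of_real (sinh x)) (at x)" for x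
    by (intro has_vector_derivative_of_real; auto intro!: derivative_eq_intros simp flip: has_real_derivative_iff_has_vector_derivative)+
  then show ?case using Suc Ck_SucI by metis
qed

text \<open>The number \<open>s\<close> is the parity, 1 for even and -1 for odd; differentiation
  changes its sign.\<close>

definition test_fun :: "complex \<Rightarrow> (real \<Rightarrow> complex) \<Rightarrow> bool" where
  "test_fun s g \<longleftrightarrow> (\<forall>n. Ck n g) \<and> (\<exists>R. \<forall>x. R < \<bar>x\<bar> \<longrightarrow> g x = 0) \<and> (\<forall>x. g (- x) = s * g x)"

abbreviation D :: "(real \<Rightarrow> complex) \<Rightarrow> real \<Rightarrow> complex" where
  "D g \<equiv> \<lambda>x. vector_derivative g (at x)"

lemma test_fun_test_function:
  assumes "test_function g" "\<And>x. g (- x) = g x"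
  shows "test_fun 1 g"
proof -
  have sm: "((D ^^ n) g) differentiable (at x)" for n x
    using assms(1) by (auto simp: test_function_def smooth_real_def)
  have "Ck n ((D ^^ k) g)" for n k
  proof (induction n arbitrary: k)
    case 0
    then show ?case
      using sm by (auto intro!: continuous_at_imp_continuous_on differentiable_imp_continuous_within)
  next
    case (Suc n)
    have "((D ^^ k) g has_vector_derivative (D ^^ Suc k) g x) (at x)" for x
      using sm[of k x] by (simp add: vector_derivative_works)
    then show ?case by (rule Ck_SucI) (rule Suc)
  qed
  from this[of _ 0] have "\<forall>n. Ck n g" by simp
  moreover have "bounded {x. g x \<noteq> 0}"
    using assms(1) compact_imp_bounded bounded_subset closure_subset unfolding test_function_def by metis
  then obtain R where "\<And>x. g x \<noteq> 0 \<Longrightarrow> \<bar>x\<bar> \<le> R"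
    unfolding bounded_real by auto
  then have "\<forall>x. R < \<bar>x\<bar> \<longrightarrow> g x = 0" by (metis not_le)
  ultimately show ?thesis using assms(2) by (auto simp: test_fun_def)
qed

lemma test_fun_deriv:
  assumes "test_fun s g"
  shows "test_fun (- s) (D g)" "(g has_vector_derivative D g x) (at x)"
proof -
  have Ck: "Ck n g" for n using assms by (simp add: test_fun_def)
  have der: "(g has_vector_derivative D g x) (at x)" for x
    using Ck[of "Suc 0"] by (auto intro!: vector_derivative_works[THEN iffD1] differentiableI_vector)
  then show "(g has_vector_derivative D g x) (at x)" .
  have "Ck n (D g)" for n
  proof -
    obtain g' where g': "\<And>x. (g has_vector_derivative g' x) (at x)" "Ck n g'"
      using Ck[of "Suc n"] by auto
    then have "D g = g'" by (auto simp: vector_derivative_at)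
    with g'(2) show ?thesis by simp
  qed
  moreover obtain R where R: "\<And>x. R < \<bar>x\<bar> \<Longrightarrow> g x = 0" using assms by (auto simp: test_fun_def)
  have "D g x = 0" if "R < \<bar>x\<bar>" for x
  proof -
    have "open {x. R < \<bar>x\<bar>}" by (intro open_Collect_less continuous_intros)
    then have "(g has_vector_derivative 0) (at x)"
      by (rule has_vector_derivative_transform_within_open[of "\<lambda>_. 0", rotated 1]) (use that R in auto)
    then show ?thesis by (rule vector_derivative_at)
  qed
  moreover have "D g (- x) = - s * D g x" for x
  proof -
    have "((\<lambda>x. g (- x)) has_vector_derivative - D g (- x)) (at x)"
      by (rule has_vector_derivative_minus_arg[OF der])
    moreover have "(\<lambda>x. g (- x)) = (\<lambda>x. s * g x)" using assms by (auto simp: test_fun_def)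
    moreover have "((\<lambda>x. s * g x) has_vector_derivative s * D g x) (at x)"
      by (rule has_vector_derivative_mult_right[OF der])
    ultimately have "- D g (- x) = s * D g x"
      using vector_derivative_unique_at by metis
    then show ?thesis by (metis minus_equation_iff mult_minus_left)
  qed
  ultimately show "test_fun (- s) (D g)" unfolding test_fun_def by blast
qed

lemma test_fun_continuous: "test_fun s g \<Longrightarrow> continuous_on S g"
  unfolding test_fun_def using Ck.simps(1) continuous_on_subset by blast

lemma test_fun_diff: "test_fun s f \<Longrightarrow> test_fun s g \<Longrightarrow> test_fun s (\<lambda>x. f x - g x)"
proof -
  assume fg: "test_fun s f" "test_fun s g"
  obtain R1 R2 where R: "\<And>x. R1 < \<bar>x\<bar> \<Longrightarrow> f x = 0" "\<And>x. R2 < \<bar>x\<bar> \<Longrightarrow> g x = 0"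
    using fg by (auto simp: test_fun_def)
  have "Ck n (\<lambda>x. f x + (-1) * g x)" for n
    using fg by (intro Ck_add Ck_mult Ck_const) (auto simp: test_fun_def)
  moreover have "\<exists>R. \<forall>x. R < \<bar>x\<bar> \<longrightarrow> f x - g x = 0"
    by (rule exI[of _ "max R1 R2"]) (use R in simp)
  moreover have "\<forall>x. f (- x) - g (- x) = s * (f x - g x)"
    using fg by (simp add: test_fun_def algebra_simps)
  ultimately show ?thesis unfolding test_fun_def by simp
qed

text \<open>The density sinh(x)/2 is the derivative of sinh(x/2)^2, the inverse of
  \<open>rho\<close>. A primitive \<open>P\<close> of the odd function \<open>?h\<close> is even, so
  its constant values to the left and to the right of the support coincide and can be
  subtracted.\<close>

lemma test_fun_primitive:
  assumes "test_fun 1 g"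
  shows "\<exists>G. test_fun 1 G \<and> (\<forall>x. (G has_vector_derivative g x * of_real (sinh x / 2)) (at x))"
proof -
  let ?h = "\<lambda>x. g x * of_real (sinh x / 2)"
  have Ckh: "Ck n ?h" for n
  proof -
    have "Ck n (\<lambda>x. g x * (of_real (sinh x) * (1/2)))"
      using assms Ck_sinh by (intro Ck_mult Ck_const) (auto simp: test_fun_def)
    then show ?thesis by simp
  qed
  obtain P where P: "\<And>x. (P has_vector_derivative ?h x) (at x)"
  proof -
    have "\<exists>F. \<forall>x. - \<infinity> < ereal x \<longrightarrow> ereal x < \<infinity> \<longrightarrow> (F has_vector_derivative ?h x) (at x)"
      using Ckh[of 0] by (intro einterval_antiderivative) (auto simp: continuous_on_eq_continuous_at)
    then show ?thesis using that by auto
  qed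
  have odd: "?h (- x) = - ?h x" for x using assms by (simp add: test_fun_def)
  obtain R where R: "\<And>x. R < \<bar>x\<bar> \<Longrightarrow> g x = 0" using assms by (auto simp: test_fun_def)
  have even: "P (- x) = P x" for x
  proof -
    have "((\<lambda>x. P (- x) - P x) has_vector_derivative 0) (at x)" for x
    proof -
      have "((\<lambda>x. P (- x)) has_vector_derivative - ?h (- x)) (at x)"
        by (rule has_vector_derivative_minus_arg[OF P])
      from has_vector_derivative_diff[OF this P[of x]] show ?thesis
        by (simp only: odd minus_minus diff_self)
    qed
    then obtain c where "\<And>x. P (- x) - P x = c"
      using has_vector_derivative_zero_constant[of UNIV "\<lambda>x. P (- x) - P x"] by auto
    from this[of 0] this[of x] show ?thesis by simp
  qed
  \<comment> \<open>The point |R| + 1 lies strictly beyond the support whatever the sign of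
    \<open>R\<close>.\<close>
  define G where "G x = P x - P (\<bar>R\<bar> + 1)" for x
  have dG: "(G has_vector_derivative ?h x) (at x)" for x
    unfolding G_def using has_vector_derivative_diff[OF P[of x] has_vector_derivative_const] by simp
  have "G x = 0" if "\<bar>R\<bar> < \<bar>x\<bar>" for x
  proof -
    have "G y = 0" if "\<bar>R\<bar> < y" for y
    proof -
      obtain c where c: "\<And>z. z \<in> {\<bar>R\<bar><..} \<Longrightarrow> G z = c"
      proof (rule has_vector_derivative_zero_constant[of "{\<bar>R\<bar><..}" G])
        show "(G has_vector_derivative 0) (at z within {\<bar>R\<bar><..})" if "z \<in> {\<bar>R\<bar><..}" for z
          using has_vector_derivative_at_within[OF dG[of z]] R[of z] that by simp
      qed (auto simp: convex_real_interval)
      from c[of y] c[of "\<bar>R\<bar> + 1"] that show ?thesis by (simp add: G_def)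
    qed
    from this[of "\<bar>x\<bar>"] that show ?thesis using even[of x] by (auto simp: G_def abs_if split: if_splits)
  qed
  moreover have "Ck n G" for n
    by (rule Ck_SucD[OF Ck_SucI[OF dG Ckh]])
  moreover have "G (- x) = 1 * G x" for x
    by (simp add: G_def even)
  ultimately have "test_fun 1 G"
    unfolding test_fun_def by blast
  then show ?thesis using dG by blast
qed

lemma integrable_compact_support:
  fixes f :: "real \<Rightarrow> complex"
  assumes "continuous_on UNIV f" "\<And>x. R < \<bar>x\<bar> \<Longrightarrow> f x = 0"
  shows "integrable lborel f"
proof -
  have "set_integrable lborel {-R..R} f"
    using assms(1) by (intro borel_integrable_atLeastAtMost') (auto intro: continuous_on_subset)
  also have "set_integrable lborel {-R..R} f = integrable lborel f"
    unfolding set_integrable_def using assms(2) by (intro Bochner_Integration.integrable_cong refl) (auto simp: indicator_def abs_le_iff not_le)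
  finally show ?thesis .
qed

lemma test_fun_integrable:
  assumes "test_fun s g" "continuous_on UNIV h"
  shows "integrable lborel (\<lambda>x. g x * h x)"
proof -
  obtain R where "\<And>x. R < \<bar>x\<bar> \<Longrightarrow> g x = 0" using assms by (auto simp: test_fun_def)
  then show ?thesis
    by (intro integrable_compact_support[of _ R] continuous_on_mult test_fun_continuous[OF assms(1)] assms(2)) auto
qed

lemma integral_deriv_compact_support:
  fixes P p :: "real \<Rightarrow> complex"
  assumes der: "\<And>x. (P has_vector_derivative p x) (at x)" and cont: "continuous_on UNIV p"
    and supp: "\<And>x. R < \<bar>x\<bar> \<Longrightarrow> P x = 0" "\<And>x. R < \<bar>x\<bar> \<Longrightarrow> p x = 0"
  shows "(LBINT x. p x) = 0"
proof -
  have "has_bochner_integral lborel (\<lambda>x. indicator {- (\<bar>R\<bar> + 1)..\<bar>R\<bar> + 1} x *\<^sub>R p x) (P (\<bar>R\<bar> + 1) - P (- (\<bar>R\<bar> + 1)))"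
    by (rule has_bochner_integral_FTC_Icc) (use der cont in \<open>auto intro: has_vector_derivative_at_within continuous_on_subset\<close>)
  moreover have "(\<lambda>x. indicator {- (\<bar>R\<bar> + 1)..\<bar>R\<bar> + 1} x *\<^sub>R p x) = p"
    using supp(2) by (fastforce simp: indicator_def abs_if split: if_splits)
  ultimately show ?thesis using supp(1)[of "\<bar>R\<bar> + 1"] supp(1)[of "- (\<bar>R\<bar> + 1)"]
    by (simp add: has_bochner_integral_integral_eq)
qed

section \<open>Decay and inversion of the cosine transform\<close>

definition cosft :: "(real \<Rightarrow> complex) \<Rightarrow> real \<Rightarrow> complex" where
  "cosft g t = (LBINT r. g r * of_real (cos (t * r)))"

lemma cosft_integrable: "test_fun s g \<Longrightarrow> integrable lborel (\<lambda>r. g r * of_real (cos (t * r)))"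
  by (intro test_fun_integrable) (auto intro!: continuous_intros)

lemma cosft_deriv2:
  assumes "test_fun s g"
  shows "cosft (D (D g)) t = - of_real (t\<^sup>2) * cosft g t"
proof -
  have g: "(g has_vector_derivative D g x) (at x)" "(D g has_vector_derivative D (D g) x) (at x)"
    "test_fun (- s) (D g)" "test_fun s (D (D g))" for x
    using test_fun_deriv[OF assms] test_fun_deriv[OF test_fun_deriv(1)[OF assms]] by auto
  obtain R1 R2 R3 where R: "\<And>x. R1 < \<bar>x\<bar> \<Longrightarrow> g x = 0" "\<And>x. R2 < \<bar>x\<bar> \<Longrightarrow> D g x = 0" "\<And>x. R3 < \<bar>x\<bar> \<Longrightarrow> D (D g) x = 0"
    using g assms unfolding test_fun_def by blast
  let ?P = "\<lambda>x. D g x * of_real (cos (t * x)) + g x * of_real (t * sin (t * x))"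
  let ?p = "\<lambda>x. D (D g) x * of_real (cos (t * x)) + of_real (t\<^sup>2) * (g x * of_real (cos (t * x)))"
  have "(LBINT x. ?p x) = 0"
  proof (rule integral_deriv_compact_support[where R = "max R1 (max R2 R3)"])
    fix x
    have c: "((\<lambda>x. complex_of_real (cos (t * x))) has_vector_derivative of_real (- t * sin (t * x))) (at x)"
      "((\<lambda>x. complex_of_real (t * sin (t * x))) has_vector_derivative of_real (t * (t * cos (t * x)))) (at x)"
      by (intro has_vector_derivative_of_real; auto intro!: derivative_eq_intros simp flip: has_real_derivative_iff_has_vector_derivative)+
    have "(?P has_vector_derivative (D g x * of_real (- t * sin (t * x)) + D (D g) x * of_real (cos (t * x)))
        + (g x * of_real (t * (t * cos (t * x))) + D g x * of_real (t * sin (t * x)))) (at x)"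
      by (intro has_vector_derivative_add has_vector_derivative_mult g c)
    then show "(?P has_vector_derivative ?p x) (at x)"
      by (simp add: power2_eq_square mult_ac)
  next
    show "continuous_on UNIV ?p"
      using assms g by (intro continuous_intros test_fun_continuous)
  qed (use R in auto)
  moreover have "(LBINT x. ?p x) = cosft (D (D g)) t + of_real (t\<^sup>2) * cosft g t"
    unfolding cosft_def using cosft_integrable[OF assms, of t] cosft_integrable[OF g(4), of t]
    by (subst Bochner_Integration.integral_add) auto
  ultimately show ?thesis by (simp add: add_eq_0_iff)
qed

text \<open>Applying 1 - D^2 to g multiplies the transform by 1 + t^2, so N is traded for
  derivatives of g; N = 0 is the L1 bound.\<close>

lemma cosft_rapid:
  assumes "test_fun s g"
  shows "\<exists>C. \<forall>t. norm (cosft g t) * (1 + t\<^sup>2) ^ N \<le> C"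
  using assms
proof (induction N arbitrary: g)
  case 0
  have "norm (cosft g t) \<le> (LBINT r. norm (g r))" for t
  proof -
    have "norm (cosft g t) \<le> (LBINT r. norm (g r * of_real (cos (t * r))))"
      unfolding cosft_def by (rule integral_norm_bound)
    also have "\<dots> \<le> (LBINT r. norm (g r))"
    proof (rule integral_mono)
      show "integrable lborel (\<lambda>r. norm (g r))"
        using test_fun_integrable[OF 0, of "\<lambda>_. 1"] by simp
      show "norm (g r * of_real (cos (t * r))) \<le> norm (g r)" for r
        by (simp add: norm_mult mult_left_le)
    qed (intro integrable_norm cosft_integrable[OF 0])
    finally show ?thesis .
  qed
  then show ?case by auto
next
  case (Suc N)
  have tf2: "test_fun s (D (D g))" using test_fun_deriv(1)[OF test_fun_deriv(1)[OF Suc.prems]] by simp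
  obtain C where C: "\<And>t. norm (cosft (\<lambda>x. g x - D (D g) x) t) * (1 + t\<^sup>2) ^ N \<le> C"
    using Suc.IH[OF test_fun_diff[OF Suc.prems tf2]] by blast
  have "norm (cosft g t) * (1 + t\<^sup>2) ^ Suc N = norm (cosft (\<lambda>x. g x - D (D g) x) t) * (1 + t\<^sup>2) ^ N" for t
  proof -
    have "cosft (\<lambda>x. g x - D (D g) x) t = cosft g t - cosft (D (D g)) t"
      unfolding cosft_def using cosft_integrable[OF Suc.prems, of t] cosft_integrable[OF tf2, of t]
      by (simp add: left_diff_distrib)
    also have "\<dots> = of_real (1 + t\<^sup>2) * cosft g t"
      unfolding cosft_deriv2[OF Suc.prems] by (simp add: algebra_simps)
    finally have "norm (cosft (\<lambda>x. g x - D (D g) x) t) = (1 + t\<^sup>2) * norm (cosft g t)"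
      by (simp only: norm_mult norm_of_real) (simp add: abs_of_nonneg)
    then show ?thesis by simp
  qed
  with C show ?case by metis
qed

lemma cosft_measurable:
  assumes "test_fun s g" shows "cosft g \<in> borel_measurable borel"
proof -
  have [measurable]: "g \<in> borel_measurable borel"
    using test_fun_continuous[OF assms] by (rule borel_measurable_continuous_onI)
  show ?thesis unfolding cosft_def[abs_def]
    by (rule lborel.borel_measurable_lebesgue_integral) measurable
qed

lemma integrable_inverse_1_plus_sq: "integrable lborel (\<lambda>x::real. C / (1 + x\<^sup>2))"
proof -
  have "integrable lborel (\<lambda>x::real. inverse (1 + x\<^sup>2))"
    using integrable_inverse_1_plus_square by (simp add: set_integrable_def)
  from integrable_mult_right[OF this, of C] show ?thesis by (simp add: divide_inverse)
qed

text \<open>One more power of 1 + t^2 than the growth of \<open>k\<close> requires leaves the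
  integrable majorant 1 / (1 + t^2).\<close>

lemma rapid_integrable:
  fixes f k :: "real \<Rightarrow> complex"
  assumes f: "f \<in> borel_measurable borel" and rapid: "\<And>N. \<exists>C. \<forall>t. norm (f t) * (1 + t\<^sup>2) ^ N \<le> C"
    and k: "k \<in> borel_measurable borel" and bd: "\<And>t. norm (k t) \<le> K * (1 + t\<^sup>2) ^ N"
  shows "\<exists>C. \<forall>t. norm (f t) * (K * (1 + t\<^sup>2) ^ N) \<le> C / (1 + t\<^sup>2)"
    and "integrable lborel (\<lambda>t. f t * k t)"
proof -
  obtain C where C: "\<And>t. norm (f t) * (1 + t\<^sup>2) ^ Suc N \<le> C" using rapid by blast
  have p: "1 + t\<^sup>2 > 0" for t :: real by (simp add: add_pos_nonneg)
  have K: "K \<ge> 0" using order_trans[OF norm_ge_zero bd[of 0]] by simp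
  have le: "norm (f t) * (K * (1 + t\<^sup>2) ^ N) \<le> (K * C) / (1 + t\<^sup>2)" for t
    using mult_left_mono[OF C[of t] K] p[of t] by (simp add: field_simps)
  then show "\<exists>C. \<forall>t. norm (f t) * (K * (1 + t\<^sup>2) ^ N) \<le> C / (1 + t\<^sup>2)" by blast
  show "integrable lborel (\<lambda>t. f t * k t)"
  proof (rule Bochner_Integration.integrable_bound[OF integrable_inverse_1_plus_sq[of "K * C"]])
    show "(\<lambda>t. f t * k t) \<in> borel_measurable lborel" using f k by measurable
    have "norm (f t * k t) \<le> norm (K * C / (1 + t\<^sup>2))" for t
    proof -
      have "norm (f t * k t) \<le> norm (f t) * (K * (1 + t\<^sup>2) ^ N)"
        unfolding norm_mult by (intro mult_left_mono bd) auto
      also note le[of t]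
      also have "K * C / (1 + t\<^sup>2) \<le> norm (K * C / (1 + t\<^sup>2))" by (simp only: real_norm_def abs_ge_self)
      finally show ?thesis .
    qed
    then show "AE t in lborel. norm (f t * k t) \<le> norm (K * C / (1 + t\<^sup>2))" by simp
  qed
qed

text \<open>The characteristic function of the standard normal law, rescaled by
  \<open>n\<close>.\<close>

lemma gaussian_cos_integral:
  assumes n: "n > 0"
  shows "integrable lborel (\<lambda>t. exp (- (t / n)\<^sup>2 / 2))"
    and "(LBINT t. cos (t * x) * exp (- (t / n)\<^sup>2 / 2)) = 2 * pi * (n * std_normal_density (n * x))"
proof -
  have E: "exp (- (t / n)\<^sup>2 / 2) = sqrt (2 * pi) * std_normal_density (0 + 1/n * t)" for t
    by (simp add: std_normal_density_def)
  show "integrable lborel (\<lambda>t. exp (- (t / n)\<^sup>2 / 2))"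
    unfolding E using n by (intro integrable_mult_right lborel_integrable_real_affine integrable_normal_density) auto
  have "char std_normal_distribution y = (CLINT x|lborel. std_normal_density x *\<^sub>R iexp (y * x))" for y
    unfolding char_def by (subst integral_density) auto
  then have c: "(CLINT x|lborel. std_normal_density x *\<^sub>R iexp (y * x)) = of_real (exp (- (y^2) / 2))" for y
    by (metis char_std_normal_distribution)
  have int: "integrable lborel (\<lambda>x. std_normal_density x *\<^sub>R iexp (y * x))" for y
    by (rule Bochner_Integration.integrable_bound[OF integrable_normal_density[of 1 0]]) (auto simp: normal_density_nonneg)
  have cos: "(LBINT x. std_normal_density x * cos (y * x)) = exp (- (y^2) / 2)" for y
  proof -
    have "Re (CLINT x|lborel. std_normal_density x *\<^sub>R iexp (y * x)) = (LBINT x. Re (std_normal_density x *\<^sub>R iexp (y * x)))"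
      using int by (intro integral_Re[symmetric])
    then show ?thesis unfolding c by (simp add: cis_conv_exp[symmetric] exp_of_real flip: of_real_mult)
  qed
  have "(LBINT t. cos (t * x) * exp (- (t / n)\<^sup>2 / 2)) = \<bar>n\<bar> *\<^sub>R (LBINT t. cos ((0 + n * t) * x) * exp (- ((0 + n * t) / n)\<^sup>2 / 2))"
    using n by (intro lborel_integral_real_affine) auto
  also have "(LBINT t. cos ((0 + n * t) * x) * exp (- ((0 + n * t) / n)\<^sup>2 / 2)) = (LBINT t. sqrt (2 * pi) * (std_normal_density t * cos ((n * x) * t)))"
    using n by (intro Bochner_Integration.integral_cong) (auto simp: std_normal_density_def mult_ac)
  also have "\<dots> = sqrt (2 * pi) * exp (- ((n * x)\<^sup>2) / 2)"
    by (simp add: cos)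
  also have "\<dots> = 2 * pi * std_normal_density (n * x)"
    by (simp add: std_normal_density_def field_simps)
  finally show "(LBINT t. cos (t * x) * exp (- (t / n)\<^sup>2 / 2)) = 2 * pi * (n * std_normal_density (n * x))"
    using n by simp
qed

lemma integrable_pair_mult:
  fixes f g :: "real \<Rightarrow> real"
  assumes f: "integrable lborel f" and g: "integrable lborel g"
  shows "integrable (lborel \<Otimes>\<^sub>M lborel) (\<lambda>(x, y). f x * g y)"
proof (rule lborel_pair.Fubini_integrable)
  have [measurable]: "f \<in> borel_measurable borel" "g \<in> borel_measurable borel"
    using f g by (auto dest: borel_measurable_integrable)
  show "(\<lambda>(x, y). f x * g y) \<in> borel_measurable (lborel \<Otimes>\<^sub>M lborel)" by measurable
  have "integrable lborel (\<lambda>x. \<bar>f x\<bar> * (LBINT y. \<bar>g y\<bar>))"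
    using f by (intro integrable_mult_left) auto
  then show "integrable lborel (\<lambda>x. LBINT y. norm (case (x, y) of (x, y) \<Rightarrow> f x * g y))"
    by (simp add: abs_mult)
  show "AE x in lborel. integrable lborel (\<lambda>y. case (x, y) of (x, y) \<Rightarrow> f x * g y)"
    using g by simp
qed

lemma Fubini_dominated:
  fixes k :: "real \<Rightarrow> real \<Rightarrow> complex" and f g :: "real \<Rightarrow> real"
  assumes k: "(\<lambda>(x, y). k x y) \<in> borel_measurable (borel \<Otimes>\<^sub>M borel)"
    and f: "integrable lborel f" and g: "integrable lborel g" and le: "\<And>x y. norm (k x y) \<le> f x * g y"
  shows "(LBINT x. LBINT y. k x y) = (LBINT y. LBINT x. k x y)"
proof -
  have [measurable]: "(\<lambda>(x, y). k x y) \<in> borel_measurable (lborel \<Otimes>\<^sub>M lborel)"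
    using k by (simp cong: measurable_cong_sets)
  have "integrable (lborel \<Otimes>\<^sub>M lborel) (\<lambda>(x, y). k x y)"
  proof (rule Bochner_Integration.integrable_bound[OF integrable_pair_mult[OF f g]])
    show "AE x in lborel \<Otimes>\<^sub>M lborel. norm (case x of (x, y) \<Rightarrow> k x y) \<le> norm (case x of (x, y) \<Rightarrow> f x * g y)"
      using le by (auto intro!: AE_I2 order_trans[OF _ abs_ge_self])
  qed measurable
  from lborel_pair.Fubini_integral[OF this] show ?thesis by simp
qed

lemma gaussian_approximate_identity:
  assumes g: "test_fun s g"
  shows "(\<lambda>k. LBINT s. g s * of_real (real (Suc k) * std_normal_density (real (Suc k) * (s - r)))) \<longlonglongrightarrow> g r"
proof -
  let ?n = "\<lambda>k. real (Suc k)"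
  have [measurable]: "g \<in> borel_measurable borel"
    using test_fun_continuous[OF g] by (rule borel_measurable_continuous_onI)
  obtain R where R: "\<And>x. R < \<bar>x\<bar> \<Longrightarrow> g x = 0" using g by (auto simp: test_fun_def)
  have "compact (g ` {-R..R})" by (intro compact_continuous_image test_fun_continuous[OF g]) auto
  then obtain M where "\<And>x. x \<in> {-R..R} \<Longrightarrow> norm (g x) \<le> M"
    using compact_imp_bounded bounded_iff by (metis imageI)
  then have M: "norm (g x) \<le> max M 0" for x
  proof (cases "R < \<bar>x\<bar>")
    case True
    then show ?thesis by (simp add: R)
  next
    case False
    then have "x \<in> {-R..R}" by auto
    then show ?thesis using \<open>\<And>x. x \<in> {-R..R} \<Longrightarrow> norm (g x) \<le> M\<close> by (simp add: le_max_iff_disj)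
  qed
  have eq: "(LBINT s. g s * of_real (?n k * std_normal_density (?n k * (s - r)))) = (LBINT y. g (r + 1 / ?n k * y) * of_real (std_normal_density y))" for k
  proof -
    have "(LBINT s. g s * of_real (?n k * std_normal_density (?n k * (s - r)))) =
      \<bar>1 / ?n k\<bar> *\<^sub>R (LBINT y. g (r + 1 / ?n k * y) * of_real (?n k * std_normal_density (?n k * ((r + 1 / ?n k * y) - r))))"
      by (intro lborel_integral_real_affine) auto
    also have "\<dots> = (LBINT y. \<bar>1 / ?n k\<bar> *\<^sub>R (g (r + 1 / ?n k * y) * of_real (?n k * std_normal_density (?n k * ((r + 1 / ?n k * y) - r)))))"
      by (rule integral_scaleR_right[symmetric])
    also have "\<dots> = (LBINT y. g (r + 1 / ?n k * y) * of_real (std_normal_density y))"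
      by (intro Bochner_Integration.integral_cong) (auto simp: scaleR_conv_of_real simp del: of_nat_Suc)
    finally show ?thesis .
  qed
  have "(\<lambda>k. LBINT y. g (r + 1 / ?n k * y) * of_real (std_normal_density y)) \<longlonglongrightarrow> (LBINT y. g r * of_real (std_normal_density y))"
  proof (rule integral_dominated_convergence[where w = "\<lambda>y. max M 0 * std_normal_density y"])
    show "integrable lborel (\<lambda>y. max M 0 * std_normal_density y)"
      by (intro integrable_mult_right integrable_normal_density) auto
    show "AE y in lborel. (\<lambda>k. g (r + 1 / ?n k * y) * of_real (std_normal_density y)) \<longlonglongrightarrow> g r * of_real (std_normal_density y)"
    proof (intro AE_I2 tendsto_mult tendsto_const)
      fix y
      have "(\<lambda>k. r + 1 / ?n k * y) \<longlonglongrightarrow> r + 0 * y"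
        by (intro tendsto_intros LIMSEQ_Suc[OF lim_1_over_n])
      moreover have "isCont g r" using test_fun_continuous[OF g, of UNIV] by (simp add: continuous_on_eq_continuous_at)
      ultimately show "(\<lambda>k. g (r + 1 / ?n k * y)) \<longlonglongrightarrow> g r"
        by (intro isCont_tendsto_compose[of r g]) auto
    qed
    show "AE y in lborel. norm (g (r + 1 / ?n k * y) * of_real (std_normal_density y)) \<le> max M 0 * std_normal_density y" for k
      using M by (auto simp: norm_mult normal_density_nonneg intro!: AE_I2 mult_right_mono simp del: of_nat_Suc)
  qed measurable
  moreover have "(LBINT y. g r * complex_of_real (std_normal_density y)) = g r"
    using integral_normal_density[of 1 0] by (simp add: integral_mult_right_zero integral_complex_of_real)
  ultimately show ?thesis unfolding eq by simp
qed

lemma cosft_integrable_mult: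
  assumes g: "test_fun s g" and k: "k \<in> borel_measurable borel" "\<And>t. norm (k t) \<le> K * (1 + t\<^sup>2) ^ N"
  shows "integrable lborel (\<lambda>t. cosft g t * k t)"
  using rapid_integrable(2)[OF cosft_measurable[OF g] cosft_rapid[OF g] k] .

text \<open>The Gaussian factor makes the double integral absolutely convergent, which allows
  Fubini. As cos(ts) cos(tr) is half the sum of cos(t(s - r)) and cos(t(s + r)), two approximate
  identities of mass pi arise, at r and at -r; evenness of g merges them into 2 pi g(r).\<close>

lemma cosft_inversion:
  assumes g: "test_fun 1 g"
  shows "g r = 1 / (2 * pi) * (LBINT t. cosft g t * of_real (cos (t * r)))"
proof -
  let ?n = "\<lambda>k. real (Suc k)"
  let ?E = "\<lambda>k t. exp (- (t / ?n k)\<^sup>2 / 2)"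
  let ?N = "\<lambda>k x. ?n k * std_normal_density (?n k * x)"
  have [measurable]: "g \<in> borel_measurable borel"
    using test_fun_continuous[OF g] by (rule borel_measurable_continuous_onI)
  have [measurable]: "cosft g \<in> borel_measurable borel" by (rule cosft_measurable[OF g])
  have intg: "integrable lborel g" using test_fun_integrable[OF g, of "\<lambda>_. 1"] by simp
  have even: "g (- x) = g x" for x using g by (simp add: test_fun_def)
  have 1: "(\<lambda>k. LBINT t. cosft g t * of_real (cos (t * r) * ?E k t)) \<longlonglongrightarrow> (LBINT t. cosft g t * of_real (cos (t * r)))"
  proof (rule integral_dominated_convergence[where w = "\<lambda>t. norm (cosft g t)"])
    show "integrable lborel (\<lambda>t. norm (cosft g t))"
      using cosft_integrable_mult[OF g, of "\<lambda>_. 1" 1 0] by (intro integrable_norm) simp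
    show "AE t in lborel. (\<lambda>k. cosft g t * of_real (cos (t * r) * ?E k t)) \<longlonglongrightarrow> cosft g t * of_real (cos (t * r))"
    proof (rule AE_I2)
      fix t
      have "(\<lambda>k. 1 / ?n k) \<longlonglongrightarrow> 0" by (rule LIMSEQ_Suc[OF lim_1_over_n])
      then have "(\<lambda>k. cosft g t * of_real (cos (t * r) * exp (- (t * (1 / ?n k))\<^sup>2 / 2))) \<longlonglongrightarrow> cosft g t * of_real (cos (t * r) * exp (- (t * 0)\<^sup>2 / 2))"
        by (intro tendsto_intros) auto
      then show "(\<lambda>k. cosft g t * of_real (cos (t * r) * ?E k t)) \<longlonglongrightarrow> cosft g t * of_real (cos (t * r))"
        by (simp del: of_nat_Suc)
    qed
    have "\<bar>cos (t * r)\<bar> * ?E k t \<le> 1 * 1" for k t by (intro mult_mono) auto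
    then show "AE t in lborel. norm (cosft g t * of_real (cos (t * r) * ?E k t)) \<le> norm (cosft g t)" for k
      by (auto simp: norm_mult abs_mult intro!: AE_I2 mult_left_le simp del: of_nat_Suc of_real_mult)
  qed measurable
  have 2: "(LBINT t. cosft g t * of_real (cos (t * r) * ?E k t)) =
     of_real pi * ((LBINT s. g s * of_real (?N k (s - r))) + (LBINT s. g s * of_real (?N k (s - (- r)))))" for k
  proof -
    have E: "integrable lborel (?E k)" by (rule gaussian_cos_integral(1)) simp
    have c: "integrable lborel (\<lambda>t. cos (t * x) * ?E k t)" for x
      by (rule Bochner_Integration.integrable_bound[OF E]) (auto simp: abs_mult mult_left_le_one_le simp del: of_nat_Suc)
    have intN: "integrable lborel (\<lambda>s. g s * of_real (?N k (s - x)))" for x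
      by (intro test_fun_integrable[OF g]) (auto intro!: continuous_intros simp: normal_density_def)
    have "(LBINT t. cosft g t * of_real (cos (t * r) * ?E k t)) = (LBINT t. LBINT s. g s * of_real (cos (t * s)) * of_real (cos (t * r) * ?E k t))"
      unfolding cosft_def by (simp only: integral_mult_left_zero)
    also have "\<dots> = (LBINT s. LBINT t. g s * of_real (cos (t * s)) * of_real (cos (t * r) * ?E k t))"
    proof (rule Fubini_dominated[OF _ E integrable_norm[OF intg]])
      fix t s
      have "norm (g s) * \<bar>cos (t * s)\<bar> * (\<bar>cos (t * r)\<bar> * ?E k t) \<le> norm (g s) * 1 * (1 * ?E k t)"
        by (intro mult_mono mult_nonneg_nonneg) auto
      then show "norm (g s * of_real (cos (t * s)) * of_real (cos (t * r) * ?E k t)) \<le> ?E k t * norm (g s)"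
        by (simp add: norm_mult abs_mult mult_ac)
    qed measurable
    also have "\<dots> = (LBINT s. g s * of_real (pi * ?N k (s - r)) + g s * of_real (pi * ?N k (s - (- r))))"
    proof (intro Bochner_Integration.integral_cong refl)
      fix s
      have "cos (t * s) * (cos (t * r) * ?E k t) = 1/2 * (cos (t * (s - r)) * ?E k t + cos (t * (s - (- r))) * ?E k t)" for t
        by (simp add: cos_diff cos_add right_diff_distrib distrib_left algebra_simps)
      then have "(LBINT t. cos (t * s) * (cos (t * r) * ?E k t)) = 1/2 * ((LBINT t. cos (t * (s - r)) * ?E k t) + (LBINT t. cos (t * (s - (- r))) * ?E k t))"
        using c by (simp only: integral_mult_right_zero Bochner_Integration.integral_add)
      also have "\<dots> = pi * ?N k (s - r) + pi * ?N k (s - (- r))"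
        using gaussian_cos_integral(2)[of "?n k"] by (simp del: of_nat_Suc)
      finally have *: "(LBINT t. cos (t * s) * (cos (t * r) * ?E k t)) = pi * ?N k (s - r) + pi * ?N k (s - (- r))" .
      have "(LBINT t. g s * of_real (cos (t * s)) * of_real (cos (t * r) * ?E k t)) = (LBINT t. g s * complex_of_real (cos (t * s) * (cos (t * r) * ?E k t)))"
        by (intro Bochner_Integration.integral_cong) (auto simp: mult_ac)
      also have "\<dots> = g s * of_real (LBINT t. cos (t * s) * (cos (t * r) * ?E k t))"
        by (simp only: integral_mult_right_zero integral_complex_of_real)
      finally show "(LBINT t. g s * of_real (cos (t * s)) * of_real (cos (t * r) * ?E k t)) = g s * of_real (pi * ?N k (s - r)) + g s * of_real (pi * ?N k (s - (- r)))"
        unfolding * by (simp add: distrib_left del: of_nat_Suc)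
    qed
    also have "\<dots> = (LBINT s. of_real pi * (g s * of_real (?N k (s - r))) + of_real pi * (g s * of_real (?N k (s - (- r)))))"
      by (simp add: mult_ac)
    also have "\<dots> = of_real pi * (LBINT s. g s * of_real (?N k (s - r))) + of_real pi * (LBINT s. g s * of_real (?N k (s - (- r))))"
      by (subst Bochner_Integration.integral_add[OF integrable_mult_right[OF intN] integrable_mult_right[OF intN]])
         (simp only: integral_mult_right_zero)
    finally show ?thesis by (simp only: distrib_left)
  qed
  have "(\<lambda>k. of_real pi * ((LBINT s. g s * of_real (?N k (s - r))) + (LBINT s. g s * of_real (?N k (s - (- r)))))) \<longlonglongrightarrow> of_real pi * (g r + g (- r))"
    by (intro tendsto_mult tendsto_const tendsto_add gaussian_approximate_identity[OF g])
  with 1 have "(LBINT t. cosft g t * of_real (cos (t * r))) = of_real pi * (g r + g (- r))"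
    unfolding 2 by (rule LIMSEQ_unique)
  then show ?thesis by (simp add: even)
qed

lemma cosft_inversion_deriv:
  assumes g: "test_fun 1 g"
  shows "D g r = - (1 / (2 * pi)) * (LBINT t. cosft g t * of_real (t * sin (t * r)))"
proof -
  have int: "integrable lborel (\<lambda>t. cosft g t * of_real (cos (t * r)))" for r
    by (rule cosft_integrable_mult[OF g, of _ 1 0]) auto
  have K: "integrable lborel (\<lambda>t. norm (cosft g t * of_real (1 + t\<^sup>2)))"
    by (intro integrable_norm cosft_integrable_mult[OF g, of _ 1 1]) (auto simp del: of_real_add)
  have [measurable]: "cosft g \<in> borel_measurable borel" by (rule cosft_measurable[OF g])
  have bd: "norm (cosft g t * - of_real (t * sin (t * r))) \<le> norm (cosft g t * of_real (1 + t\<^sup>2))" for t r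
  proof -
    have "\<bar>t * sin (t * r)\<bar> \<le> \<bar>t\<bar> * 1" unfolding abs_mult by (intro mult_left_mono) auto
    also have "\<dots> \<le> 1 + t\<^sup>2"
    proof -
      have "0 \<le> (\<bar>t\<bar> - 1)\<^sup>2 + \<bar>t\<bar>" by simp
      then show ?thesis by (simp add: power2_eq_square algebra_simps flip: abs_mult)
    qed
    finally show ?thesis unfolding norm_mult norm_minus_cancel norm_of_real
      by (intro mult_left_mono) (auto simp: abs_of_nonneg)
  qed
  have "((\<lambda>r. LBINT t. cosft g t * of_real (cos (t * r))) has_vector_derivative (LBINT t. cosft g t * - of_real (t * sin (t * r)))) (at r within UNIV)"
  proof (rule leibniz_dominated(1)[OF convex_UNIV UNIV_I _ int K bd])
    show "((\<lambda>u. cosft g w * of_real (cos (w * u))) has_vector_derivative cosft g w * - of_real (w * sin (w * u))) (at u within UNIV)" for u w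
    proof -
      have "((\<lambda>u. complex_of_real (cos (w * u))) has_vector_derivative of_real (- (w * sin (w * u)))) (at u)"
        by (intro has_vector_derivative_of_real; auto intro!: derivative_eq_intros simp flip: has_real_derivative_iff_has_vector_derivative)
      from has_vector_derivative_mult_right[OF this, of "cosft g w"] show ?thesis by simp
    qed
  qed measurable
  then have "((\<lambda>r. of_real (1 / (2 * pi)) * (LBINT t. cosft g t * of_real (cos (t * r)))) has_vector_derivative of_real (1 / (2 * pi)) * (LBINT t. cosft g t * - of_real (t * sin (t * r)))) (at r)"
    by (intro has_vector_derivative_mult_right) simp
  also have "(\<lambda>r. of_real (1 / (2 * pi)) * (LBINT t. cosft g t * of_real (cos (t * r)))) = g"
    using cosft_inversion[OF g] by auto
  finally show ?thesis by (simp add: vector_derivative_at)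
qed

subsection \<open>The sine transform of the reciprocal hyperbolic sine\<close>

lemma of_real_cosh: "complex_of_real (cosh x) = cosh (of_real x)"
  and of_real_sinh: "complex_of_real (sinh x) = sinh (of_real x)"
  by (simp_all add: cosh_def sinh_def scaleR_conv_of_real exp_of_real flip: of_real_minus)

text \<open>The product of Gamma(w), Gamma(1 - w) and sin(pi w) is constant on the strip 0 < Re w <
  1. Its logarithmic derivative at 1/2 + i t gives the difference as -pi cot(pi (1/2 + i t)), and
  the cotangent equals -i tanh(pi t).\<close>

lemma Digamma_reflection_half:
  "Digamma (1/2 + \<i> * of_real t) - Digamma (1/2 - \<i> * of_real t) = \<i> * of_real (pi * tanh (pi * t))"
proof -
  define z where "z = 1/2 + \<i> * complex_of_real t"
  let ?U = "{w :: complex. 0 < Re w} \<inter> {w. Re w < 1}"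
  have U: "open ?U" "z \<in> ?U"
    by (auto intro!: open_Int open_halfspace_Re_gt open_halfspace_Re_lt simp: z_def)
  have nz: "w \<notin> \<int>\<^sub>\<le>\<^sub>0" "1 - w \<notin> \<int>\<^sub>\<le>\<^sub>0" if "w \<in> ?U" for w
    using that nonpos_Ints_subset_nonpos_Reals by (auto simp: complex_nonpos_Reals_iff subset_iff)+
  have sin_nz: "sin (of_real pi * w) \<noteq> 0" if "w \<in> ?U" for w
  proof
    assume "sin (of_real pi * w) = 0"
    then obtain n :: int where "of_real pi * w = of_int n * of_real pi" unfolding sin_eq_0 by auto
    then have "w = of_int n" by (metis mult.commute mult_cancel_right of_real_eq_0_iff pi_neq_zero)
    then show False using that by auto
  qed
  let ?f = "\<lambda>w. Gamma w * Gamma (1 - w) * sin (of_real pi * w)"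
  have const: "?f w = of_real pi" if "w \<in> ?U" for w
    using sin_nz[OF that] unfolding Gamma_reflection_complex by simp
  have "(?f has_field_derivative
     (Gamma z * Digamma z * Gamma (1 - z) - Gamma z * (Gamma (1 - z) * Digamma (1 - z))) * sin (of_real pi * z)
      + Gamma z * Gamma (1 - z) * (cos (of_real pi * z) * of_real pi)) (at z)"
    by (rule derivative_eq_intros refl nz[OF U(2)])+ simp
  moreover have "(?f has_field_derivative 0) (at z)"
    by (rule has_field_derivative_transform_within_open[OF DERIV_const U]) (use const in auto)
  ultimately have "(Gamma z * Digamma z * Gamma (1 - z) - Gamma z * (Gamma (1 - z) * Digamma (1 - z))) * sin (of_real pi * z)
      + Gamma z * Gamma (1 - z) * (cos (of_real pi * z) * of_real pi) = 0"
    by (rule DERIV_unique)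
  then have "Gamma z * Gamma (1 - z) * ((Digamma z - Digamma (1 - z)) * sin (of_real pi * z) + cos (of_real pi * z) * of_real pi) = 0"
    by (simp add: algebra_simps)
  moreover have "Gamma z \<noteq> 0" "Gamma (1 - z) \<noteq> 0"
    using nz[OF U(2)] by (auto simp: Gamma_eq_zero_iff)
  ultimately have e: "(Digamma z - Digamma (1 - z)) * sin (of_real pi * z) + cos (of_real pi * z) * of_real pi = 0"
    by simp
  have pz: "of_real pi * z = of_real (pi / 2) + \<i> * of_real (pi * t)"
    by (simp add: z_def algebra_simps)
  have s: "sin (of_real pi * z) = of_real (cosh (pi * t))"
    unfolding pz sin_add of_real_cosh cosh_conv_cos by (simp add: sin_of_real cos_of_real del: of_real_mult)
  have c: "cos (of_real pi * z) = - \<i> * of_real (sinh (pi * t))"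
  proof -
    have "sin (\<i> * w) = \<i> * sinh w" for w :: complex
      by (simp add: sinh_conv_sin)
    then show ?thesis
      unfolding pz cos_add of_real_sinh by (simp add: sin_of_real cos_of_real del: of_real_mult)
  qed
  have "complex_of_real (cosh (pi * t)) \<noteq> 0" by simp
  with e have "Digamma z - Digamma (1 - z) = \<i> * of_real (pi * tanh (pi * t))"
    unfolding s c tanh_def by (simp add: field_simps)
  moreover have "1 - z = 1/2 - \<i> * of_real t" by (simp add: z_def)
  ultimately show ?thesis by (simp add: z_def)
qed

text \<open>In the difference of the Digamma series at the conjugate points 1/2 + i t and 1/2 - i t,
  each term collapses to i times a real partial fraction.\<close>

lemma tanh_partial_fractions:
  "(\<lambda>n. 2 * t / ((real n + 1/2)\<^sup>2 + t\<^sup>2)) sums (pi * tanh (pi * t))"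
proof -
  let ?z = "1/2 + \<i> * complex_of_real t" and ?w = "1/2 - \<i> * complex_of_real t"
  let ?f = "\<lambda>z n. inverse (of_nat (Suc n)) - inverse (z + of_nat n) :: complex"
  have "?z \<noteq> 0" "?w \<noteq> 0" by (auto simp: complex_eq_iff)
  then have "(\<lambda>n. ?f ?z n - ?f ?w n) sums (suminf (?f ?z) - suminf (?f ?w))"
    by (intro sums_diff summable_sums summable_Digamma)
  moreover have "suminf (?f ?z) - suminf (?f ?w) = \<i> * of_real (pi * tanh (pi * t))"
    using Digamma_reflection_half[of t] unfolding Digamma_def by simp
  moreover have "?f ?z n - ?f ?w n = \<i> * of_real (2 * t / ((real n + 1/2)\<^sup>2 + t\<^sup>2))" for n
  proof -
    define a where "a = real n + 1/2"
    have a: "a > 0" by (simp add: a_def)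
    have e: "?z + of_nat n = of_real a + \<i> * of_real t" "?w + of_nat n = of_real a - \<i> * of_real t"
      by (simp_all add: a_def)
    have nz: "of_real a + \<i> * of_real t \<noteq> 0" "of_real a - \<i> * of_real t \<noteq> 0"
      using a by (auto simp: complex_eq_iff)
    have p: "(of_real a + \<i> * of_real t) * (of_real a - \<i> * of_real t) = complex_of_real (a\<^sup>2 + t\<^sup>2)"
      by (simp add: complex_eq_iff power2_eq_square)
    have "?f ?z n - ?f ?w n = inverse (of_real a - \<i> * of_real t) - inverse (of_real a + \<i> * of_real t)"
      unfolding e by simp
    also have "\<dots> = (2 * \<i> * of_real t) / ((of_real a + \<i> * of_real t) * (of_real a - \<i> * of_real t))"
      using nz by (simp add: field_simps)
    also have "\<dots> = \<i> * of_real (2 * t / (a\<^sup>2 + t\<^sup>2))"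
      unfolding p by simp
    finally show ?thesis by (simp add: a_def)
  qed
  ultimately have "(\<lambda>n. \<i> * of_real (2 * t / ((real n + 1/2)\<^sup>2 + t\<^sup>2))) sums (\<i> * complex_of_real (pi * tanh (pi * t)))"
    by simp
  then have "(\<lambda>n. - \<i> * (\<i> * of_real (2 * t / ((real n + 1/2)\<^sup>2 + t\<^sup>2)))) sums (- \<i> * (\<i> * complex_of_real (pi * tanh (pi * t))))"
    by (rule sums_mult)
  then have "(\<lambda>n. complex_of_real (2 * t / ((real n + 1/2)\<^sup>2 + t\<^sup>2))) sums complex_of_real (pi * tanh (pi * t))"
    by (simp flip: mult.assoc)
  then show ?thesis by (simp only: sums_of_real_iff)
qed

text \<open>The integrals with the factor r serve as majorants for those with sin(t r), through
  |sin(t r)| \<le> |t| r.\<close>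

lemma exp_mscale_integrals:
  fixes a t :: real
  assumes a: "a > 0"
  shows "set_integrable lborel {0<..} (\<lambda>r. r * exp (- (a * r)))" "(LBINT r:{0<..}. r * exp (- (a * r))) = 1 / a\<^sup>2"
    and "set_integrable lborel {0<..} (\<lambda>r. sin (t * r) * exp (- (a * r)))"
    and "(LBINT r:{0<..}. sin (t * r) * exp (- (a * r))) = t / (a\<^sup>2 + t\<^sup>2)"
proof -
  let ?F = "\<lambda>r. - (r / a + 1 / a\<^sup>2) * exp (- (a * r))"
  have at0: "((f \<circ> real_of_ereal) \<longlongrightarrow> f 0) (at_right 0)" if "isCont f 0" for f :: "real \<Rightarrow> real"
    using that unfolding zero_ereal_def ereal_tendsto_simps isCont_def filterlim_at_split by simp
  have F0: "((?F \<circ> real_of_ereal) \<longlongrightarrow> - (1 / a\<^sup>2)) (at_right 0)"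
    using at0[of ?F] a by (simp add: continuous_intros)
  have F1: "((?F \<circ> real_of_ereal) \<longlongrightarrow> 0) (at_left \<infinity>)"
    unfolding ereal_tendsto_simps using a by real_asymp
  have dF: "(?F has_real_derivative r * exp (- (a * r))) (at r)" for r
    using a by (auto intro!: derivative_eq_intros simp: field_simps power2_eq_square)
  note FTC = interval_integral_FTC_nonneg[of 0 \<infinity> ?F "\<lambda>r. r * exp (- (a * r))", OF _ dF _ _ F0 F1]
  have 1: "set_integrable lborel (einterval 0 \<infinity>) (\<lambda>r. r * exp (- (a * r)))"
    by (rule FTC(1)) (auto intro!: continuous_intros AE_I2)
  have 2: "(LBINT r=0..\<infinity>. r * exp (- (a * r))) = 0 - - (1 / a\<^sup>2)"
    by (rule FTC(2)) (auto intro!: continuous_intros AE_I2)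
  have ei: "einterval 0 \<infinity> = {0<..}" by (auto simp: einterval_def)
  show i1: "set_integrable lborel {0<..} (\<lambda>r. r * exp (- (a * r)))" using 1 by (simp add: ei)
  show "(LBINT r:{0<..}. r * exp (- (a * r))) = 1 / a\<^sup>2"
    using 2 by (simp add: interval_lebesgue_integral_def ei)
  show i2: "set_integrable lborel {0<..} (\<lambda>r. sin (t * r) * exp (- (a * r)))"
  proof (rule set_integrable_bound)
    show "set_integrable lborel {0<..} (\<lambda>r. \<bar>t\<bar> * (r * exp (- (a * r))))"
      using i1 by (rule set_integrable_mult_right[rotated])
    have "\<bar>sin (t * r)\<bar> \<le> \<bar>t\<bar> * r" if "r > 0" for r
      using abs_sin_x_le_abs_x[of "t * r"] that by (simp add: abs_mult)
    then show "AE r in lborel. r \<in> {0<..} \<longrightarrow> norm (sin (t * r) * exp (- (a * r))) \<le> norm (\<bar>t\<bar> * (r * exp (- (a * r))))"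
      by (auto simp: abs_mult intro!: AE_I2)
  qed (auto simp: set_borel_measurable_def)
  let ?G = "\<lambda>r. - exp (- (a * r)) * (a * sin (t * r) + t * cos (t * r)) / (a\<^sup>2 + t\<^sup>2)"
  have p: "a\<^sup>2 + t\<^sup>2 > 0" using a by (simp add: add_pos_nonneg)
  have "(LBINT r=0..\<infinity>. sin (t * r) * exp (- (a * r))) = 0 - - (t / (a\<^sup>2 + t\<^sup>2))"
  proof (rule interval_integral_FTC_integrable)
    fix r
    have "((\<lambda>r. - exp (- (a * r)) * (a * sin (t * r) + t * cos (t * r))) has_real_derivative
       sin (t * r) * exp (- (a * r)) * (a\<^sup>2 + t\<^sup>2)) (at r)"
      by (auto intro!: derivative_eq_intros simp: algebra_simps power2_eq_square)
    from DERIV_cdivide[OF this, of "a\<^sup>2 + t\<^sup>2"]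
    have "(?G has_real_derivative sin (t * r) * exp (- (a * r)) * (a\<^sup>2 + t\<^sup>2) / (a\<^sup>2 + t\<^sup>2)) (at r)" .
    then show "(?G has_vector_derivative sin (t * r) * exp (- (a * r))) (at r)"
      using p a by (simp add: has_real_derivative_iff_has_vector_derivative)
    show "((?G \<circ> real_of_ereal) \<longlongrightarrow> - (t / (a\<^sup>2 + t\<^sup>2))) (at_right 0)"
    proof -
      have "isCont ?G 0" by (intro continuous_intros) (use p in auto)
      from at0[OF this] show ?thesis by simp
    qed
    have lim0: "((\<lambda>r. exp (- (a * r)) * ((\<bar>a\<bar> + \<bar>t\<bar>) / (a\<^sup>2 + t\<^sup>2))) \<longlongrightarrow> 0) at_top"
      by (rule tendsto_mult_left_zero) (use a in real_asymp)
    have "\<bar>a * sin (t * r) + t * cos (t * r)\<bar> \<le> \<bar>a\<bar> + \<bar>t\<bar>" for r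
      by (rule order_trans[OF abs_triangle_ineq]) (auto simp: abs_mult intro!: add_mono mult_left_le)
    then have "\<forall>\<^sub>F r in at_top. norm (?G r) \<le> exp (- (a * r)) * ((\<bar>a\<bar> + \<bar>t\<bar>) / (a\<^sup>2 + t\<^sup>2))"
      using p by (auto simp: abs_mult divide_right_mono)
    from Lim_null_comparison[OF this lim0] have "(?G \<longlongrightarrow> 0) at_top" .
    then show "((?G \<circ> real_of_ereal) \<longlongrightarrow> 0) (at_left \<infinity>)"
      by (simp add: ereal_tendsto_simps)
  qed (use i2 in \<open>auto simp: ei intro!: continuous_intros\<close>)
  then show "(LBINT r:{0<..}. sin (t * r) * exp (- (a * r))) = t / (a\<^sup>2 + t\<^sup>2)"
    by (simp add: interval_lebesgue_integral_def ei)
qed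

text \<open>Expand 1/sinh(r/2) as twice the sum of exp(-(n + 1/2) r) and integrate termwise. The
  terms become 2 t / ((n + 1/2)^2 + t^2), the partial fractions of pi tanh(pi t).\<close>

lemma sin_over_sinh_integral:
  fixes t :: real
  shows "set_integrable lborel {0<..} (\<lambda>r. sin (t * r) / sinh (r / 2))"
    and "(LBINT r:{0<..}. sin (t * r) / sinh (r / 2)) = pi * tanh (pi * t)"
proof -
  let ?a = "\<lambda>n. real n + 1/2"
  let ?f = "\<lambda>n r. indicator {0<..} r *\<^sub>R (2 * (sin (t * r) * exp (- (?a n * r))))"
  have a: "?a n > 0" for n by simp
  have int: "integrable lborel (?f n)" for n
    using set_integrable_mult_right[of "2::real", OF exp_mscale_integrals(3)[OF a[of n], of t]] unfolding set_integrable_def by simp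
  have sums: "(\<lambda>n. ?f n r) sums (indicator {0<..} r *\<^sub>R (sin (t * r) / sinh (r / 2)))" for r
  proof (cases "r > 0")
    case True
    have q: "exp (- r) < 1" using True by simp
    have 1: "(\<lambda>n. 2 * sin (t * r) * exp (- r / 2) * exp (- r) ^ n) sums (2 * sin (t * r) * exp (- r / 2) * (1 / (1 - exp (- r))))"
      using q by (intro sums_mult geometric_sums) simp
    have 2: "2 * sin (t * r) * exp (- r / 2) * exp (- r) ^ n = 2 * (sin (t * r) * exp (- (?a n * r)))" for n
    proof -
      have "exp (- r / 2) * exp (- r) ^ n = exp (- r / 2 + real n * (- r))"
        by (simp only: exp_of_nat_mult exp_add)
      also have "- r / 2 + real n * (- r) = - (?a n * r)" by (simp add: algebra_simps)
      finally show ?thesis by (simp add: mult.assoc)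
    qed
    have 3: "2 * sin (t * r) * exp (- r / 2) * (1 / (1 - exp (- r))) = sin (t * r) / sinh (r / 2)"
    proof -
      have e: "sinh (r / 2) = (1 - exp (- r)) / (2 * exp (- r / 2))"
      proof -
        have "exp (- r) = exp (- r / 2) * exp (- r / 2)" "exp (r / 2) * exp (- r / 2) = 1"
          by (simp_all flip: exp_add)
        then show ?thesis by (simp add: sinh_def field_simps)
      qed
      show ?thesis unfolding e using q by (simp add: field_simps)
    qed
    show ?thesis using 1 True unfolding 2 3 by simp
  qed simp
  have S: "suminf (\<lambda>n. ?f n r) = indicator {0<..} r *\<^sub>R (sin (t * r) / sinh (r / 2))" for r
    using sums[of r] by (rule sums_unique[symmetric])
  have AEsum: "AE r in lborel. summable (\<lambda>n. norm (?f n r))"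
  proof (rule AE_I2)
    fix r
    show "summable (\<lambda>n. norm (?f n r))"
    proof (cases "r > 0")
      case True
      have "norm (?f n r) = 2 * \<bar>sin (t * r)\<bar> * exp (- r / 2) * exp (- r) ^ n" for n
      proof -
        have "exp (- r / 2) * exp (- r) ^ n = exp (- r / 2 + real n * (- r))"
          by (simp only: exp_of_nat_mult exp_add)
        also have "- r / 2 + real n * (- r) = - (?a n * r)" by (simp add: algebra_simps)
        finally show ?thesis using True by (simp add: abs_mult mult.assoc)
      qed
      then show ?thesis using True by (simp only:) (intro summable_mult summable_geometric, simp)
    qed simp
  qed
  \<comment> \<open>Bounding the sine by 1 would give terms of size 1/(n + 1/2), which are not
    summable; the bound |t| r improves them to 1/(n + 1/2)^2.\<close>
  have bnd: "(LBINT r. norm (?f n r)) \<le> 2 * \<bar>t\<bar> * (1 / (?a n)\<^sup>2)" for n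
  proof -
    have "(LBINT r. norm (?f n r)) \<le> (LBINT r. indicator {0<..} r *\<^sub>R (2 * \<bar>t\<bar> * (r * exp (- (?a n * r)))))"
    proof (rule integral_mono)
      show "integrable lborel (\<lambda>r. norm (?f n r))" using int[of n] by (rule integrable_norm)
      show "integrable lborel (\<lambda>r. indicator {0<..} r *\<^sub>R (2 * \<bar>t\<bar> * (r * exp (- (?a n * r)))))"
        using set_integrable_mult_right[of "2 * \<bar>t\<bar>", OF exp_mscale_integrals(1)[OF a[of n]]] unfolding set_integrable_def by simp
      fix r
      have "\<bar>sin (t * r)\<bar> \<le> \<bar>t\<bar> * r" if "r > 0"
        using abs_sin_x_le_abs_x[of "t * r"] that by (simp add: abs_mult)
      then show "norm (?f n r) \<le> indicator {0<..} r *\<^sub>R (2 * \<bar>t\<bar> * (r * exp (- (?a n * r))))"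
        by (auto simp: indicator_def abs_mult mult_ac)
    qed
    also have "\<dots> = 2 * \<bar>t\<bar> * (1 / (?a n)\<^sup>2)"
      using exp_mscale_integrals(2)[OF a[of n]] set_integral_mult_right[of lborel "{0<..}" "2 * \<bar>t\<bar>" "\<lambda>r. r * exp (- (?a n * r))"]
      unfolding set_lebesgue_integral_def by simp
    finally show ?thesis .
  qed
  have "summable (\<lambda>n. 1 / (?a n)\<^sup>2)"
  proof (rule summable_comparison_test')
    show "summable (\<lambda>n. 4 * inverse (real (Suc n) ^ 2))"
      using inverse_power_summable[of 2, where 'a=real] by (intro summable_mult) (subst summable_Suc_iff, simp)
    fix n :: nat assume "n \<ge> 0"
    have "(real (Suc n))\<^sup>2 \<le> (2 * ?a n)\<^sup>2" by (intro power_mono) auto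
    then have "(real (Suc n))\<^sup>2 \<le> 4 * (?a n)\<^sup>2" by (simp only: power_mult_distrib) simp
    then show "norm (1 / (?a n)\<^sup>2) \<le> 4 * inverse (real (Suc n) ^ 2)"
      using a[of n] by (simp add: divide_simps del: of_nat_Suc)
  qed
  then have sg: "summable (\<lambda>n. 2 * \<bar>t\<bar> * (1 / (?a n)\<^sup>2))" by (rule summable_mult)
  have "norm (LBINT r. norm (?f n r)) \<le> 2 * \<bar>t\<bar> * (1 / (?a n)\<^sup>2)" for n
  proof -
    have "0 \<le> (LBINT r. norm (?f n r))" by (rule Bochner_Integration.integral_nonneg) (rule norm_ge_zero)
    then show ?thesis
      using bnd[of n] by (simp only: real_norm_def abs_of_nonneg)
  qed
  then have "summable (\<lambda>n. LBINT r. norm (?f n r))"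
    by (rule summable_comparison_test'[OF sg])
  note main = integrable_suminf[OF int AEsum this] sums_integral[OF int AEsum this]
  show "set_integrable lborel {0<..} (\<lambda>r. sin (t * r) / sinh (r / 2))"
    using main(1) unfolding S set_integrable_def .
  have "(\<lambda>n. LBINT r. ?f n r) sums (LBINT r:{0<..}. sin (t * r) / sinh (r / 2))"
    using main(2) unfolding S set_lebesgue_integral_def .
  moreover have "(LBINT r. ?f n r) = 2 * t / ((?a n)\<^sup>2 + t\<^sup>2)" for n
    using exp_mscale_integrals(4)[OF a[of n], of t] set_integral_mult_right[of lborel "{0<..}" "2" "\<lambda>r. sin (t * r) * exp (- (?a n * r))"]
    unfolding set_lebesgue_integral_def by simp
  ultimately have "(\<lambda>n. 2 * t / ((?a n)\<^sup>2 + t\<^sup>2)) sums (LBINT r:{0<..}. sin (t * r) / sinh (r / 2))"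
    by (simp only:)
  then show "(LBINT r:{0<..}. sin (t * r) / sinh (r / 2)) = pi * tanh (pi * t)"
    using tanh_partial_fractions[of t] by (rule sums_unique2)
qed

subsection \<open>Raising the parameter\<close>

definition weight :: "real \<Rightarrow> real \<Rightarrow> real" where
  "weight c v = (v\<^sup>2 + v) powr (c - 1)"

definition jacobi_transform :: "real \<Rightarrow> (real \<Rightarrow> complex) \<Rightarrow> real \<Rightarrow> complex" where
  "jacobi_transform c f t = (LBINT v:{0<..}. f v * phi c t v * of_real (weight c v))"

definition admissible :: "(real \<Rightarrow> complex) \<Rightarrow> bool" where
  "admissible f \<longleftrightarrow> continuous_on {0..} f \<and> (\<exists>B>0. \<forall>v>B. f v = 0)"

lemma sq_plus_pos: "v > 0 \<Longrightarrow> v\<^sup>2 + v > (0::real)"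
  by (simp add: add_nonneg_pos)

lemma powr_tendsto_0: "c > 0 \<Longrightarrow> ((\<lambda>v. (v\<^sup>2 + v) powr c) \<longlongrightarrow> 0) (at_right (0::real))"
proof -
  assume c: "c > 0"
  have "((\<lambda>v::real. v\<^sup>2 + v) \<longlongrightarrow> 0\<^sup>2 + 0) (at_right 0)" by (intro tendsto_intros)
  then have "((\<lambda>v::real. (v\<^sup>2 + v) powr c) \<longlongrightarrow> 0 powr c) (at_right 0)"
  proof (intro tendsto_powr')
    show "0 \<noteq> (0::real) \<or> 0 < c \<and> (\<forall>\<^sub>F v in at_right (0::real). 0 \<le> v\<^sup>2 + v)"
    proof -
      have "\<forall>\<^sub>F v in at_right 0. 0 \<le> v\<^sup>2 + (v::real)"
        using eventually_at_right_less[of "0::real"]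
        by eventually_elim (rule less_imp_le[OF sq_plus_pos])
      then show ?thesis using c by (intro disjI2 conjI)
    qed
  qed auto
  then show ?thesis by simp
qed

text \<open>For c < 1 the weight is singular at 0. It is at most 1/c times the derivative of w^c,
  and w^c tends to 0 there.\<close>

lemma weight_integrable:
  assumes c: "c > 0" and B: "B > 0"
  shows "set_integrable lborel {0<..<B} (weight c)"
proof -
  let ?F = "\<lambda>v. (v\<^sup>2 + v) powr c" and ?f = "\<lambda>v. c * (v\<^sup>2 + v) powr (c - 1) * (2 * v + 1)"
  have ei: "einterval 0 (ereal B) = {0<..<B}" by (auto simp: einterval_def)
  have "set_integrable lborel (einterval 0 (ereal B)) ?f"
  proof (rule interval_integral_FTC_nonneg(1))
    show "0 < ereal B" using B by simp
    fix v :: real assume v: "0 < ereal v"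
    then have v0: "v > 0" by simp
    show "(?F has_real_derivative ?f v) (at v)"
      using sq_plus_pos[OF v0] by (auto intro!: derivative_eq_intros)
    show "isCont ?f v"
      using sq_plus_pos[OF v0] by (intro continuous_intros) auto
  next
    show "AE v in lborel. 0 < ereal v \<longrightarrow> ereal v < ereal B \<longrightarrow> 0 \<le> ?f v"
      using c by (intro AE_I2 impI mult_nonneg_nonneg) auto
    show "((?F \<circ> real_of_ereal) \<longlongrightarrow> 0) (at_right 0)"
      using powr_tendsto_0[OF c] unfolding zero_ereal_def ereal_tendsto_simps .
    have "isCont ?F B"
      using sq_plus_pos[OF B] by (intro continuous_intros) auto
    then show "((?F \<circ> real_of_ereal) \<longlongrightarrow> ?F B) (at_left (ereal B))"
      unfolding ereal_tendsto_simps isCont_def filterlim_at_split by simp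
  qed
  then have int: "set_integrable lborel {0<..<B} (\<lambda>v. 1 / c * ?f v)"
    unfolding ei by (rule set_integrable_mult_right[rotated])
  show ?thesis
  proof (rule set_integrable_bound[OF int])
    show "set_borel_measurable lborel {0<..<B} (weight c)"
      unfolding weight_def set_borel_measurable_def by measurable
    have "(v\<^sup>2 + v) powr (c - 1) * 1 \<le> (v\<^sup>2 + v) powr (c - 1) * (2 * v + 1)" if "v > 0" for v
      using that by (intro mult_left_mono) auto
    then show "AE v in lborel. v \<in> {0<..<B} \<longrightarrow> norm (weight c v) \<le> norm (1 / c * ?f v)"
      using c by (auto intro!: AE_I2 simp: weight_def abs_mult)
  qed
qed

lemma admissible_bounded: "admissible f \<Longrightarrow> \<exists>M\<ge>0. \<forall>v\<ge>0. norm (f v) \<le> M"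
proof -
  assume f: "admissible f"
  then obtain B where B: "B > 0" "\<And>v. v > B \<Longrightarrow> f v = 0" by (auto simp: admissible_def)
  have "compact (f ` {0..B})"
    using f by (intro compact_continuous_image) (auto simp: admissible_def intro: continuous_on_subset)
  then obtain M where "\<And>v. v \<in> {0..B} \<Longrightarrow> norm (f v) \<le> M"
    using compact_imp_bounded bounded_iff by (metis imageI)
  then have "norm (f v) \<le> max M 0" if "v \<ge> 0" for v
    using that B(2)[of v] by (cases "v > B") (auto simp: le_max_iff_disj)
  then show ?thesis by (intro exI[of _ "max M 0"]) auto
qed

lemma admissible_integrand_continuous:
  assumes f: "admissible f" and c: "half_integer c"
  shows "continuous_on {0<..} (\<lambda>v. f v * phi c t v * of_real (weight c v))"
proof -
  have "continuous_on {0<..} (weight c)"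
    unfolding weight_def using sq_plus_pos by (intro continuous_intros) (metis greaterThan_iff less_irrefl)
  then show ?thesis
    using f c by (intro continuous_intros phi_continuous_on) (auto simp: admissible_def intro: continuous_on_subset)
qed

lemma jacobi_transform_integrable:
  assumes f: "admissible f" and c: "half_integer c"
  shows "set_integrable lborel {0<..} (\<lambda>v. f v * phi c t v * of_real (weight c v))"
proof -
  obtain B where B: "B > 0" "\<And>v. v > B \<Longrightarrow> f v = 0" using f by (auto simp: admissible_def)
  obtain M where M: "M \<ge> 0" "\<And>v. v \<ge> 0 \<Longrightarrow> norm (f v) \<le> M" using admissible_bounded[OF f] by blast
  have "integrable lborel (\<lambda>v. M * (indicator {0<..<B+1} v *\<^sub>R weight c v))"
    using weight_integrable[of c "B+1"] half_integer_pos[OF c] B(1) unfolding set_integrable_def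
    by (intro integrable_mult_right) auto
  then show ?thesis unfolding set_integrable_def
  proof (rule Bochner_Integration.integrable_bound)
    show "(\<lambda>v. indicator {0<..} v *\<^sub>R (f v * phi c t v * of_real (weight c v))) \<in> borel_measurable lborel"
      using borel_measurable_continuous_on_indicator[OF _ admissible_integrand_continuous[OF f c]] by simp
    have "norm (f v * phi c t v * of_real (weight c v)) \<le> M * 1 * weight c v" if "v > 0" for v
      unfolding norm_mult using that M phi_bound[OF c, of v t]
      by (intro mult_mono) (auto simp: weight_def)
    then show "AE v in lborel. norm (indicator {0<..} v *\<^sub>R (f v * phi c t v * of_real (weight c v))) \<le> norm (M * (indicator {0<..<B+1} v *\<^sub>R weight c v))"
      using B M by (auto simp: indicator_def weight_def abs_mult intro!: AE_I2)
  qed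
qed

text \<open>Integration by parts. At 0 the boundary term vanishes because w^c tends to 0 while
  \<open>F\<close> and \<open>phi\<close> stay bounded, at infinity because \<open>F\<close> is
  eventually 0.\<close>

lemma jacobi_transform_shift:
  assumes f: "admissible f" and F: "admissible F" and c: "half_integer c"
    and der: "\<And>v. v > 0 \<Longrightarrow> (F has_vector_derivative f v) (at v)"
  shows "jacobi_transform (c + 1) f t = - of_real c * jacobi_transform c F t"
proof -
  let ?P = "\<lambda>v. F v * (of_real ((v\<^sup>2 + v) powr c) * phi (c + 1) t v)"
  let ?p = "\<lambda>v. of_real c * (F v * phi c t v * of_real (weight c v)) + f v * phi (c + 1) t v * of_real (weight (c + 1) v)"
  have ei: "einterval 0 \<infinity> = {0<..}" by (auto simp: einterval_def)
  have c0: "c > 0" using half_integer_pos[OF c] by simp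
  note c1 = half_integer_Suc[OF c]
  note i1 = jacobi_transform_integrable[OF F c, of t] and i2 = jacobi_transform_integrable[OF f c1, of t]
  have int: "set_integrable lborel {0<..} ?p"
    by (intro set_integral_add(1) set_integrable_mult_right i1 i2)
  have "(LBINT v=0..\<infinity>. ?p v) = 0 - 0"
  proof (rule interval_integral_FTC_integrable)
    fix v assume "0 < ereal v"
    then have v: "v > 0" by simp
    have "(?P has_vector_derivative F v * (of_real (c * (v\<^sup>2 + v) powr (c - 1)) * phi c t v) + f v * (of_real ((v\<^sup>2 + v) powr c) * phi (c + 1) t v)) (at v)"
      by (intro has_vector_derivative_mult der phi_weighted_vderiv c v)
    then show "(?P has_vector_derivative ?p v) (at v)"
      by (simp add: weight_def mult_ac)
    have "continuous_on {0<..} ?p"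
      by (intro continuous_on_add continuous_on_mult continuous_on_const admissible_integrand_continuous f F c c1)
    then show "isCont ?p v"
      using v by (simp add: continuous_on_eq_continuous_at)
  next
    show "set_integrable lborel (einterval 0 \<infinity>) ?p" using int by (simp add: ei)
    obtain M where M: "M \<ge> 0" "\<And>v. v \<ge> 0 \<Longrightarrow> norm (F v) \<le> M" using admissible_bounded[OF F] by blast
    have lim0: "((\<lambda>v. M * (v\<^sup>2 + v) powr c) \<longlongrightarrow> 0) (at_right 0)"
      by (intro tendsto_mult_right_zero powr_tendsto_0 c0)
    have "norm (?P v) \<le> M * ((v\<^sup>2 + v) powr c * 1)" if "v > 0" for v
      unfolding norm_mult using that M phi_bound[OF c1, of v t] by (intro mult_mono) auto
    then have "\<forall>\<^sub>F v in at_right 0. norm (?P v) \<le> M * (v\<^sup>2 + v) powr c"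
      using eventually_at_right_less[of "0::real"] by (auto elim!: eventually_mono)
    from Lim_null_comparison[OF this lim0] have "(?P \<longlongrightarrow> 0) (at_right 0)" .
    then show "((?P \<circ> real_of_ereal) \<longlongrightarrow> 0) (at_right 0)"
      unfolding zero_ereal_def ereal_tendsto_simps .
    obtain B where B: "B > 0" "\<And>v. v > B \<Longrightarrow> F v = 0" using F by (auto simp: admissible_def)
    have "eventually (\<lambda>v. ?P v = 0) at_top"
      using eventually_gt_at_top[of B] by eventually_elim (simp add: B)
    then have "(?P \<longlongrightarrow> 0) at_top" by (rule tendsto_eventually)
    then show "((?P \<circ> real_of_ereal) \<longlongrightarrow> 0) (at_left \<infinity>)"
      unfolding ereal_tendsto_simps .
  qed simp
  then have "(LBINT v:{0<..}. ?p v) = 0"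
    by (simp add: interval_lebesgue_integral_def ei)
  moreover have "(LBINT v:{0<..}. ?p v) = of_real c * jacobi_transform c F t + jacobi_transform (c + 1) f t"
    unfolding jacobi_transform_def using i1 i2 by (subst set_integral_add(2)) (auto intro: set_integrable_mult_right)
  ultimately show ?thesis by (simp add: add_eq_0_iff)
qed

text \<open>Rapid decay of the transform is kept as part of the notion because each raising step multiplies \<open>q\<close> by a quadratic factor.\<close>

definition inversion_family :: "real \<Rightarrow> (real \<Rightarrow> real) \<Rightarrow> (real \<Rightarrow> complex) set \<Rightarrow> bool" where
  "inversion_family c q \<F> \<longleftrightarrow>
     (\<exists>K N. \<forall>t. \<bar>q t\<bar> \<le> K * (1 + t\<^sup>2) ^ N) \<and> q \<in> borel_measurable borel \<and>
     (\<forall>f\<in>\<F>. jacobi_transform c f \<in> borel_measurable borel \<and> (\<forall>N. \<exists>C. \<forall>t. norm (jacobi_transform c f t) * (1 + t\<^sup>2) ^ N \<le> C) \<and>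
        (\<forall>u\<ge>0. f u = 1 / (Gamma (of_real c))\<^sup>2 * (LBINT t. jacobi_transform c f t * (phi c t u * of_real (q t)))))"

lemma inversion_family_integrable:
  assumes inv: "inversion_family c q \<F>" and c: "half_integer c" and f: "f \<in> \<F>" and u: "u \<ge> 0"
  shows "integrable lborel (\<lambda>t. jacobi_transform c f t * (phi c t u * of_real (q t)))"
proof -
  obtain K N where K: "\<And>t. \<bar>q t\<bar> \<le> K * (1 + t\<^sup>2) ^ N" using inv by (auto simp: inversion_family_def)
  have [measurable]: "(\<lambda>t. phi c t u) \<in> borel_measurable borel" "q \<in> borel_measurable borel"
    using phi_measurable[OF c u] inv by (auto simp: inversion_family_def)
  show ?thesis
  proof (rule rapid_integrable(2)[where K = K and N = N])
    show "norm (phi c t u * of_real (q t)) \<le> K * (1 + t\<^sup>2) ^ N" for t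
    proof -
      have "norm (phi c t u) * \<bar>q t\<bar> \<le> 1 * \<bar>q t\<bar>"
        using phi_bound[OF c u, of t] by (intro mult_right_mono) auto
      with K[of t] show ?thesis by (simp add: norm_mult)
    qed
  qed (use inv f in \<open>auto simp: inversion_family_def\<close>)
qed

text \<open>Differentiating the formula for the primitive \<open>F\<close> brings out -((c - 1/2)^2
  + t^2)/c, and expressing the transform of \<open>F\<close> by that of \<open>f\<close> brings out
  -1/c. The signs cancel, and 1/c^2 is absorbed by Gamma(c + 1) = c Gamma(c). Derivatives are taken
  within \<open>{0..}\<close> so that u = 0 is reached.\<close>

lemma inversion_family_step:
  assumes inv: "inversion_family c q \<F>" and c: "half_integer c"
    and admissible: "\<And>f. f \<in> \<F> \<Longrightarrow> admissible f"
    and prim: "\<And>f. f \<in> \<F> \<Longrightarrow> \<exists>F\<in>\<F>. \<forall>u\<ge>0. (F has_vector_derivative f u) (at u within {0..})"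
  shows "inversion_family (c + 1) (\<lambda>t. q t * ((c - 1/2)\<^sup>2 + t\<^sup>2)) \<F>"
  unfolding inversion_family_def
proof (intro conjI ballI)
  let ?Q = "\<lambda>t. (c - 1/2)\<^sup>2 + t\<^sup>2"
  obtain K N where K: "\<And>t. \<bar>q t\<bar> \<le> K * (1 + t\<^sup>2) ^ N" using inv by (auto simp: inversion_family_def)
  have qm [measurable]: "q \<in> borel_measurable borel" using inv by (auto simp: inversion_family_def)
  have c0: "c > 0" using half_integer_pos[OF c] by simp
  have Qb: "\<bar>q t * ?Q t\<bar> \<le> (K * ((c - 1/2)\<^sup>2 + 1)) * (1 + t\<^sup>2) ^ (N + 1)" for t
  proof -
    have "?Q t \<le> ((c - 1/2)\<^sup>2 + 1) * (1 + t\<^sup>2)" by (simp add: algebra_simps)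
    then have "\<bar>q t\<bar> * ?Q t \<le> (K * (1 + t\<^sup>2) ^ N) * (((c - 1/2)\<^sup>2 + 1) * (1 + t\<^sup>2))"
      by (intro mult_mono K order_trans[OF abs_ge_zero K]) auto
    then show ?thesis by (simp add: abs_mult mult_ac)
  qed
  then show "\<exists>K N. \<forall>t. \<bar>q t * ?Q t\<bar> \<le> K * (1 + t\<^sup>2) ^ N" by blast
  show "(\<lambda>t. q t * ?Q t) \<in> borel_measurable borel" by measurable
  fix f assume f: "f \<in> \<F>"
  obtain F where F: "F \<in> \<F>" "\<And>u. u \<ge> 0 \<Longrightarrow> (F has_vector_derivative f u) (at u within {0..})"
    using prim[OF f] by blast
  have "(F has_vector_derivative f u) (at u)" if "u > 0" for u
  proof -
    have "(F has_vector_derivative f u) (at u within {0<..})"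
      using F(2)[of u] that by (auto intro: has_vector_derivative_within_subset)
    then show ?thesis using that by (simp add: at_within_open[OF _ open_greaterThan])
  qed
  then have shift: "jacobi_transform (c + 1) f t = - of_real c * jacobi_transform c F t" for t
    by (rule jacobi_transform_shift[OF admissible[OF f] admissible[OF F(1)] c])
  have Fm [measurable]: "jacobi_transform c F \<in> borel_measurable borel" and Fr: "\<And>N. \<exists>C. \<forall>t. norm (jacobi_transform c F t) * (1 + t\<^sup>2) ^ N \<le> C"
    and Finv: "\<And>u. u \<ge> 0 \<Longrightarrow> F u = 1 / (Gamma (of_real c))\<^sup>2 * (LBINT t. jacobi_transform c F t * (phi c t u * of_real (q t)))"
    using inv F(1) by (auto simp: inversion_family_def)
  show "jacobi_transform (c + 1) f \<in> borel_measurable borel"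
    unfolding shift[abs_def] by measurable
  show "\<forall>N. \<exists>C. \<forall>t. norm (jacobi_transform (c + 1) f t) * (1 + t\<^sup>2) ^ N \<le> C"
  proof
    fix N
    obtain C where "\<And>t. norm (jacobi_transform c F t) * (1 + t\<^sup>2) ^ N \<le> C" using Fr by blast
    then have "norm (jacobi_transform (c + 1) f t) * (1 + t\<^sup>2) ^ N \<le> c * C" for t
      unfolding shift using c0 by (simp add: norm_mult mult.assoc)
    then show "\<exists>C. \<forall>t. norm (jacobi_transform (c + 1) f t) * (1 + t\<^sup>2) ^ N \<le> C" by blast
  qed
  show "\<forall>u\<ge>0. f u = 1 / (Gamma (of_real (c + 1)))\<^sup>2 * (LBINT t. jacobi_transform (c + 1) f t * (phi (c + 1) t u * of_real (q t * ?Q t)))"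
  proof (intro allI impI)
    fix u :: real assume u: "u \<ge> 0"
    let ?d = "\<lambda>u t. jacobi_transform c F t * ((- of_real (?Q t / c) * phi (c + 1) t u) * of_real (q t))"
    have [measurable]: "(\<lambda>t. phi (c + 1) t u) \<in> borel_measurable borel"
      using phi_measurable[OF half_integer_Suc[OF c] u] .
    obtain C where C: "\<And>t. norm (jacobi_transform c F t) * ((K * ((c - 1/2)\<^sup>2 + 1)) * (1 + t\<^sup>2) ^ (N + 1)) \<le> C / (1 + t\<^sup>2)"
    proof -
      have "(\<lambda>t. complex_of_real (q t * ?Q t)) \<in> borel_measurable borel" by measurable
      from rapid_integrable(1)[OF Fm Fr this, of "K * ((c - 1/2)\<^sup>2 + 1)" "N + 1"] Qb that show ?thesis
        by (simp only: norm_of_real) blast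
    qed
    have bd: "norm (?d v t) \<le> (C / c) / (1 + t\<^sup>2)" if v: "v \<in> {0..}" for v t
    proof -
      have "norm (?d v t) = (norm (jacobi_transform c F t) * \<bar>q t * ?Q t\<bar>) / c * norm (phi (c + 1) t v)"
      proof -
        have nrm: "norm (J * ((- complex_of_real (Q / c) * P) * of_real x)) = (norm J * \<bar>x * Q\<bar>) / c * norm P"
          if "Q \<ge> 0" for J P Q x
          unfolding norm_mult norm_minus_cancel norm_of_real using that c0 by (simp add: abs_mult)
        show ?thesis by (rule nrm) simp
      qed
      also have "\<dots> \<le> (norm (jacobi_transform c F t) * ((K * ((c - 1/2)\<^sup>2 + 1)) * (1 + t\<^sup>2) ^ (N + 1))) / c * 1"
        using c0 v phi_bound[OF half_integer_Suc[OF c], of v t] Qb[of t]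
        by (intro mult_mono divide_right_mono mult_left_mono divide_nonneg_nonneg mult_nonneg_nonneg order_trans[OF abs_ge_zero Qb]) auto
      also have "\<dots> \<le> (C / (1 + t\<^sup>2)) / c"
        unfolding mult_1_right using c0 by (intro divide_right_mono C) simp
      finally show ?thesis by (simp add: mult.commute)
    qed
    have "((\<lambda>u. LBINT t. jacobi_transform c F t * (phi c t u * of_real (q t))) has_vector_derivative (LBINT t. ?d u t)) (at u within {0..})"
    proof (rule leibniz_dominated(1)[OF _ _ _ _ _ bd])
      show "u \<in> {0..}" using u by simp
      show "integrable lborel (\<lambda>t. (C / c) / (1 + t\<^sup>2))" by (rule integrable_inverse_1_plus_sq)
      show "integrable lborel (\<lambda>t. jacobi_transform c F t * (phi c t v * of_real (q t)))" if "v \<in> {0..}" for v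
        using inversion_family_integrable[OF inv c F(1)] that by simp
      fix v t assume v: "v \<in> {0::real..}"
      have "(phi c t has_vector_derivative - of_real (?Q t / c) * phi (c + 1) t v) (at v within {0..})"
        using phi_vderiv(1)[OF c, of v t] v has_vector_derivative_at_within by fastforce
      then have "((\<lambda>v. phi c t v * of_real (q t)) has_vector_derivative (- of_real (?Q t / c) * phi (c + 1) t v) * of_real (q t)) (at v within {0..})"
        by (rule has_vector_derivative_mult_left)
      then show "((\<lambda>v. jacobi_transform c F t * (phi c t v * of_real (q t))) has_vector_derivative ?d v t) (at v within {0..})"
        by (rule has_vector_derivative_mult_right)
    qed (auto simp: convex_real_interval)
    then have "((\<lambda>u. 1 / (Gamma (of_real c))\<^sup>2 * (LBINT t. jacobi_transform c F t * (phi c t u * of_real (q t)))) has_vector_derivative 1 / (Gamma (of_real c))\<^sup>2 * (LBINT t. ?d u t)) (at u within {0..})"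
      by (rule has_vector_derivative_mult_right)
    then have "(F has_vector_derivative 1 / (Gamma (of_real c))\<^sup>2 * (LBINT t. ?d u t)) (at u within {0..})"
      by (rule has_vector_derivative_transform[rotated 2]) (use u Finv in auto)
    \<comment> \<open>At u = 0 only a one-sided derivative is available; nontriviality of the filter
      makes it unique.\<close>
    moreover have "at u within {0..} \<noteq> bot"
    proof
      assume "at u within {0..} = bot"
      moreover have "at_right u \<le> at u within {0..}" using u by (intro at_le) auto
      ultimately show False using trivial_limit_at_right_real[of u] by (simp add: bot_unique)
    qed
    ultimately have "f u = 1 / (Gamma (of_real c))\<^sup>2 * (LBINT t. ?d u t)"
      using vector_derivative_unique_within F(2)[OF u] by blast
    also have "(LBINT t. ?d u t) = (LBINT t. 1 / (of_real c)\<^sup>2 * (jacobi_transform (c + 1) f t * (phi (c + 1) t u * of_real (q t * ?Q t))))"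
    proof (intro Bochner_Integration.integral_cong refl)
      fix t
      have "of_real (?Q t / c) = of_real (?Q t) / complex_of_real c" by (rule of_real_divide)
      then show "?d u t = 1 / (of_real c)\<^sup>2 * (jacobi_transform (c + 1) f t * (phi (c + 1) t u * of_real (q t * ?Q t)))"
        unfolding shift of_real_mult using c0 by (simp add: power2_eq_square field_simps del: of_real_add of_real_divide of_real_mult)
    qed
    also have "\<dots> = 1 / (of_real c)\<^sup>2 * (LBINT t. jacobi_transform (c + 1) f t * (phi (c + 1) t u * of_real (q t * ?Q t)))"
      by (rule integral_mult_right_zero)
    also have "1 / (Gamma (of_real c))\<^sup>2 * (1 / (of_real c)\<^sup>2 * (LBINT t. jacobi_transform (c + 1) f t * (phi (c + 1) t u * of_real (q t * ?Q t))))
       = 1 / (Gamma (of_real (c + 1)))\<^sup>2 * (LBINT t. jacobi_transform (c + 1) f t * (phi (c + 1) t u * of_real (q t * ?Q t)))"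
    proof -
      have "complex_of_real c \<notin> \<int>\<^sub>\<le>\<^sub>0" using c0 by (auto simp: nonpos_Ints_def dest: arg_cong[where f = Re])
      then have "Gamma (complex_of_real (c + 1)) = of_real c * Gamma (of_real c)"
        using Gamma_plus1[of "complex_of_real c"] by simp
      then show ?thesis by (simp add: power_mult_distrib)
    qed
    finally show "f u = 1 / (Gamma (of_real (c + 1)))\<^sup>2 * (LBINT t. jacobi_transform (c + 1) f t * (phi (c + 1) t u * of_real (q t * ?Q t)))" .
  qed
qed

subsection \<open>The odd case for parameter one half\<close>

lemma rho_pos: "v > 0 \<Longrightarrow> rho v > 0"
  by (simp add: rho_def)

lemma rho_0 [simp]: "rho 0 = 0"
  by (simp add: rho_def)

lemma rho_nonneg: "v \<ge> 0 \<Longrightarrow> rho v \<ge> 0"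
  using rho_pos[of v] by (cases "v = 0") auto

lemma rho_sinh: "r \<ge> 0 \<Longrightarrow> rho ((sinh (r / 2))\<^sup>2) = r"
  by (simp add: rho_def arsinh_sinh_real)

lemma sinh_rho_half: "v \<ge> 0 \<Longrightarrow> (sinh (rho v / 2))\<^sup>2 = v"
  by (simp add: rho_def sinh_arsinh_real)

lemma sinh_rho: "v \<ge> 0 \<Longrightarrow> sinh (rho v) = 2 * sqrt (v\<^sup>2 + v)"
proof -
  assume v: "v \<ge> 0"
  have "sinh (rho v) = 2 * (sqrt v * sqrt (v + 1))"
    using v by (simp add: rho_def sinh_double sinh_arsinh_real cosh_arsinh_real)
  also have "sqrt v * sqrt (v + 1) = sqrt (v\<^sup>2 + v)"
    by (simp add: power2_eq_square algebra_simps flip: real_sqrt_mult)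
  finally show ?thesis .
qed

lemma rho_deriv: "v > 0 \<Longrightarrow> (rho has_real_derivative 1 / sqrt (v\<^sup>2 + v)) (at v)"
proof -
  assume v: "v > 0"
  have "((\<lambda>v. 2 * arsinh (sqrt v)) has_real_derivative 2 * (1 / sqrt ((sqrt v)\<^sup>2 + 1) * (inverse (sqrt v) / 2))) (at v)"
    using v by (intro DERIV_cmult DERIV_chain2[OF arsinh_real_has_field_derivative DERIV_real_sqrt])
  moreover have "2 * (1 / sqrt ((sqrt v)\<^sup>2 + 1) * (inverse (sqrt v) / 2)) = 1 / sqrt (v\<^sup>2 + v)"
  proof -
    have "sqrt (v\<^sup>2 + v) = sqrt (v + 1) * sqrt v"
      by (simp add: power2_eq_square algebra_simps flip: real_sqrt_mult)
    then show ?thesis using v by (simp add: inverse_eq_divide)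
  qed
  ultimately show ?thesis unfolding rho_def[abs_def] by simp
qed

lemma rho_gt: "(sinh (R / 2))\<^sup>2 < v \<Longrightarrow> R < rho v"
proof (rule ccontr)
  assume v: "(sinh (R / 2))\<^sup>2 < v" and "\<not> R < rho v"
  then have "rho v / 2 \<le> R / 2" by simp
  moreover have "v \<ge> 0" using v zero_le_power2[of "sinh (R / 2)"] by linarith
  ultimately have "(sinh (rho v / 2))\<^sup>2 \<le> (sinh (R / 2))\<^sup>2"
    using rho_nonneg[of v] by (intro power_mono) auto
  then show False using v sinh_rho_half[OF \<open>v \<ge> 0\<close>] by simp
qed

lemma rho_image: "u \<ge> 0 \<Longrightarrow> rho ` {u<..} = {rho u<..}"
proof (intro set_eqI iffI)
  fix r assume u: "u \<ge> 0" and "r \<in> rho ` {u<..}"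
  then obtain v where v: "v > u" "r = rho v" by auto
  then show "r \<in> {rho u<..}" by (simp add: rho_def)
next
  fix r assume u: "u \<ge> 0" and r: "r \<in> {rho u<..}"
  then have r0: "r > 0" using rho_nonneg[OF u] by simp
  have "(sinh (rho u / 2))\<^sup>2 < (sinh (r / 2))\<^sup>2"
    using r rho_nonneg[OF u] by (intro power_strict_mono) auto
  then have "(sinh (r / 2))\<^sup>2 > u" using sinh_rho_half[OF u] by simp
  then show "r \<in> rho ` {u<..}" using rho_sinh[of r] r0 by (intro image_eqI[of _ _ "(sinh (r / 2))\<^sup>2"]) auto
qed

lemma rho_inj: "inj_on rho {0<..}"
  by (rule inj_on_inverseI[where g = "\<lambda>r. (sinh (r / 2))\<^sup>2"]) (simp add: sinh_rho_half)

lemma test_fun_rho_adm: "test_fun s g \<Longrightarrow> admissible (\<lambda>v. g (rho v))"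
proof -
  assume g: "test_fun s g"
  then obtain R where R: "\<And>x. R < \<bar>x\<bar> \<Longrightarrow> g x = 0" by (auto simp: test_fun_def)
  have "continuous_on {0..} (\<lambda>v. g (rho v))"
    by (rule continuous_on_compose2[OF test_fun_continuous[OF g, of UNIV]]) (auto intro!: continuous_intros)
  moreover have "g (rho v) = 0" if "v > (sinh (R / 2))\<^sup>2 + 1" for v
    using rho_gt[of R v] that by (intro R) auto
  moreover have "(sinh (R / 2))\<^sup>2 + 1 > 0" by (simp add: add_nonneg_pos)
  ultimately show ?thesis unfolding admissible_def by blast
qed

text \<open>Since \<open>rho\<close> behaves like 2 sqrt v near 0, the chain rule fails at the
  endpoint. Continuity of \<open>P\<close> and \<open>f\<close> allows \<open>P\<close> to be
  written as an integral of \<open>f\<close> from 0, and this is differentiable at 0 too.\<close>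

lemma has_vector_derivative_Ici:
  fixes P f :: "real \<Rightarrow> complex"
  assumes P: "continuous_on {0..} P" and f: "continuous_on {0..} f"
    and der: "\<And>v. v > 0 \<Longrightarrow> (P has_vector_derivative f v) (at v)" and u: "u \<ge> 0"
  shows "(P has_vector_derivative f u) (at u within {0..})"
proof -
  let ?b = "u + 1"
  have "((\<lambda>u. integral {0..u} f) has_vector_derivative f u) (at u within {0..?b})"
    using u f by (intro integral_has_vector_derivative) (auto intro: continuous_on_subset)
  then have "((\<lambda>u. P 0 + integral {0..u} f) has_vector_derivative f u) (at u within {0..?b})"
    using has_vector_derivative_add[OF has_vector_derivative_const] by fastforce
  then have "(P has_vector_derivative f u) (at u within {0..?b})"
  proof (rule has_vector_derivative_transform[rotated 2])
    fix v assume v: "v \<in> {0..?b}"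
    have "(f has_integral P v - P 0) {0..v}"
      by (rule fundamental_theorem_of_calculus_interior) (use v P der in \<open>auto intro: continuous_on_subset\<close>)
    then show "P v = P 0 + integral {0..v} f" by (simp add: integral_unique)
  qed (use u in auto)
  moreover have "at u within {0..?b} = at u within {0..}"
    by (rule at_within_nhd[of u "{..<?b}"]) auto
  ultimately show ?thesis by simp
qed

lemma test_fun_rho_vderiv:
  assumes g: "test_fun s g" and v: "v > 0"
  shows "((\<lambda>v. g (rho v)) has_vector_derivative 2 * (D g (rho v) / of_real (sinh (rho v)))) (at v)"
proof -
  have "(rho has_vector_derivative 1 / sqrt (v\<^sup>2 + v)) (at v)"
    using rho_deriv[OF v] by (simp add: has_real_derivative_iff_has_vector_derivative)
  from vector_diff_chain_at[OF this test_fun_deriv(2)[OF g]]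
  have "((\<lambda>v. g (rho v)) has_vector_derivative (1 / sqrt (v\<^sup>2 + v)) *\<^sub>R D g (rho v)) (at v)"
    by (simp add: o_def)
  then show ?thesis using v by (simp add: sinh_rho scaleR_conv_of_real)
qed

lemma test_fun_rho_primitive:
  assumes g: "test_fun 1 g" and G: "test_fun 1 G" "\<And>x. (G has_vector_derivative g x * of_real (sinh x / 2)) (at x)" and v: "v > 0"
  shows "((\<lambda>v. G (rho v)) has_vector_derivative g (rho v)) (at v)"
proof -
  have "D G (rho v) = g (rho v) * of_real (sinh (rho v) / 2)"
    using G(2) by (rule vector_derivative_at)
  moreover have "complex_of_real (sinh (rho v)) \<noteq> 0" using rho_pos[OF v] by simp
  ultimately have "2 * (D G (rho v) / of_real (sinh (rho v))) = g (rho v)"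
    by (simp add: nonzero_divide_eq_eq mult.commute)
  with test_fun_rho_vderiv[OF G(1) v] show ?thesis by (simp only:)
qed

text \<open>The derivative of \<open>rho\<close> is exactly the weight at c = 1/2, so r = rho v
  turns the transform into a cosine integral over the half line, half of \<open>cosft\<close>
  because g is even.\<close>

lemma jacobi_transform_half:
  assumes g: "test_fun 1 g"
  shows "jacobi_transform (1/2) (\<lambda>v. g (rho v)) t = cosft g t / 2"
proof -
  let ?f = "\<lambda>r. g r * of_real (cos (t * r))"
  have cont: "continuous_on UNIV ?f" by (intro continuous_intros test_fun_continuous[OF g])
  have [measurable]: "g \<in> borel_measurable borel"
    using test_fun_continuous[OF g] by (rule borel_measurable_continuous_onI)
  have img: "rho ` {0<..} = {0<..}" using rho_image[of 0] by simp
  have "(LBINT r:rho ` {0<..}. ?f r) = (LBINT v:{0<..}. \<bar>1 / sqrt (v\<^sup>2 + v)\<bar> *\<^sub>R ?f (rho v))"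
  proof (rule set_lborel_substitution(2))
    show "(rho has_real_derivative 1 / sqrt (x\<^sup>2 + x)) (at x within {0<..})" if "x \<in> {0<..}" for x
      using rho_deriv[of x] that by (auto intro: has_field_derivative_at_within)
  qed (auto simp: img rho_inj)
  also have "\<dots> = jacobi_transform (1/2) (\<lambda>v. g (rho v)) t"
    unfolding jacobi_transform_def
  proof (rule set_lebesgue_integral_cong)
    show "\<forall>v. v \<in> {0<..} \<longrightarrow> \<bar>1 / sqrt (v\<^sup>2 + v)\<bar> *\<^sub>R ?f (rho v) = g (rho v) * phi (1/2) t v * of_real (weight (1/2) v)"
    proof (intro allI impI)
      fix v :: real assume "v \<in> {0<..}"
      then have v: "v > 0" by simp
      have "weight (1/2) v = 1 / sqrt (v\<^sup>2 + v)"
        using sq_plus_pos[OF v] by (simp add: weight_def powr_minus powr_half_sqrt inverse_eq_divide)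
      moreover have "\<bar>1 / sqrt (v\<^sup>2 + v)\<bar> = 1 / sqrt (v\<^sup>2 + v)"
        using sq_plus_pos[OF v] by simp
      ultimately show "\<bar>1 / sqrt (v\<^sup>2 + v)\<bar> *\<^sub>R ?f (rho v) = g (rho v) * phi (1/2) t v * of_real (weight (1/2) v)"
        using v by (simp add: phi_half scaleR_conv_of_real mult_ac)
    qed
  qed simp
  finally have 1: "jacobi_transform (1/2) (\<lambda>v. g (rho v)) t = (LBINT r:{0<..}. ?f r)" by (simp add: img)
  have int: "integrable lborel ?f" by (rule cosft_integrable[OF g])
  have i: "integrable lborel (\<lambda>r. indicator A r *\<^sub>R ?f r)" if "A \<in> sets borel" for A
    using that int by (intro integrable_mult_indicator) auto
  have "cosft g t = (LBINT r. indicator {0<..} r *\<^sub>R ?f r + indicator {..<0} r *\<^sub>R ?f r)"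
    unfolding cosft_def
  proof (rule integral_cong_AE)
    show "AE r in lborel. ?f r = indicator {0<..} r *\<^sub>R ?f r + indicator {..<0} r *\<^sub>R ?f r"
      using AE_lborel_singleton[of 0] by eventually_elim (auto simp: indicator_def)
  qed measurable
  also have "\<dots> = (LBINT r. indicator {0<..} r *\<^sub>R ?f r) + (LBINT r. indicator {..<0} r *\<^sub>R ?f r)"
    by (intro Bochner_Integration.integral_add i) auto
  also have "(LBINT r. indicator {..<0} r *\<^sub>R ?f r) = \<bar>-1\<bar> *\<^sub>R (LBINT r. indicator {..<0} (0 + (-1) * r) *\<^sub>R ?f (0 + (-1) * r))"
    by (intro lborel_integral_real_affine) auto
  also have "\<dots> = (LBINT r. indicator {0<..} r *\<^sub>R ?f r)"
    using g by (simp add: test_fun_def indicator_def)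
  finally show ?thesis
    unfolding 1 set_lebesgue_integral_def by simp
qed

text \<open>The constant 1/(2 pi) of Fourier inversion splits into 1/Gamma(1/2)^2 = 1/pi and the 1/2
  from \<open>jacobi_transform_half\<close>.\<close>

lemma inversion_family_odd:
  "inversion_family (1/2) (\<lambda>_. 1) {\<lambda>v. g (rho v) | g. test_fun 1 g}"
  unfolding inversion_family_def
proof (intro conjI ballI)
  show "\<exists>K N. \<forall>t::real. \<bar>1\<bar> \<le> K * (1 + t\<^sup>2) ^ N"
    by (intro exI[of _ 1] exI[of _ 0]) auto
  show "(\<lambda>_::real. 1 :: real) \<in> borel_measurable borel" by simp
  fix f assume "f \<in> {\<lambda>v. g (rho v) | g. test_fun 1 g}"
  then obtain g where g: "test_fun 1 g" and f: "f = (\<lambda>v. g (rho v))" by auto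
  have jacobi_transform: "jacobi_transform (1/2) f = (\<lambda>t. cosft g t / 2)"
    unfolding f using jacobi_transform_half[OF g] by auto
  have [measurable]: "cosft g \<in> borel_measurable borel" by (rule cosft_measurable[OF g])
  show "jacobi_transform (1/2) f \<in> borel_measurable borel" unfolding jacobi_transform by measurable
  show "\<forall>N. \<exists>C. \<forall>t. norm (jacobi_transform (1/2) f t) * (1 + t\<^sup>2) ^ N \<le> C"
  proof
    fix N
    obtain C where "\<And>t. norm (cosft g t) * (1 + t\<^sup>2) ^ N \<le> C" using cosft_rapid[OF g] by blast
    then have "norm (jacobi_transform (1/2) f t) * (1 + t\<^sup>2) ^ N \<le> C / 2" for t
      unfolding jacobi_transform by (simp add: norm_divide)
    then show "\<exists>C. \<forall>t. norm (jacobi_transform (1/2) f t) * (1 + t\<^sup>2) ^ N \<le> C" by blast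
  qed
  show "\<forall>u\<ge>0. f u = 1 / (Gamma (of_real (1/2)))\<^sup>2 * (LBINT t. jacobi_transform (1/2) f t * (phi (1/2) t u * of_real 1))"
  proof (intro allI impI)
    fix u :: real assume u: "u \<ge> 0"
    have "(LBINT t. jacobi_transform (1/2) f t * (phi (1/2) t u * of_real 1)) = (LBINT t. 1/2 * (cosft g t * of_real (cos (t * rho u))))"
      unfolding jacobi_transform using u by (simp add: phi_half)
    also have "\<dots> = 1/2 * (LBINT t. cosft g t * of_real (cos (t * rho u)))"
      by (rule integral_mult_right_zero)
    finally have I: "(LBINT t. jacobi_transform (1/2) f t * (phi (1/2) t u * of_real 1)) = 1/2 * (LBINT t. cosft g t * of_real (cos (t * rho u)))" .
    have Gam: "(Gamma (complex_of_real (1/2)))\<^sup>2 = of_real pi"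
    proof -
      have "Gamma (complex_of_real (1/2)) = of_real (sqrt pi)"
        by (simp only: Gamma_complex_of_real Gamma_one_half_real)
      then show ?thesis by (simp flip: of_real_power)
    qed
    show "f u = 1 / (Gamma (of_real (1/2)))\<^sup>2 * (LBINT t. jacobi_transform (1/2) f t * (phi (1/2) t u * of_real 1))"
      unfolding I Gam using cosft_inversion[OF g, of "rho u"] by (simp add: f)
  qed
qed

subsection \<open>Mehler's formula\<close>

lemma sinh_cosh_measurable [measurable]:
  "(sinh :: real \<Rightarrow> real) \<in> borel_measurable borel" "(cosh :: real \<Rightarrow> real) \<in> borel_measurable borel"
  by (intro borel_measurable_continuous_onI continuous_intros)+

text \<open>The equation \<open>((v\<^sup>2 + v) Y')' = - l Y\<close> is singular at \<open>0\<close>; bounds on \<open>Y\<close> are improved successively by integrating twice.\<close>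

lemma jacobi_ode_zero:
  fixes Y Y1 Z :: "real \<Rightarrow> complex"
  assumes Y: "continuous_on {0..} Y" "Y 0 = 0" "\<And>v. v > 0 \<Longrightarrow> (Y has_vector_derivative Y1 v) (at v)"
    and Z: "continuous_on {0..} Z" "Z 0 = 0" "\<And>v. v > 0 \<Longrightarrow> (Z has_vector_derivative of_real (- l) * Y v) (at v)"
    and ZY: "\<And>v. v > 0 \<Longrightarrow> Z v = of_real (v\<^sup>2 + v) * Y1 v" and l: "l \<ge> 0"
    and K: "\<And>v. v \<ge> 0 \<Longrightarrow> norm (Y v) \<le> K" and v: "v \<ge> 0"
  shows "Y v = 0"
proof -
  \<comment> \<open>Each round bounds \<open>Z\<close> by integrating l \<open>Y\<close>, divides by
    v^2 + v, which is at least v, to bound the derivative of \<open>Y\<close>, and integrates again.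
    The resulting bounds tend to 0 as n grows.\<close>
  have bd: "norm (Y v) \<le> K * ((l * v) ^ n / fact n)" if "v \<ge> 0" for v n
    using that
  proof (induction n arbitrary: v)
    case 0
    then show ?case using K by simp
  next
    case (Suc n)
    have K0: "K \<ge> 0" using order_trans[OF norm_ge_zero K[of 0]] by simp
    let ?p = "\<lambda>v. K * ((l * v) ^ Suc n / fact (Suc n))" and ?p' = "\<lambda>v. l * (K * ((l * v) ^ n / fact n))"
    have dp: "(?p has_vector_derivative ?p' x) (at x)" for x
    proof -
      have "(?p has_real_derivative K * (real (Suc n) * (l * x) ^ n * l / fact (Suc n))) (at x)"
        by (auto intro!: derivative_eq_intros simp del: fact_Suc of_nat_Suc power_Suc)
      moreover have "K * (real (Suc n) * (l * x) ^ n * l / fact (Suc n)) = ?p' x"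
        by (simp add: field_simps del: of_nat_Suc)
      ultimately show ?thesis by (simp only: has_real_derivative_iff_has_vector_derivative)
    qed
    have cp: "continuous_on S ?p" for S by (intro continuous_intros) auto
    have Zb: "norm (Z v) \<le> ?p v" if "v > 0" for v
    proof -
      have "norm (Z v - Z 0) \<le> ?p v - ?p 0"
      proof (rule differentiable_bound_general[OF that _ cp])
        show "continuous_on {0..v} Z" using Z(1) by (rule continuous_on_subset) auto
        fix x assume x: "0 < x" "x < v"
        show "(Z has_vector_derivative of_real (- l) * Y x) (at x)" by (rule Z(3)[OF x(1)])
        show "(?p has_vector_derivative ?p' x) (at x)" by (rule dp)
        have "l * norm (Y x) \<le> l * (K * ((l * x) ^ n / fact n))"
          using Suc.IH[of x] x l by (intro mult_left_mono) auto
        then show "norm (of_real (- l) * Y x) \<le> ?p' x"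
          unfolding norm_mult norm_of_real using l by simp
      qed
      then show ?thesis using Z(2) by simp
    qed
    have Y1b: "norm (Y1 v) \<le> ?p' v" if v: "v > 0" for v
    proof -
      have "(v\<^sup>2 + v) * norm (Y1 v) = norm (Z v)"
        unfolding ZY[OF v] norm_mult norm_of_real using sq_plus_pos[OF v] by simp
      then have "v * norm (Y1 v) \<le> norm (Z v)"
      proof -
        have "0 \<le> v\<^sup>2 * norm (Y1 v)" by simp
        with \<open>(v\<^sup>2 + v) * norm (Y1 v) = norm (Z v)\<close> show ?thesis
          unfolding distrib_right by linarith
      qed
      also have "\<dots> \<le> ?p v" by (rule Zb[OF v])
      also have "\<dots> = v * (?p' v / real (Suc n))"
        by (simp add: field_simps del: of_nat_Suc)
      finally have "norm (Y1 v) \<le> ?p' v / real (Suc n)" by (rule mult_left_le_imp_le[OF _ v])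
      \<comment> \<open>Giving up the factor 1/(n + 1) leaves exactly the derivative of
        \<open>?p\<close>.\<close>
      also have "\<dots> \<le> ?p' v / 1"
        using l v K0 by (intro divide_left_mono mult_nonneg_nonneg) auto
      finally show ?thesis by simp
    qed
    show ?case
    proof (cases "v = 0")
      case True
      then show ?thesis using Y(2) by simp
    next
      case False
      then have v: "0 < v" using Suc.prems by simp
      have "norm (Y v - Y 0) \<le> ?p v - ?p 0"
      proof (rule differentiable_bound_general[OF v _ cp])
        show "continuous_on {0..v} Y" using Y(1) by (rule continuous_on_subset) auto
        fix x assume x: "0 < x" "x < v"
        show "(Y has_vector_derivative Y1 x) (at x)" by (rule Y(3)[OF x(1)])
        show "(?p has_vector_derivative ?p' x) (at x)" by (rule dp)
        show "norm (Y1 x) \<le> ?p' x" by (rule Y1b[OF x(1)])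
      qed
      then show ?thesis using Y(2) by simp
    qed
  qed
  have "(\<lambda>n. K * ((l * v) ^ n / fact n)) \<longlonglongrightarrow> K * 0"
  proof (intro tendsto_mult tendsto_const)
    have "(l * v) ^ n / fact n = inverse (fact n) * (l * v) ^ n" for n
      by (simp add: field_simps)
    then show "(\<lambda>n. (l * v) ^ n / fact n) \<longlonglongrightarrow> 0"
      using summable_LIMSEQ_zero[OF summable_exp[of "l * v"]] by (simp only:)
  qed
  then have "norm (Y v) \<le> K * 0"
    by (rule LIMSEQ_le_const) (use bd[OF v] in auto)
  then show ?thesis by simp
qed

text \<open>Two expressions for the derivative of \<open>phi (1/2)\<close> are compared, the general
  rule and that of cos(t rho(v)). The factor t^2 stays on the left, so that t = 0 is
  included.\<close>

lemma phi_three_halves: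
  assumes v: "v > 0"
  shows "of_real (t\<^sup>2) * phi (3/2) t v = of_real (t * sin (t * rho v) / sinh (rho v))"
proof -
  have "(phi (1/2) t has_vector_derivative - of_real (((1/2 - 1/2)\<^sup>2 + t\<^sup>2) / (1/2)) * phi (1/2 + 1) t v) (at v)"
    using v by (intro phi_vderiv(1)) auto
  moreover have "(phi (1/2) t has_vector_derivative of_real (- sin (t * rho v) * (t * (1 / sqrt (v\<^sup>2 + v))))) (at v)"
  proof (rule has_vector_derivative_transform_within_open[of _ _ _ "{0<..}"])
    show "((\<lambda>v. complex_of_real (cos (t * rho v))) has_vector_derivative of_real (- sin (t * rho v) * (t * (1 / sqrt (v\<^sup>2 + v))))) (at v)"
      using rho_deriv[OF v]
      by (intro has_vector_derivative_of_real) (auto intro!: derivative_eq_intros simp flip: has_real_derivative_iff_has_vector_derivative)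
  qed (use v in \<open>auto simp: phi_half\<close>)
  ultimately have "- of_real (((1/2 - 1/2)\<^sup>2 + t\<^sup>2) / (1/2)) * phi (1/2 + 1) t v = of_real (- sin (t * rho v) * (t * (1 / sqrt (v\<^sup>2 + v))))"
    by (rule vector_derivative_unique_at)
  then have "2 * (of_real (t\<^sup>2) * phi (3/2) t v) = 2 * of_real (t * sin (t * rho v) / sinh (rho v))"
    using v by (simp add: sinh_rho mult_ac)
  from mult_left_cancel[THEN iffD1, OF _ this] show ?thesis by simp
qed

text \<open>The first bound controls small v, the weighted one large v; they combine through (1 +
  v)^2 \<le> 4 (1 + (v^2 + v)).\<close>

lemma decay_bound:
  fixes a :: real
  assumes a: "a \<ge> 0" "a \<le> K1" "(v\<^sup>2 + v) * a \<le> K2" and v: "v \<ge> 0"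
  shows "(1 + v)\<^sup>2 * a \<le> 4 * (K1 + K2)"
proof -
  have "0 \<le> (v\<^sup>2 + v) * a" using a v by simp
  then have K: "0 \<le> K1" "0 \<le> K2" using a by linarith+
  have "(1 + v)\<^sup>2 \<le> 4 * (1 + (v\<^sup>2 + v))"
    using v by (simp add: power2_eq_square algebra_simps)
  then have "(1 + v)\<^sup>2 * a \<le> 4 * (1 + (v\<^sup>2 + v)) * a"
    using a by (intro mult_right_mono) auto
  also have "\<dots> = 4 * (a + (v\<^sup>2 + v) * a)" by (simp add: algebra_simps)
  also have "\<dots> \<le> 4 * (K1 + K2)" using a by simp
  finally show ?thesis .
qed

context
  fixes t :: real
begin

text \<open>\<open>H1\<close> and \<open>H2\<close> are the first two derivatives of \<open>H0\<close>, which is the integrand in Mehler's formula.\<close>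

private definition H0 :: "real \<Rightarrow> complex" where "H0 v = of_real (t\<^sup>2) * phi (3/2) t v"
private definition H1 :: "real \<Rightarrow> complex" where "H1 v = of_real (- (t\<^sup>2 * (1 + t\<^sup>2) / (3/2))) * phi (5/2) t v"
private definition H2 :: "real \<Rightarrow> complex" where "H2 v = of_real (t\<^sup>2 * (1 + t\<^sup>2) / (3/2) * ((4 + t\<^sup>2) / (5/2))) * phi (7/2) t v"

private lemma hi: "half_integer (5/2)" "half_integer (7/2)"
  using half_integer_Suc[of "3/2"] half_integer_Suc[of "5/2"] by simp_all

private lemma H_deriv:
  assumes "v > -1"
  shows "(H0 has_vector_derivative H1 v) (at v)" "(H1 has_vector_derivative H2 v) (at v)"
proof -
  have "(H0 has_vector_derivative of_real (t\<^sup>2) * (- of_real (((3/2 - 1/2)\<^sup>2 + t\<^sup>2) / (3/2)) * phi (3/2 + 1) t v)) (at v)"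
    unfolding H0_def[abs_def] by (intro has_vector_derivative_mult_right phi_vderiv(1) assms) simp
  then show "(H0 has_vector_derivative H1 v) (at v)"
    by (simp add: H1_def algebra_simps power_divide)
  have e: "(5/2 - 1/2)\<^sup>2 + t\<^sup>2 = 4 + t\<^sup>2" "5/2 + 1 = (7/2::real)" by (simp_all add: power2_eq_square)
  have alg: "of_real (- k) * (- of_real l * p) = of_real (k * l) * p" for k l and p :: complex by simp
  have "(H1 has_vector_derivative of_real (- (t\<^sup>2 * (1 + t\<^sup>2) / (3/2))) * (- of_real (((5/2 - 1/2)\<^sup>2 + t\<^sup>2) / (5/2)) * phi (5/2 + 1) t v)) (at v)"
    unfolding H1_def[abs_def] by (intro has_vector_derivative_mult_right phi_vderiv(1) assms hi)
  then show "(H1 has_vector_derivative H2 v) (at v)"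
    unfolding e alg H2_def[symmetric] .
qed

private lemma H_cont: "continuous_on {-1<..} H0" "continuous_on {-1<..} H1" "continuous_on {-1<..} H2"
  unfolding H0_def[abs_def] H1_def[abs_def] H2_def[abs_def]
  by (intro continuous_intros phi_continuous_on hi; simp)+

private lemma H_ode1:
  assumes "v > -1"
  shows "of_real (v\<^sup>2 + v) * H1 v + of_real (v + 1/2) * H0 v = of_real (t\<^sup>2 / 2) * phi (1/2) t v"
proof -
  have e: "(1/2 + 1/2)\<^sup>2 + t\<^sup>2 = 1 + t\<^sup>2" "1/2 + 1 = (3/2::real)" "1/2 + 2 = (5/2::real)" by (simp_all add: power2_eq_square)
  have "of_real (v\<^sup>2 + v) * (- of_real ((1 + t\<^sup>2) / (3/2)) * phi (5/2) t v)
        + of_real (1/2 * (1 + 2 * v)) * phi (3/2) t v = of_real (1/2) * phi (1/2) t v"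
    using phi_vderiv(2)[of "1/2" v t] assms unfolding e by simp
  then have "of_real (t\<^sup>2) * (of_real (v\<^sup>2 + v) * (- of_real ((1 + t\<^sup>2) / (3/2)) * phi (5/2) t v)
        + of_real (1/2 * (1 + 2 * v)) * phi (3/2) t v) = of_real (t\<^sup>2) * (of_real (1/2) * phi (1/2) t v)"
    by (simp only:)
  then show ?thesis by (simp add: H0_def H1_def algebra_simps)
qed

text \<open>The hypergeometric equation of \<open>phi (3/2)\<close> in the variable v; its constant
  is (3/2 - 1/2)^2 + t^2.\<close>

private lemma H_ode2:
  assumes "v > -1"
  shows "of_real (v\<^sup>2 + v) * H2 v + of_real (3/2 * (2 * v + 1)) * H1 v + of_real (1 + t\<^sup>2) * H0 v = 0"
proof -
  have e: "(3/2 + 1/2)\<^sup>2 + t\<^sup>2 = 4 + t\<^sup>2" "3/2 + 1 = (5/2::real)" "3/2 + 2 = (7/2::real)" by (simp_all add: power2_eq_square)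
  have E: "of_real (v\<^sup>2 + v) * (- of_real ((4 + t\<^sup>2) / (5/2)) * phi (7/2) t v)
        + of_real (3/2 * (1 + 2 * v)) * phi (5/2) t v = of_real (3/2) * phi (3/2) t v"
    using phi_vderiv(2)[of "3/2" v t] assms unfolding e by simp
  define k where "k = t\<^sup>2 * (1 + t\<^sup>2) / (3/2)"
  have "of_real (v\<^sup>2 + v) * H2 v + of_real (3/2 * (2 * v + 1)) * H1 v =
     - of_real k * (of_real (v\<^sup>2 + v) * (- of_real ((4 + t\<^sup>2) / (5/2)) * phi (7/2) t v)
        + of_real (3/2 * (1 + 2 * v)) * phi (5/2) t v)"
    unfolding H1_def H2_def k_def[symmetric] of_real_mult[of k] by (simp add: field_simps)
  also have "\<dots> = - of_real (1 + t\<^sup>2) * H0 v"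
    unfolding E H0_def k_def by (simp add: algebra_simps)
  finally have "of_real (v\<^sup>2 + v) * H2 v + of_real (3/2 * (2 * v + 1)) * H1 v = - of_real (1 + t\<^sup>2) * H0 v" .
  then show ?thesis by (simp only: mult_minus_left left_minus)
qed

text \<open>After the substitution v = u + x^2, decay of order 1/(1 + v) is what makes the
  x-integrals converge uniformly in u. For \<open>H0\<close> it comes from the formula with sine and
  sinh. The two equations then express (v^2 + v) \<open>H1\<close> and (v^2 + v) \<open>H2\<close>
  by quantities already known to be bounded.\<close>

private lemma H_bounds:
  obtains K where "K \<ge> 0" "\<And>v. v > 0 \<Longrightarrow> norm (H0 v) \<le> K / (1 + v)" "\<And>v. v > 0 \<Longrightarrow> norm (H1 v) \<le> K / (1 + v)\<^sup>2"
     "\<And>v. v > 0 \<Longrightarrow> norm (H2 v) \<le> K / (1 + v)\<^sup>2"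
proof -
  have bd: "norm (of_real k * phi c t v) \<le> \<bar>k\<bar>" if "half_integer c" "v > 0" for k c v
    unfolding norm_mult norm_of_real using phi_bound[OF that(1), of v t] that(2) by (intro mult_left_le) auto
  have b0: "norm (H0 v) \<le> t\<^sup>2" if "v > 0" for v
    using bd[of "3/2" v "t\<^sup>2"] that by (simp only: H0_def half_integer_basic abs_power2)
  have b1: "norm (H1 v) \<le> \<bar>- (t\<^sup>2 * (1 + t\<^sup>2) / (3/2))\<bar>" if "v > 0" for v
    unfolding H1_def by (rule bd[OF hi(1) that])
  have b2: "norm (H2 v) \<le> \<bar>t\<^sup>2 * (1 + t\<^sup>2) / (3/2) * ((4 + t\<^sup>2) / (5/2))\<bar>" if "v > 0" for v
    unfolding H2_def by (rule bd[OF hi(2) that])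
  have c0: "(1 + v) * norm (H0 v) \<le> t\<^sup>2 + \<bar>t\<bar>" if v: "v > 0" for v
  proof -
    have s: "sinh (rho v) \<ge> 2 * v"
    proof -
      have "v = sqrt (v\<^sup>2)" using v by simp
      also have "\<dots> \<le> sqrt (v\<^sup>2 + v)" using v by (intro real_sqrt_le_mono) simp
      finally show ?thesis using v by (simp add: sinh_rho)
    qed
    have "norm (H0 v) = \<bar>t\<bar> * \<bar>sin (t * rho v)\<bar> / sinh (rho v)"
      unfolding H0_def phi_three_halves[OF v] norm_of_real using rho_pos[OF v] by (simp add: abs_mult)
    also have "\<dots> \<le> \<bar>t\<bar> * 1 / (2 * v)"
      using s v by (intro frac_le mult_left_mono) auto
    finally have "v * norm (H0 v) \<le> \<bar>t\<bar>" using v by (simp add: field_simps)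
    with b0[OF v] show ?thesis by (simp add: algebra_simps)
  qed
  have c1: "(v\<^sup>2 + v) * norm (H1 v) \<le> (t\<^sup>2 + \<bar>t\<bar>) + t\<^sup>2" if v: "v > 0" for v
  proof -
    have "of_real (v\<^sup>2 + v) * H1 v = of_real (t\<^sup>2 / 2) * phi (1/2) t v - of_real (v + 1/2) * H0 v"
      using H_ode1[of v] v by (simp add: algebra_simps)
    then have "norm (of_real (v\<^sup>2 + v) * H1 v) \<le> norm (of_real (t\<^sup>2 / 2) * phi (1/2) t v) + norm (of_real (v + 1/2) * H0 v)"
      by (metis norm_triangle_ineq4)
    also have "norm (of_real (t\<^sup>2 / 2) * phi (1/2) t v) \<le> t\<^sup>2"
    proof -
      have "t\<^sup>2 / 2 * norm (phi (1/2) t v) \<le> t\<^sup>2 / 2 * 1"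
        using phi_bound[of "1/2" v t] v by (intro mult_left_mono) auto
      also have "\<dots> \<le> t\<^sup>2" by simp
      finally show ?thesis by (simp add: norm_mult norm_power norm_divide)
    qed
    also have "norm (of_real (v + 1/2) * H0 v) \<le> (1 + v) * norm (H0 v)"
      unfolding norm_mult norm_of_real using v by (intro mult_right_mono) auto
    also note c0[OF v]
    also have "norm (of_real (v\<^sup>2 + v) * H1 v) = (v\<^sup>2 + v) * norm (H1 v)"
      unfolding norm_mult norm_of_real using v by (simp add: abs_of_nonneg)
    finally show ?thesis by simp
  qed
  obtain K1 where K1: "\<And>v. v > 0 \<Longrightarrow> (1 + v)\<^sup>2 * norm (H1 v) \<le> K1"
    using decay_bound[OF norm_ge_zero b1 c1] by (metis less_imp_le)
  have c2: "(v\<^sup>2 + v) * norm (H2 v) \<le> 3 * K1 + (1 + t\<^sup>2) * (t\<^sup>2 + \<bar>t\<bar>)" if v: "v > 0" for v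
  proof -
    have "of_real (v\<^sup>2 + v) * H2 v = - (of_real (3/2 * (2 * v + 1)) * H1 v) - of_real (1 + t\<^sup>2) * H0 v"
      using H_ode2[of v] v by (simp add: algebra_simps eq_neg_iff_add_eq_0)
    then have "norm (of_real (v\<^sup>2 + v) * H2 v) \<le> norm (of_real (3/2 * (2 * v + 1)) * H1 v) + norm (of_real (1 + t\<^sup>2) * H0 v)"
      by (metis norm_triangle_ineq4 norm_minus_cancel)
    also have "norm (of_real (3/2 * (2 * v + 1)) * H1 v) \<le> 3 * ((1 + v)\<^sup>2 * norm (H1 v))"
    proof -
      have "\<bar>3/2 * (2 * v + 1)\<bar> \<le> 3 * (1 + v)\<^sup>2" using v by (simp add: power2_eq_square algebra_simps)
      then have "\<bar>3/2 * (2 * v + 1)\<bar> * norm (H1 v) \<le> (3 * (1 + v)\<^sup>2) * norm (H1 v)" by (intro mult_right_mono) auto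
      then show ?thesis unfolding norm_mult norm_of_real by (simp add: mult.assoc)
    qed
    also have "3 * ((1 + v)\<^sup>2 * norm (H1 v)) \<le> 3 * K1" using K1[OF v] by simp
    also have "norm (of_real (1 + t\<^sup>2) * H0 v) \<le> (1 + t\<^sup>2) * (t\<^sup>2 + \<bar>t\<bar>)"
    proof -
      have "norm (H0 v) \<le> (1 + v) * norm (H0 v)" using v by (simp add: algebra_simps)
      with c0[OF v] have "norm (H0 v) \<le> t\<^sup>2 + \<bar>t\<bar>" by linarith
      then have "(1 + t\<^sup>2) * norm (H0 v) \<le> (1 + t\<^sup>2) * (t\<^sup>2 + \<bar>t\<bar>)" by (intro mult_left_mono) auto
      moreover have "\<bar>1 + t\<^sup>2\<bar> = 1 + t\<^sup>2" by (simp add: abs_of_nonneg)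
      ultimately show ?thesis unfolding norm_mult norm_of_real by simp
    qed
    also have "norm (of_real (v\<^sup>2 + v) * H2 v) = (v\<^sup>2 + v) * norm (H2 v)"
      unfolding norm_mult norm_of_real using v by (simp add: abs_of_nonneg)
    finally show ?thesis by simp
  qed
  obtain K2 where K2: "\<And>v. v > 0 \<Longrightarrow> (1 + v)\<^sup>2 * norm (H2 v) \<le> K2"
    using decay_bound[OF norm_ge_zero b2 c2] by (metis less_imp_le)
  define K where "K = max 0 (max (t\<^sup>2 + \<bar>t\<bar>) (max K1 K2))"
  show ?thesis
  proof (rule that[of K])
    fix v :: real assume v: "v > 0"
    then have p: "0 < 1 + v" "0 < (1 + v)\<^sup>2" by auto
    show "norm (H0 v) \<le> K / (1 + v)"
      using c0[OF v] unfolding pos_le_divide_eq[OF p(1)] by (simp add: K_def mult.commute le_max_iff_disj)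
    show "norm (H1 v) \<le> K / (1 + v)\<^sup>2"
      using K1[OF v] unfolding pos_le_divide_eq[OF p(2)] by (simp add: K_def mult.commute le_max_iff_disj)
    show "norm (H2 v) \<le> K / (1 + v)\<^sup>2"
      using K2[OF v] unfolding pos_le_divide_eq[OF p(2)] by (simp add: K_def mult.commute le_max_iff_disj)
  qed (simp add: K_def)
qed

text \<open>Up to a constant, Weyl's fractional integral of order 1/2 in the variable x = sqrt (v -
  u).\<close>

private definition A :: "(real \<Rightarrow> complex) \<Rightarrow> real \<Rightarrow> complex" where
  "A h u = (LBINT x. indicator {0<..} x *\<^sub>R h (u + x\<^sup>2))"

private lemma A_measurable:
  fixes h :: "real \<Rightarrow> complex"
  assumes "continuous_on {-1<..} h" "u \<ge> 0"
  shows "(\<lambda>x. indicator {0<..} x *\<^sub>R h (u + x\<^sup>2)) \<in> borel_measurable borel"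
proof (rule borel_measurable_continuous_on_indicator)
  have "u + x\<^sup>2 > -1" for x using assms(2) zero_le_power2[of x] by linarith
  then show "continuous_on {0<..} (\<lambda>x. h (u + x\<^sup>2))"
    by (intro continuous_on_compose2[OF assms(1)]) (auto intro!: continuous_intros)
qed simp

private lemma A_bound:
  fixes h :: "real \<Rightarrow> complex"
  assumes K: "K \<ge> 0" and h: "\<And>v. v > 0 \<Longrightarrow> norm (h v) \<le> K / (1 + v)" and u: "u \<ge> 0"
  shows "norm (indicator {0<..} x *\<^sub>R h (u + x\<^sup>2)) \<le> K / (1 + x\<^sup>2)"
proof (cases "x > 0")
  case True
  have v: "u + x\<^sup>2 > 0" using True u by (simp add: add_nonneg_pos)
  have "norm (h (u + x\<^sup>2)) \<le> K / (1 + (u + x\<^sup>2))" by (rule h[OF v])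
  also have "\<dots> \<le> K / (1 + x\<^sup>2)" using K u by (intro divide_left_mono mult_pos_pos add_pos_nonneg) auto
  finally show ?thesis using True by simp
next
  case False
  then show ?thesis using K by simp
qed

private lemma A_integrable:
  fixes h :: "real \<Rightarrow> complex"
  assumes "continuous_on {-1<..} h" "K \<ge> 0" "\<And>v. v > 0 \<Longrightarrow> norm (h v) \<le> K / (1 + v)" "u \<ge> 0"
  shows "integrable lborel (\<lambda>x. indicator {0<..} x *\<^sub>R h (u + x\<^sup>2))"
proof (rule Bochner_Integration.integrable_bound[OF integrable_inverse_1_plus_sq[of K]])
  show "(\<lambda>x. indicator {0<..} x *\<^sub>R h (u + x\<^sup>2)) \<in> borel_measurable lborel"
    using A_measurable[OF assms(1,4)] by simp
  have "norm (indicator {0<..} x *\<^sub>R h (u + x\<^sup>2)) \<le> norm (K / (1 + x\<^sup>2))" for x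
  proof -
    have "norm (indicator {0<..} x *\<^sub>R h (u + x\<^sup>2)) \<le> K / (1 + x\<^sup>2)"
      by (rule A_bound) (use assms in auto)
    also have "\<dots> \<le> norm (K / (1 + x\<^sup>2))" by (simp only: real_norm_def abs_ge_self)
    finally show ?thesis .
  qed
  then show "AE x in lborel. norm (indicator {0<..} x *\<^sub>R h (u + x\<^sup>2)) \<le> norm (K / (1 + x\<^sup>2))"
    by blast
qed

private lemma A_deriv:
  assumes h: "continuous_on {-1<..} h" "\<And>v. v > 0 \<Longrightarrow> norm (h v) \<le> K / (1 + v)"
    and k: "continuous_on {-1<..} k" "\<And>v. v > 0 \<Longrightarrow> norm (k v) \<le> K / (1 + v)" and K: "K \<ge> 0"
    and der: "\<And>v. v > -1 \<Longrightarrow> (h has_vector_derivative k v) (at v)" and u: "u \<ge> 0"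
  shows "(A h has_vector_derivative A k u) (at u within {0..})"
  unfolding A_def[abs_def]
proof (rule leibniz_dominated(1)[where K = "\<lambda>x. K / (1 + x\<^sup>2)"])
  fix v x :: real assume v: "v \<in> {0..}"
  have "v \<ge> 0" using v by simp
  then have "v + x\<^sup>2 > -1" using zero_le_power2[of x] by linarith
  from der[OF this] have "(h has_vector_derivative k (v + x\<^sup>2)) (at (v + x\<^sup>2))" .
  moreover have "((\<lambda>v. v + x\<^sup>2) has_vector_derivative 1) (at v)"
    using has_vector_derivative_add[OF has_vector_derivative_id has_vector_derivative_const] by fastforce
  ultimately have "((\<lambda>v. h (v + x\<^sup>2)) has_vector_derivative k (v + x\<^sup>2)) (at v)"
    using vector_diff_chain_at[of "\<lambda>v. v + x\<^sup>2" 1 v h "k (v + x\<^sup>2)"] by (simp add: o_def)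
  then have "((\<lambda>v. h (v + x\<^sup>2)) has_vector_derivative k (v + x\<^sup>2)) (at v within {0..})"
    by (rule has_vector_derivative_at_within)
  then show "((\<lambda>u. indicator {0<..} x *\<^sub>R h (u + x\<^sup>2)) has_vector_derivative indicator {0<..} x *\<^sub>R k (v + x\<^sup>2)) (at v within {0..})"
    by (cases "x > 0") auto
  show "norm (indicator {0<..} x *\<^sub>R k (v + x\<^sup>2)) \<le> K / (1 + x\<^sup>2)"
    using A_bound[OF K k(2)] v by simp
qed (use A_integrable[OF h(1) K h(2)] A_measurable[OF k(1)] u integrable_inverse_1_plus_sq in \<open>auto simp: convex_real_interval\<close>)

text \<open>Half-order integration carries the equation of parameter 3/2, with constant 1 + t^2,
  into that of parameter 1, with constant 1/4 + t^2. With v = u + x^2 one has u^2 + u = (v^2 + v) +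
  x^2 (x^2 - (2 v + 1)). The first summand is handled by \<open>H_ode2\<close>; the second,
  multiplied by \<open>H2\<close>, integrates by parts because 2 x \<open>H2\<close> is the
  x-derivative of \<open>H1\<close>.\<close>

private lemma A_ode:
  assumes u: "u \<ge> 0"
  shows "of_real (u\<^sup>2 + u) * A H2 u + of_real (2 * u + 1) * A H1 u + of_real (1/4 + t\<^sup>2) * A H0 u = 0"
proof -
  obtain K where K: "K \<ge> 0" "\<And>v. v > 0 \<Longrightarrow> norm (H0 v) \<le> K / (1 + v)" "\<And>v. v > 0 \<Longrightarrow> norm (H1 v) \<le> K / (1 + v)\<^sup>2"
     "\<And>v. v > 0 \<Longrightarrow> norm (H2 v) \<le> K / (1 + v)\<^sup>2" using H_bounds by blast
  have sq: "K / (1 + v)\<^sup>2 \<le> K / (1 + v)" if "v > 0" for v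
    using K(1) that by (intro divide_left_mono) (auto simp: power2_eq_square)
  note K' = K(2) order_trans[OF K(3) sq] order_trans[OF K(4) sq]
  note i0 = A_integrable[OF H_cont(1) K(1) K'(1) u] and i1 = A_integrable[OF H_cont(2) K(1) K'(2) u] and i2 = A_integrable[OF H_cont(3) K(1) K'(3) u]
  let ?v = "\<lambda>x. u + x\<^sup>2"
  let ?q = "\<lambda>x. 2 * (of_real (u\<^sup>2 + u) * H2 (?v x) + of_real (2 * u + 1) * H1 (?v x) + of_real (1/4 + t\<^sup>2) * H0 (?v x))"
  \<comment> \<open>Modulo the equation \<open>H_ode2\<close> at \<open>u + x\<^sup>2\<close>, the integrand of the claim is the \<open>x\<close>-derivative of \<open>?Q\<close>.\<close>
  let ?Q = "\<lambda>x. of_real x * (of_real (x\<^sup>2 - (2 * ?v x + 1)) * H1 (?v x) - of_real (3/2) * H0 (?v x))"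
  have ei: "einterval 0 \<infinity> = {0<..}" by (auto simp: einterval_def)
  have vpos: "?v x > -1" for x using u zero_le_power2[of x] by linarith
  have vc: "((\<lambda>x. u + x\<^sup>2) has_vector_derivative 2 * x) (at x)" for x
    by (auto intro!: derivative_eq_intros simp flip: has_real_derivative_iff_has_vector_derivative)
  have comp: "((\<lambda>x. h (?v x)) has_vector_derivative of_real (2 * x) * k (?v x)) (at x)"
    if "(h has_vector_derivative k (?v x)) (at (?v x))" for h k and x :: real
    using vector_diff_chain_at[OF vc that] by (simp add: o_def scaleR_conv_of_real)
  have Eq: "(LBINT x=0..\<infinity>. ?q x) = 0 - 0"
  proof (rule interval_integral_FTC_integrable)
    fix x :: real
    have p1: "((\<lambda>x. complex_of_real (x\<^sup>2 - (2 * ?v x + 1))) has_vector_derivative of_real (- 2 * x)) (at x)"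
      "(complex_of_real has_vector_derivative of_real 1) (at x)"
      by (intro has_vector_derivative_of_real; auto intro!: derivative_eq_intros simp flip: has_real_derivative_iff_has_vector_derivative)+
    have "(?Q has_vector_derivative of_real x * ((of_real (x\<^sup>2 - (2 * ?v x + 1)) * (of_real (2 * x) * H2 (?v x)) + of_real (- 2 * x) * H1 (?v x)) - of_real (3/2) * (of_real (2 * x) * H1 (?v x)))
       + of_real 1 * (of_real (x\<^sup>2 - (2 * ?v x + 1)) * H1 (?v x) - of_real (3/2) * H0 (?v x))) (at x)"
      by (intro has_vector_derivative_mult has_vector_derivative_diff p1 comp H_deriv vpos has_vector_derivative_mult_right)
    moreover have "of_real x * ((of_real (x\<^sup>2 - (2 * ?v x + 1)) * (of_real (2 * x) * H2 (?v x)) + of_real (- 2 * x) * H1 (?v x)) - of_real (3/2) * (of_real (2 * x) * H1 (?v x)))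
       + of_real 1 * (of_real (x\<^sup>2 - (2 * ?v x + 1)) * H1 (?v x) - of_real (3/2) * H0 (?v x)) = ?q x"
    proof -
      define v where "v = ?v x"
      have u: "u = v - x\<^sup>2" by (simp add: v_def)
      have "of_real x * ((of_real (x\<^sup>2 - (2 * v + 1)) * (of_real (2 * x) * H2 v) + of_real (- 2 * x) * H1 v) - of_real (3/2) * (of_real (2 * x) * H1 v))
       + of_real 1 * (of_real (x\<^sup>2 - (2 * v + 1)) * H1 v - of_real (3/2) * H0 v)
       - 2 * (of_real ((v - x\<^sup>2)\<^sup>2 + (v - x\<^sup>2)) * H2 v + of_real (2 * (v - x\<^sup>2) + 1) * H1 v + of_real (1/4 + t\<^sup>2) * H0 v)
       = - 2 * (of_real (v\<^sup>2 + v) * H2 v + of_real (3/2 * (2 * v + 1)) * H1 v + of_real (1 + t\<^sup>2) * H0 v)"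
        by (simp add: algebra_simps power2_eq_square)
      also have "\<dots> = 0" using H_ode2[of v] vpos by (simp add: v_def)
      finally show ?thesis unfolding v_def[symmetric] u by simp
    qed
    ultimately show "(?Q has_vector_derivative ?q x) (at x)" by (simp only:)
    have "isCont H0 (?v x)" "isCont H1 (?v x)" "isCont H2 (?v x)"
      using H_cont vpos by (auto simp: continuous_on_eq_continuous_at)
    then show "isCont ?q x"
      by (intro continuous_intros isCont_o2[of _ ?v]) auto
  next
    have "integrable lborel (\<lambda>x. 2 * (of_real (u\<^sup>2 + u) * (indicator {0<..} x *\<^sub>R H2 (?v x)) + of_real (2 * u + 1) * (indicator {0<..} x *\<^sub>R H1 (?v x)) + of_real (1/4 + t\<^sup>2) * (indicator {0<..} x *\<^sub>R H0 (?v x))))"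
      by (intro integrable_mult_right Bochner_Integration.integrable_add i0 i1 i2)
    also have "(\<lambda>x. 2 * (of_real (u\<^sup>2 + u) * (indicator {0<..} x *\<^sub>R H2 (?v x)) + of_real (2 * u + 1) * (indicator {0<..} x *\<^sub>R H1 (?v x)) + of_real (1/4 + t\<^sup>2) * (indicator {0<..} x *\<^sub>R H0 (?v x))))
       = (\<lambda>x. indicator {0<..} x *\<^sub>R ?q x)"
      by (auto simp: indicator_def)
    finally show "set_integrable lborel (einterval 0 \<infinity>) ?q"
      unfolding ei set_integrable_def .
    have "isCont H0 (?v 0)" "isCont H1 (?v 0)"
      using H_cont vpos[of 0] by (auto simp: continuous_on_eq_continuous_at)
    then have "isCont ?Q 0"
      by (intro continuous_intros isCont_o2[of _ ?v]) auto
    then have "(?Q \<longlongrightarrow> ?Q 0) (at_right 0)"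
      unfolding isCont_def filterlim_at_split by simp
    then show "((?Q \<circ> real_of_ereal) \<longlongrightarrow> 0) (at_right 0)"
      unfolding zero_ereal_def ereal_tendsto_simps by simp
    have lim0: "((\<lambda>x::real. x * (3 * K / (1 + x\<^sup>2) + 3/2 * (K / (1 + x\<^sup>2)))) \<longlongrightarrow> 0) at_top"
      by real_asymp
    have Qb: "norm (?Q x) \<le> x * (3 * K / (1 + x\<^sup>2) + 3/2 * (K / (1 + x\<^sup>2)))" if x: "x > 0" for x
    proof -
      have v: "?v x > 0" using x u by (simp add: add_nonneg_pos)
      have b0: "norm (H0 (?v x)) \<le> K / (1 + x\<^sup>2)"
        using A_bound[OF K(1) K'(1) u, of x] x by simp
      have "\<bar>x\<^sup>2 - (2 * ?v x + 1)\<bar> \<le> 3 * (1 + ?v x)" using x u by (simp add: abs_le_iff)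
      then have "\<bar>x\<^sup>2 - (2 * ?v x + 1)\<bar> * norm (H1 (?v x)) \<le> (3 * (1 + ?v x)) * (K / (1 + ?v x)\<^sup>2)"
        using v by (intro mult_mono K(3)) auto
      also have "\<dots> = 3 * K / (1 + ?v x)"
      proof -
        have p: "(3 * p) * (K / p\<^sup>2) = 3 * K / p" if "p > 0" for p :: real
          using that by (simp add: power2_eq_square)
        show ?thesis by (rule p) (use v in simp)
      qed
      also have "\<dots> \<le> 3 * K / (1 + x\<^sup>2)" using K(1) u by (intro divide_left_mono mult_pos_pos add_pos_nonneg) auto
      finally have b1: "\<bar>x\<^sup>2 - (2 * ?v x + 1)\<bar> * norm (H1 (?v x)) \<le> 3 * K / (1 + x\<^sup>2)" .
      have "norm (of_real (x\<^sup>2 - (2 * ?v x + 1)) * H1 (?v x) - of_real (3/2) * H0 (?v x)) \<le>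
         norm (of_real (x\<^sup>2 - (2 * ?v x + 1)) * H1 (?v x)) + norm (of_real (3/2) * H0 (?v x))"
        by (rule norm_triangle_ineq4)
      also have "\<dots> \<le> 3 * K / (1 + x\<^sup>2) + 3/2 * (K / (1 + x\<^sup>2))"
      proof -
        have "\<bar>3/2::real\<bar> * norm (H0 (?v x)) \<le> 3/2 * (K / (1 + x\<^sup>2))"
          by (rule mult_mono) (use b0 in auto)
        then show ?thesis unfolding norm_mult norm_of_real by (intro add_mono b1)
      qed
      finally show ?thesis using x unfolding norm_mult[of "of_real x"] norm_of_real by (simp add: mult_left_mono)
    qed
    have "\<forall>\<^sub>F x in at_top. norm (?Q x) \<le> x * (3 * K / (1 + x\<^sup>2) + 3/2 * (K / (1 + x\<^sup>2)))"
      using eventually_gt_at_top[of 0] by eventually_elim (rule Qb)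
    from Lim_null_comparison[OF this lim0] have "(?Q \<longlongrightarrow> 0) at_top" .
    then show "((?Q \<circ> real_of_ereal) \<longlongrightarrow> 0) (at_left \<infinity>)"
      unfolding ereal_tendsto_simps .
  qed simp
  have "0 = (LBINT x. indicator {0<..} x *\<^sub>R ?q x)"
    using Eq by (simp add: interval_lebesgue_integral_def ei set_lebesgue_integral_def)
  also have "\<dots> = (LBINT x. 2 * (of_real (u\<^sup>2 + u) * (indicator {0<..} x *\<^sub>R H2 (?v x)) + of_real (2 * u + 1) * (indicator {0<..} x *\<^sub>R H1 (?v x)) + of_real (1/4 + t\<^sup>2) * (indicator {0<..} x *\<^sub>R H0 (?v x))))"
    by (intro Bochner_Integration.integral_cong) (auto simp: indicator_def)
  also have "\<dots> = 2 * (of_real (u\<^sup>2 + u) * A H2 u + of_real (2 * u + 1) * A H1 u + of_real (1/4 + t\<^sup>2) * A H0 u)"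
    unfolding A_def using i0 i1 i2
    by (simp only: integral_mult_right_zero Bochner_Integration.integral_add Bochner_Integration.integrable_add integrable_mult_right)
  finally have "2 * (of_real (u\<^sup>2 + u) * A H2 u + of_real (2 * u + 1) * A H1 u + of_real (1/4 + t\<^sup>2) * A H0 u) = 0"
    by (rule sym)
  then show ?thesis unfolding mult_eq_0_iff[of "2::complex"] by simp
qed

text \<open>The substitution x = sinh(r/2) gives rho(x^2) = r, and the Jacobian cosh(r/2)/2 divided
  by sinh r leaves 1/(4 sinh(r/2)), so the sine transform applies.\<close>

private lemma A_zero: "A H0 0 = of_real (pi / 4 * (t * tanh (pi * t)))"
proof -
  let ?f = "\<lambda>x. complex_of_real (t * sin (t * rho (x\<^sup>2)) / sinh (rho (x\<^sup>2)))"
  have img: "(\<lambda>r::real. sinh (r / 2)) ` {0<..} = {0<..}"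
  proof (intro set_eqI iffI)
    fix x :: real assume "x \<in> {0<..}"
    then show "x \<in> (\<lambda>r. sinh (r / 2)) ` {0<..}"
      by (intro image_eqI[of _ _ "2 * arsinh x"]) (auto simp: sinh_arsinh_real)
  qed auto
  have "A H0 0 = (LBINT x:{0<..}. ?f x)"
    unfolding A_def set_lebesgue_integral_def
    by (intro Bochner_Integration.integral_cong) (auto simp: H0_def phi_three_halves indicator_def simp del: of_real_power of_real_mult of_real_divide)
  also have "\<dots> = (LBINT r:{0<..}. \<bar>cosh (r / 2) / 2\<bar> *\<^sub>R ?f (sinh (r / 2)))"
  proof -
    have "(LBINT x:(\<lambda>r::real. sinh (r / 2)) ` {0<..}. ?f x) = (LBINT r:{0<..}. \<bar>cosh (r / 2) / 2\<bar> *\<^sub>R ?f (sinh (r / 2)))"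
    proof (rule set_lborel_substitution(2))
      show "((\<lambda>r. sinh (r / 2)) has_real_derivative cosh (r / 2) / 2) (at r within {0<..})" for r :: real
        by (auto intro!: derivative_eq_intros)
      show "inj_on (\<lambda>r::real. sinh (r / 2)) {0<..}" by (rule inj_onI) simp
      show "(\<lambda>x. indicator ((\<lambda>r::real. sinh (r / 2)) ` {0<..}) x *\<^sub>R ?f x) \<in> borel_measurable borel"
        unfolding img by measurable
    qed (measurable, simp add: img, measurable)
    then show ?thesis by (simp only: img)
  qed
  also have "\<dots> = (LBINT r:{0<..}. complex_of_real (t / 4 * (sin (t * r) / sinh (r / 2))))"
  proof (rule set_lebesgue_integral_cong)
    show "\<forall>r. r \<in> {0<..} \<longrightarrow> \<bar>cosh (r / 2) / 2\<bar> *\<^sub>R ?f (sinh (r / 2)) = complex_of_real (t / 4 * (sin (t * r) / sinh (r / 2)))"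
    proof (intro allI impI)
      fix r :: real assume "r \<in> {0<..}"
      then have r: "r > 0" by simp
      have "sinh r = 2 * sinh (r / 2) * cosh (r / 2)" using sinh_double[of "r / 2"] by simp
      then show "\<bar>cosh (r / 2) / 2\<bar> *\<^sub>R ?f (sinh (r / 2)) = complex_of_real (t / 4 * (sin (t * r) / sinh (r / 2)))"
        using r by (simp add: rho_sinh scaleR_conv_of_real)
    qed
  qed simp
  also have "\<dots> = of_real (LBINT r:{0<..}. t / 4 * (sin (t * r) / sinh (r / 2)))"
    by (rule set_integral_complex_of_real)
  also have "(LBINT r:{0<..}. t / 4 * (sin (t * r) / sinh (r / 2))) = t / 4 * (pi * tanh (pi * t))"
    by (simp only: set_integral_mult_right sin_over_sinh_integral)
  finally show ?thesis by (simp add: mult_ac)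
qed

private lemma A_eq:
  assumes u: "u \<ge> 0"
  shows "A H0 u = of_real (pi / 4 * (t * tanh (pi * t))) * phi 1 t u"
proof -
  let ?c = "complex_of_real (pi / 4 * (t * tanh (pi * t)))" and ?l = "1/4 + t\<^sup>2"
  obtain K where K: "K \<ge> 0" "\<And>v. v > 0 \<Longrightarrow> norm (H0 v) \<le> K / (1 + v)" "\<And>v. v > 0 \<Longrightarrow> norm (H1 v) \<le> K / (1 + v)\<^sup>2"
     "\<And>v. v > 0 \<Longrightarrow> norm (H2 v) \<le> K / (1 + v)\<^sup>2" using H_bounds by blast
  have sq: "K / (1 + v)\<^sup>2 \<le> K / (1 + v)" if "v > 0" for v
    using K(1) that by (intro divide_left_mono) (auto simp: power2_eq_square)
  note K' = K(2) order_trans[OF K(3) sq] order_trans[OF K(4) sq]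
  have dA0: "(A H0 has_vector_derivative A H1 u) (at u within {0..})" if "u \<ge> 0" for u
    by (rule A_deriv[OF H_cont(1) K'(1) H_cont(2) K'(2) K(1) H_deriv(1) that])
  have dA1: "(A H1 has_vector_derivative A H2 u) (at u within {0..})" if "u \<ge> 0" for u
    by (rule A_deriv[OF H_cont(2) K'(2) H_cont(3) K'(3) K(1) H_deriv(2) that])
  have int: "at v within {0..} = at v" if "v > 0" for v :: real
    by (rule at_within_interior) (use that in simp)
  have cA: "continuous_on {0..} (A H0)" "continuous_on {0..} (A H1)"
    using dA0 dA1 by (auto simp: continuous_on_eq_continuous_within intro: has_vector_derivative_continuous)
  have cphi: "continuous_on {0..} (phi 1 t)" "continuous_on {0..} (phi 2 t)"
    using half_integer_Suc[of 1] by (intro phi_continuous_on; auto)+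
  let ?Y = "\<lambda>u. A H0 u - ?c * phi 1 t u" and ?Y1 = "\<lambda>u. A H1 u - ?c * (of_real (- ?l) * phi 2 t u)"
  \<comment> \<open>The flux form of the equation: \<open>?Z\<close> is w times the derivative of
    \<open>?Y\<close>, and its own derivative is -(1/4 + t^2) \<open>?Y\<close> by
    \<open>A_ode\<close> and by the matching relation for \<open>phi 1\<close>.\<close>
  let ?Z = "\<lambda>u. of_real (u\<^sup>2 + u) * ?Y1 u"
  have e: "1 + 1 = (2::real)" "(1 - 1/2)\<^sup>2 + t\<^sup>2 = ?l" "(1 + 1/2)\<^sup>2 + t\<^sup>2 = 9/4 + t\<^sup>2" "1 + 2 = (3::real)"
    "(2 - 1/2)\<^sup>2 + t\<^sup>2 = 9/4 + t\<^sup>2" "2 + 1 = (3::real)"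
    by (simp_all add: power2_eq_square)
  have h2: "half_integer 2" using half_integer_Suc[of 1] by simp
  have d1: "(phi 1 t has_vector_derivative of_real (- ?l) * phi 2 t v) (at v)" if "v > 0" for v
    using phi_vderiv(1)[of 1 v t] that unfolding e by simp
  have d2: "(phi 2 t has_vector_derivative - of_real ((9/4 + t\<^sup>2) / 2) * phi 3 t v) (at v)" if "v > 0" for v
    using phi_vderiv(1)[OF h2, of v t] that unfolding e by simp
  have rel: "of_real (v\<^sup>2 + v) * (- of_real ((9/4 + t\<^sup>2) / 2) * phi 3 t v) + of_real (2 * v + 1) * phi 2 t v = phi 1 t v" if "v > 0" for v
    using phi_vderiv(2)[of 1 v t] that unfolding e by (simp add: add.commute)
  have "?Y u = 0"
  proof (rule jacobi_ode_zero[where Y = ?Y and ?Y1.0 = ?Y1 and Z = ?Z and l = ?l])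
    show "continuous_on {0..} ?Y" "continuous_on {0..} ?Z"
      by (intro continuous_intros cA cphi)+
    show "?Y 0 = 0" using A_zero by simp
    show "(?Y has_vector_derivative ?Y1 v) (at v)" if "v > 0" for v
      using dA0[of v] that unfolding int[OF that]
      by (intro has_vector_derivative_diff has_vector_derivative_mult_right d1) auto
    show "(?Z has_vector_derivative of_real (- ?l) * ?Y v) (at v)" if v: "v > 0" for v
    proof -
      have p: "((\<lambda>u. complex_of_real (u\<^sup>2 + u)) has_vector_derivative of_real (2 * v + 1)) (at v)"
        by (intro has_vector_derivative_of_real; auto intro!: derivative_eq_intros simp flip: has_real_derivative_iff_has_vector_derivative)
      have "(?Z has_vector_derivative of_real (v\<^sup>2 + v) * (A H2 v - ?c * (of_real (- ?l) * (- of_real ((9/4 + t\<^sup>2) / 2) * phi 3 t v))) + of_real (2 * v + 1) * ?Y1 v) (at v)"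
        using dA1[of v] v unfolding int[OF v]
        by (intro has_vector_derivative_mult p has_vector_derivative_diff has_vector_derivative_mult_right d2) auto
      moreover have "of_real (v\<^sup>2 + v) * (A H2 v - ?c * (of_real (- ?l) * (- of_real ((9/4 + t\<^sup>2) / 2) * phi 3 t v))) + of_real (2 * v + 1) * ?Y1 v
        = (of_real (v\<^sup>2 + v) * A H2 v + of_real (2 * v + 1) * A H1 v) + ?c * of_real ?l * (of_real (v\<^sup>2 + v) * (- of_real ((9/4 + t\<^sup>2) / 2) * phi 3 t v) + of_real (2 * v + 1) * phi 2 t v)"
      proof -
        have "V * (A2 - c * (- L * (m * p3))) + W * (A1 - c * (- L * p2)) = (V * A2 + W * A1) + c * L * (V * (m * p3) + W * p2)"
          for V W A1 A2 c L m p2 p3 :: complex by (simp add: algebra_simps)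
        then show ?thesis unfolding of_real_minus .
      qed
      moreover have "of_real (v\<^sup>2 + v) * A H2 v + of_real (2 * v + 1) * A H1 v = - of_real ?l * A H0 v"
      proof -
        have "of_real (v\<^sup>2 + v) * A H2 v + of_real (2 * v + 1) * A H1 v + of_real ?l * A H0 v = 0"
          by (rule A_ode) (use v in simp)
        then show ?thesis by (simp only: add_eq_0_iff2 mult_minus_left)
      qed
      ultimately have "(?Z has_vector_derivative - of_real ?l * A H0 v + ?c * of_real ?l * phi 1 t v) (at v)"
        using rel[OF v] by (simp only:)
      moreover have "- L * a + c * L * p = - L * (a - c * p)" for L a c p :: complex
        by (simp add: algebra_simps)
      ultimately show ?thesis by (simp only: of_real_minus)
    qed
    have K2: "integrable lborel (\<lambda>x. K / (1 + x\<^sup>2))" by (rule integrable_inverse_1_plus_sq)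
    show "norm (?Y v) \<le> (LBINT x. K / (1 + x\<^sup>2)) + norm ?c * 1" if v: "v \<ge> 0" for v
    proof -
      have "norm (A H0 v) \<le> (LBINT x. K / (1 + x\<^sup>2))"
        unfolding A_def
      proof (rule order_trans[OF integral_norm_bound integral_mono])
        show "integrable lborel (\<lambda>x. norm (indicator {0<..} x *\<^sub>R H0 (v + x\<^sup>2)))"
          by (rule integrable_norm[OF A_integrable[OF H_cont(1) K(1) K'(1) v]])
        show "norm (indicator {0<..} x *\<^sub>R H0 (v + x\<^sup>2)) \<le> K / (1 + x\<^sup>2)" for x
          by (rule A_bound[OF K(1) K'(1) v])
      qed (rule K2)
      moreover have "norm (?c * phi 1 t v) \<le> norm ?c * 1"
        unfolding norm_mult[of ?c] using phi_bound[of 1 v t] v by (intro mult_left_mono) auto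
      ultimately show ?thesis using norm_triangle_ineq4[of "A H0 v" "?c * phi 1 t v"] by linarith
    qed
  qed (use u in auto)
  then show ?thesis by simp
qed

lemma mehler_second:
  assumes u: "u \<ge> 0"
  shows "(LBINT x:{0<..}. complex_of_real (t * sin (t * rho (u + x\<^sup>2)) / sinh (rho (u + x\<^sup>2)))) =
    of_real (pi / 4 * (t * tanh (pi * t))) * phi 1 t u"
proof -
  have "u + x\<^sup>2 > 0" if "x > 0" for x using u that by (simp add: add_nonneg_pos)
  then have "(LBINT x:{0<..}. complex_of_real (t * sin (t * rho (u + x\<^sup>2)) / sinh (rho (u + x\<^sup>2)))) = A H0 u"
    unfolding A_def set_lebesgue_integral_def
    by (intro Bochner_Integration.integral_cong) (auto simp: H0_def phi_three_halves indicator_def simp del: of_real_power of_real_mult of_real_divide)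
  with A_eq[OF u] show ?thesis by simp
qed

end

subsection \<open>The even case for parameter one\<close>

lemma test_fun_bounded: "test_fun s g \<Longrightarrow> \<exists>M\<ge>0. \<forall>x. norm (g x) \<le> M"
proof -
  assume g: "test_fun s g"
  obtain R where R: "\<And>x. R < \<bar>x\<bar> \<Longrightarrow> g x = 0" using g by (auto simp: test_fun_def)
  have "compact (g ` {-R..R})" by (intro compact_continuous_image test_fun_continuous[OF g]) auto
  then obtain M where M: "\<And>x. x \<in> {-R..R} \<Longrightarrow> norm (g x) \<le> M"
    using compact_imp_bounded bounded_iff by (metis imageI)
  have "norm (g x) \<le> max M 0" for x
  proof (cases "R < \<bar>x\<bar>")
    case True
    then show ?thesis by (simp add: R)
  next
    case False
    then have "x \<in> {-R..R}" by auto
    then show ?thesis using M by (simp add: le_max_iff_disj)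
  qed
  then show ?thesis by (intro exI[of _ "max M 0"]) auto
qed

lemma sinh_ge_self: "x \<ge> 0 \<Longrightarrow> x \<le> sinh (x::real)"
proof -
  assume x: "x \<ge> 0"
  have "sinh 0 - 0 \<le> sinh x - x"
  proof (rule DERIV_nonneg_imp_nondecreasing[OF x])
    fix y :: real
    have "((\<lambda>x. sinh x - x) has_real_derivative cosh y - 1) (at y)"
      by (auto intro!: derivative_eq_intros)
    then show "\<exists>z. ((\<lambda>x. sinh x - x) has_real_derivative z) (at y) \<and> 0 \<le> z"
      using cosh_real_ge_1[of y] by (intro exI[of _ "cosh y - 1"]) auto
  qed
  then show ?thesis by simp
qed

text \<open>For v > 0 this is half the derivative of g(rho(v)). The indicator makes it 0 elsewhere,
  so that it can be shifted and integrated over the whole line.\<close>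

definition deriv_rho :: "(real \<Rightarrow> complex) \<Rightarrow> real \<Rightarrow> complex" where
  "deriv_rho g v = indicator {0<..} v *\<^sub>R (D g (rho v) / of_real (sinh (rho v)))"

lemma deriv_rho_measurable: "test_fun s g \<Longrightarrow> deriv_rho g \<in> borel_measurable borel"
proof -
  assume g: "test_fun s g"
  have [measurable]: "D g \<in> borel_measurable borel"
    using test_fun_continuous[OF test_fun_deriv(1)[OF g]] by (rule borel_measurable_continuous_onI)
  show ?thesis unfolding deriv_rho_def[abs_def] by measurable
qed

text \<open>The quotient stays bounded at 0 because \<open>D g\<close> is odd: it vanishes at 0,
  hence |D g(r)| \<le> M r \<le> M sinh r with M a bound for the second derivative.\<close>

lemma deriv_rho_bounded:
  assumes g: "test_fun 1 g"
  obtains M B where "M \<ge> 0" "B > 0" "\<And>v. norm (deriv_rho g v) \<le> M" "\<And>v. v > B \<Longrightarrow> deriv_rho g v = 0" "\<And>v. v > B \<Longrightarrow> g (rho v) = 0"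
proof -
  have g2: "test_fun (-1) (D g)" "test_fun 1 (D (D g))"
    using test_fun_deriv(1)[OF g] test_fun_deriv(1)[OF test_fun_deriv(1)[OF g]] by auto
  obtain M where M: "M \<ge> 0" "\<And>x. norm (D (D g) x) \<le> M" using test_fun_bounded[OF g2(2)] by blast
  have D0: "D g 0 = 0"
  proof -
    have "D g (- 0) = (- 1) * D g 0" using g2(1) unfolding test_fun_def by blast
    then show ?thesis by simp
  qed
  have le: "norm (D g r) \<le> M * r" if "r \<ge> 0" for r
  proof -
    have "norm (D g r - D g 0) \<le> M * norm (r - 0)"
    proof (rule differentiable_bound[of UNIV])
      fix x
      show "(D g has_derivative (\<lambda>h. h *\<^sub>R D (D g) x)) (at x within UNIV)"
        using test_fun_deriv(2)[OF g2(1), of x] by (simp add: has_vector_derivative_def)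
      show "onorm (\<lambda>h. h *\<^sub>R D (D g) x) \<le> M"
        using M(2)[of x] by (simp add: onorm_scaleR_left onorm_id bounded_linear_ident)
    qed auto
    then show ?thesis using that D0 by simp
  qed
  have "norm (deriv_rho g v) \<le> M" for v
  proof (cases "v > 0")
    case True
    have r: "rho v > 0" by (rule rho_pos[OF True])
    have "norm (D g (rho v)) \<le> M * rho v" using le r by simp
    also have "\<dots> \<le> M * sinh (rho v)" using r M(1) by (intro mult_left_mono sinh_ge_self) auto
    finally have "norm (D g (rho v)) \<le> M * sinh (rho v)" .
    then show ?thesis using True r by (simp add: deriv_rho_def norm_divide divide_le_eq)
  next
    case False
    then show ?thesis using M(1) by (simp add: deriv_rho_def)
  qed
  moreover obtain R1 where R1: "\<And>x. R1 < \<bar>x\<bar> \<Longrightarrow> D g x = 0" using g2(1) by (auto simp: test_fun_def)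
  moreover obtain R2 where R2: "\<And>x. R2 < \<bar>x\<bar> \<Longrightarrow> g x = 0" using g by (auto simp: test_fun_def)
  define B where "B = (sinh (R1 / 2))\<^sup>2 + (sinh (R2 / 2))\<^sup>2 + 1"
  have "B > 0" by (simp add: B_def add_nonneg_pos)
  moreover have "D g (rho v) = 0" "g (rho v) = 0" if "v > B" for v
  proof -
    have "(sinh (R1 / 2))\<^sup>2 < v" "(sinh (R2 / 2))\<^sup>2 < v"
      using that zero_le_power2[of "sinh (R1 / 2)"] zero_le_power2[of "sinh (R2 / 2)"] unfolding B_def by linarith+
    then have "R1 < rho v" "R2 < rho v" by (auto dest: rho_gt)
    then show "D g (rho v) = 0" "g (rho v) = 0" by (auto intro: R1 R2)
  qed
  ultimately show ?thesis using that[of M B] M(1) by (auto simp: deriv_rho_def)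
qed

text \<open>\<open>f_even\<close> after the substitution \<open>t = rho (u + x\<^sup>2)\<close>, which removes the singularity of the integrand at the lower limit.\<close>

definition abel :: "(real \<Rightarrow> complex) \<Rightarrow> real \<Rightarrow> complex" where
  "abel g u = - (LBINT x. indicator {0<..} x *\<^sub>R deriv_rho g (u + x\<^sup>2))"

text \<open>Since cosh(rho(v)) = 1 + 2 v, the radicand becomes 2 x^2 and its root cancels the x of
  the Jacobian. Together with 1/sqrt(v^2 + v) = 2/sinh(rho(v)) the remaining constant is 2 sqrt 2,
  the reciprocal of the prefactor in \<open>f_even\<close>.\<close>

lemma f_even_eq_abel:
  assumes g: "test_fun 1 g" and u: "u \<ge> 0"
  shows "f_even g u = abel g u"
proof -
  let ?r = "\<lambda>x. rho (u + x\<^sup>2)"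
  let ?h = "\<lambda>x. 1 / sqrt ((u + x\<^sup>2)\<^sup>2 + (u + x\<^sup>2)) * (2 * x)"
  let ?f = "\<lambda>s. D g s / complex_of_real (sqrt (cosh s - 1 - 2 * u))"
  have [measurable]: "D g \<in> borel_measurable borel"
    using test_fun_continuous[OF test_fun_deriv(1)[OF g]] by (rule borel_measurable_continuous_onI)
  have pos: "u + x\<^sup>2 > 0" if "x > 0" for x using u that by (simp add: add_nonneg_pos)
  have img0: "(\<lambda>x. u + x\<^sup>2) ` {0<..} = {u<..}"
  proof (intro set_eqI iffI)
    fix y assume "y \<in> {u<..}"
    then show "y \<in> (\<lambda>x. u + x\<^sup>2) ` {0<..}"
      by (intro image_eqI[of _ _ "sqrt (y - u)"]) auto
  qed auto
  have img: "?r ` {0<..} = {rho u<..}"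
    using rho_image[OF u] by (metis img0 image_image)
  have inj: "inj_on ?r {0<..}"
  proof (rule inj_onI)
    fix x y assume xy: "x \<in> {0<..}" "y \<in> {0<..}" "?r x = ?r y"
    then have "u + x\<^sup>2 = u + y\<^sup>2"
      using inj_onD[OF rho_inj, of "u + x\<^sup>2" "u + y\<^sup>2"] pos by auto
    then show "x = y" using xy by simp
  qed
  have "(LBINT s:{rho u<..}. ?f s) = (LBINT s:?r ` {0<..}. ?f s)" by (simp only: img)
  also have "\<dots> = (LBINT x:{0<..}. \<bar>?h x\<bar> *\<^sub>R ?f (?r x))"
  proof (rule set_lborel_substitution(2))
    fix x :: real assume "x \<in> {0<..}"
    then have x: "x > 0" by simp
    have "((\<lambda>x. u + x\<^sup>2) has_real_derivative 2 * x) (at x within {0<..})"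
      by (auto intro!: derivative_eq_intros)
    from DERIV_chain2[OF rho_deriv[OF pos[OF x]] this]
    show "(?r has_real_derivative ?h x) (at x within {0<..})" .
  next
    show "(\<lambda>x. indicator (?r ` {0<..}) x *\<^sub>R ?f x) \<in> borel_measurable borel"
      unfolding img by measurable
  qed (use inj in \<open>auto simp: img\<close>)
  also have "\<dots> = (LBINT x. of_real (2 * sqrt 2) * (indicator {0<..} x *\<^sub>R deriv_rho g (u + x\<^sup>2)))"
    unfolding set_lebesgue_integral_def
  proof (intro Bochner_Integration.integral_cong refl)
    fix x :: real
    show "indicator {0<..} x *\<^sub>R (\<bar>?h x\<bar> *\<^sub>R ?f (?r x)) = complex_of_real (2 * sqrt 2) * (indicator {0<..} x *\<^sub>R deriv_rho g (u + x\<^sup>2))"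
    proof (cases "x > 0")
      case True
      define v where "v = u + x\<^sup>2"
      have v: "v > 0" unfolding v_def by (rule pos[OF True])
      have "cosh (rho v) = 1 + 2 * v"
        using sinh_rho_half[of v] v cosh_double[of "rho v / 2"] cosh_square_eq[of "rho v / 2"] by simp
      then have c: "cosh (rho v) - 1 - 2 * u = 2 * x\<^sup>2" by (simp add: v_def)
      have sq: "sqrt (2 * x\<^sup>2) = sqrt 2 * x" using True by (simp add: real_sqrt_mult)
      have sv: "sqrt (v\<^sup>2 + v) > 0" using sq_plus_pos[OF v] by simp
      have a1: "\<bar>1 / sqrt (v\<^sup>2 + v) * (2 * x)\<bar> = 4 * x / sinh (rho v)"
        using v True sv by (simp add: sinh_rho abs_mult)
      have a2: "(4 * x / sinh (rho v)) *\<^sub>R (D g (rho v) / complex_of_real (sqrt 2 * x)) = complex_of_real (2 * sqrt 2) * (D g (rho v) / of_real (sinh (rho v)))"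
      proof -
        have "4 * x / (sqrt 2 * x) = 2 * sqrt 2" using True by (simp add: field_simps)
        moreover have "(a / S) *\<^sub>R (w / complex_of_real q) = complex_of_real (a / q) * (w / of_real S)" for a S q w
          by (simp add: scaleR_conv_of_real)
        ultimately show ?thesis by metis
      qed
      have a3: "deriv_rho g v = D g (rho v) / of_real (sinh (rho v))" using v by (simp add: deriv_rho_def)
      have a4: "indicator {0<..} x = (1::real)" using True by simp
      show ?thesis unfolding v_def[symmetric] c sq a1 a2 a3 a4 scaleR_one ..
    qed simp
  qed
  also have "\<dots> = of_real (2 * sqrt 2) * (LBINT x. indicator {0<..} x *\<^sub>R deriv_rho g (u + x\<^sup>2))"
    by (rule integral_mult_right_zero)
  finally show ?thesis
    unfolding f_even_def abel_def by simp
qed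

text \<open>A majorant in x that does not depend on u, for the dominated convergence and Fubini
  arguments with Abel integrals.\<close>

lemma shifted_square_bound:
  fixes k :: "real \<Rightarrow> complex"
  assumes "\<And>v. v > 0 \<Longrightarrow> norm (k v) \<le> M" "\<And>v. v > B \<Longrightarrow> k v = 0" "M \<ge> 0" "B > 0" "u \<ge> 0"
  shows "norm (indicator {0<..} x *\<^sub>R k (u + x\<^sup>2)) \<le> M * indicator {0..B+1} x"
proof (cases "x > 0 \<and> x \<le> B + 1")
  case True
  then show ?thesis using assms(1)[of "u + x\<^sup>2"] assms(5) by (simp add: add_nonneg_pos)
next
  case False
  have "k (u + x\<^sup>2) = 0" if "x > B + 1"
  proof -
    \<comment> \<open>Beyond B + 1 one has x > 1, hence x^2 \<ge> x > B; the bound B alone would not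
      do when B < 1.\<close>
    have "x * 1 \<le> x * x" using that assms(4) by (intro mult_left_mono) auto
    then have "u + x\<^sup>2 > B" using that assms(5) unfolding power2_eq_square by linarith
    then show ?thesis by (rule assms(2))
  qed
  with False show ?thesis using assms(3) by (auto simp: indicator_def)
qed

lemma integrable_const_indicator: "integrable lborel (\<lambda>x::real. M * indicator {a..b} x :: real)"
  by (intro integrable_mult_right integrable_real_indicator) (auto simp: emeasure_lborel_Icc_eq)

text \<open>The sinh in the derivative of \<open>G\<close> cancels the one in
  \<open>deriv_rho\<close>, so \<open>abel G\<close> is minus the integral of g(rho(u + x^2))/2.
  Differentiating in u turns this into \<open>deriv_rho g\<close>.\<close>

lemma abel_primitive:
  assumes g: "test_fun 1 g" and G: "test_fun 1 G" "\<And>x. (G has_vector_derivative g x * of_real (sinh x / 2)) (at x)" and u: "u \<ge> 0"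
  shows "(abel G has_vector_derivative abel g u) (at u within {0..})"
proof -
  obtain M B where MB: "M \<ge> 0" "B > 0" "\<And>v. norm (deriv_rho g v) \<le> M" "\<And>v. v > B \<Longrightarrow> deriv_rho g v = 0" "\<And>v. v > B \<Longrightarrow> g (rho v) = 0"
    using deriv_rho_bounded[OF g] by metis
  obtain M' where M': "M' \<ge> 0" "\<And>x. norm (g x) \<le> M'" using test_fun_bounded[OF g] by blast
  have [measurable]: "deriv_rho g \<in> borel_measurable borel" by (rule deriv_rho_measurable[OF g])
  have [measurable]: "g \<in> borel_measurable borel"
    using test_fun_continuous[OF g] by (rule borel_measurable_continuous_onI)
  let ?k = "\<lambda>v. g (rho v) / 2"
  have gsG: "deriv_rho G v = ?k v" if v: "v > 0" for v
  proof -
    have "D G (rho v) = g (rho v) * of_real (sinh (rho v) / 2)"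
      using G(2) by (rule vector_derivative_at)
    moreover have "complex_of_real (sinh (rho v)) \<noteq> 0" using rho_pos[OF v] by simp
    ultimately show ?thesis using v by (simp add: deriv_rho_def)
  qed
  have pos: "v + x\<^sup>2 > 0" if "v \<ge> 0" "x > 0" for v x :: real using that by (simp add: add_nonneg_pos)
  have evG: "abel G v = - (LBINT x. indicator {0<..} x *\<^sub>R ?k (v + x\<^sup>2))" if "v \<ge> 0" for v
    unfolding abel_def using gsG[OF pos[OF that]]
    by (intro arg_cong[of _ _ uminus] Bochner_Integration.integral_cong) (auto simp: indicator_def)
  have "((\<lambda>v. LBINT x. indicator {0<..} x *\<^sub>R ?k (v + x\<^sup>2)) has_vector_derivative (LBINT x. indicator {0<..} x *\<^sub>R deriv_rho g (u + x\<^sup>2))) (at u within {0..})"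
  proof (rule leibniz_dominated(1))
    fix v x :: real assume v: "v \<in> {0..}"
    show "((\<lambda>v. indicator {0<..} x *\<^sub>R ?k (v + x\<^sup>2)) has_vector_derivative indicator {0<..} x *\<^sub>R deriv_rho g (v + x\<^sup>2)) (at v within {0..})"
    proof (cases "x > 0")
      case True
      have p: "v + x\<^sup>2 > 0" using pos[of v x] v True by simp
      have "((\<lambda>v. v + x\<^sup>2) has_vector_derivative 1) (at v)"
        using has_vector_derivative_add[OF has_vector_derivative_id has_vector_derivative_const] by fastforce
      from vector_diff_chain_at[OF this test_fun_rho_vderiv[OF g p]]
      have "((\<lambda>v. g (rho (v + x\<^sup>2))) has_vector_derivative 2 * (D g (rho (v + x\<^sup>2)) / of_real (sinh (rho (v + x\<^sup>2))))) (at v)"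
        by (simp add: o_def)
      then have "((\<lambda>v. (1/2) * g (rho (v + x\<^sup>2))) has_vector_derivative (1/2) * (2 * (D g (rho (v + x\<^sup>2)) / of_real (sinh (rho (v + x\<^sup>2)))))) (at v within {0..})"
        by (rule has_vector_derivative_mult_right[OF has_vector_derivative_at_within])
      then show ?thesis using True p by (simp add: deriv_rho_def)
    qed simp
    show "norm (indicator {0<..} x *\<^sub>R deriv_rho g (v + x\<^sup>2)) \<le> M * indicator {0..B+1} x"
      by (rule shifted_square_bound) (use MB v in auto)
  next
    show "integrable lborel (\<lambda>x::real. M * indicator {0..B+1} x :: real)" by (rule integrable_const_indicator)
    fix v :: real assume v: "v \<in> {0..}"
    show "integrable lborel (\<lambda>x. indicator {0<..} x *\<^sub>R ?k (v + x\<^sup>2))"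
    proof (rule Bochner_Integration.integrable_bound[OF integrable_const_indicator[of M' 0 "B+1"]])
      show "(\<lambda>x. indicator {0<..} x *\<^sub>R ?k (v + x\<^sup>2)) \<in> borel_measurable lborel" by measurable
      have "norm (?k w) \<le> M'" for w
      proof -
        have "norm (?k w) \<le> norm (g (rho w))" by (simp add: norm_divide)
        with M'(2)[of "rho w"] show ?thesis by linarith
      qed
      then have "norm (indicator {0<..} x *\<^sub>R ?k (v + x\<^sup>2)) \<le> M' * indicator {0..B+1} x" for x
        by (rule shifted_square_bound) (use MB M' v in auto)
      then show "AE x in lborel. norm (indicator {0<..} x *\<^sub>R ?k (v + x\<^sup>2)) \<le> norm (M' * indicator {0..B+1} x :: real)"
        using M'(1) by (auto simp del: norm_scaleR)
    qed
  qed (use u in \<open>auto simp: convex_real_interval\<close>)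
  then have "((\<lambda>v. - (LBINT x. indicator {0<..} x *\<^sub>R ?k (v + x\<^sup>2))) has_vector_derivative abel g u) (at u within {0..})"
    unfolding abel_def by (rule has_vector_derivative_minus)
  then show ?thesis
    by (rule has_vector_derivative_transform[rotated 2]) (use u evG in auto)
qed

text \<open>The constant 1/8 is 1/(2 pi) from Fourier inversion times pi/4 from Mehler's
  formula.\<close>

lemma abel_inversion:
  assumes g: "test_fun 1 g" and u: "u \<ge> 0"
  shows "abel g u = 1/8 * (LBINT t. cosft g t * (phi 1 t u * of_real (t * tanh (pi * t))))"
proof -
  let ?k = "\<lambda>x t. indicator {0<..} x *\<^sub>R (cosft g t * of_real (t * sin (t * rho (u + x\<^sup>2)) / sinh (rho (u + x\<^sup>2))))"
  have [measurable]: "cosft g \<in> borel_measurable borel" by (rule cosft_measurable[OF g])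
  have pos: "u + x\<^sup>2 > 0" if "x > 0" for x :: real using u that by (simp add: add_nonneg_pos)
  have "(LBINT x. indicator {0<..} x *\<^sub>R deriv_rho g (u + x\<^sup>2)) = (LBINT x. - (1 / (2 * pi)) * (LBINT t. ?k x t))"
  proof (intro Bochner_Integration.integral_cong refl)
    fix x :: real
    show "indicator {0<..} x *\<^sub>R deriv_rho g (u + x\<^sup>2) = - (1 / (2 * pi)) * (LBINT t. ?k x t)"
    proof (cases "x > 0")
      case True
      let ?r = "rho (u + x\<^sup>2)"
      have "(LBINT t. ?k x t) = (LBINT t. 1 / of_real (sinh ?r) * (cosft g t * of_real (t * sin (t * ?r))))"
        using True by (intro Bochner_Integration.integral_cong) auto
      also have "\<dots> = 1 / of_real (sinh ?r) * (LBINT t. cosft g t * of_real (t * sin (t * ?r)))"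
        by (rule integral_mult_right_zero)
      finally have "(LBINT t. ?k x t) = 1 / of_real (sinh ?r) * (LBINT t. cosft g t * of_real (t * sin (t * ?r)))" .
      then show ?thesis using True pos[OF True] by (simp add: deriv_rho_def cosft_inversion_deriv[OF g])
    qed simp
  qed
  also have "\<dots> = - (1 / (2 * pi)) * (LBINT x. LBINT t. ?k x t)"
    by (rule integral_mult_right_zero)
  also have "(LBINT x. LBINT t. ?k x t) = (LBINT t. LBINT x. ?k x t)"
  proof (rule Fubini_dominated)
    show "integrable lborel (\<lambda>x::real. 1 / (1 + x\<^sup>2))" by (rule integrable_inverse_1_plus_sq)
    show "integrable lborel (\<lambda>t. norm (cosft g t * of_real (2 * (1 + t\<^sup>2))))"
      by (intro integrable_norm cosft_integrable_mult[OF g, of _ 2 1]) (auto simp del: of_real_mult of_real_add)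
    fix x t :: real
    show "norm (?k x t) \<le> 1 / (1 + x\<^sup>2) * norm (cosft g t * of_real (2 * (1 + t\<^sup>2)))"
    proof (cases "x > 0")
      case True
      let ?r = "rho (u + x\<^sup>2)"
      have r: "?r > 0" by (rule rho_pos[OF pos[OF True]])
      have v: "u + x\<^sup>2 \<ge> 0" using pos[OF True] by simp
      \<comment> \<open>The majorant uses two lower bounds for sinh: the bound by its argument
        cancels |sin(t r)| \<le> |t| r and serves small x, the bound by 2 x^2 gives the decay for
        large x.\<close>
      have s1: "?r \<le> sinh ?r" using r by (intro sinh_ge_self) simp
      have s2: "2 * x\<^sup>2 \<le> sinh ?r"
      proof -
        have "u + x\<^sup>2 = sqrt ((u + x\<^sup>2)\<^sup>2)" using v by simp
        also have "\<dots> \<le> sqrt ((u + x\<^sup>2)\<^sup>2 + (u + x\<^sup>2))" using v by (intro real_sqrt_le_mono) simp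
        finally show ?thesis using u by (simp add: sinh_rho[OF v])
      qed
      have "\<bar>sin (t * ?r)\<bar> \<le> \<bar>t\<bar> * ?r" using abs_sin_x_le_abs_x[of "t * ?r"] r by (simp add: abs_mult)
      also have "\<dots> \<le> \<bar>t\<bar> * sinh ?r" by (intro mult_left_mono s1) auto
      finally have a1: "\<bar>sin (t * ?r)\<bar> \<le> \<bar>t\<bar> * sinh ?r" .
      have "x\<^sup>2 * \<bar>sin (t * ?r)\<bar> \<le> (sinh ?r / 2) * 1" using s2 r by (intro mult_mono) auto
      with a1 have "(1 + x\<^sup>2) * \<bar>sin (t * ?r)\<bar> \<le> (\<bar>t\<bar> + 1/2) * sinh ?r"
        by (simp add: algebra_simps)
      then have "\<bar>t\<bar> * ((1 + x\<^sup>2) * \<bar>sin (t * ?r)\<bar>) \<le> \<bar>t\<bar> * ((\<bar>t\<bar> + 1/2) * sinh ?r)"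
        by (intro mult_left_mono) auto
      also have "\<bar>t\<bar> * ((\<bar>t\<bar> + 1/2) * sinh ?r) \<le> (2 * (1 + t\<^sup>2)) * sinh ?r"
      proof -
        have "0 \<le> (\<bar>t\<bar> - 1/4)\<^sup>2" by simp
        then have "\<bar>t\<bar> * (\<bar>t\<bar> + 1/2) \<le> 2 * (1 + t\<^sup>2)"
          using zero_le_power2[of t] by (simp add: power2_eq_square algebra_simps flip: abs_mult)
        then show ?thesis using r by (simp only: mult.assoc[symmetric]) (intro mult_right_mono, auto)
      qed
      finally have "\<bar>t\<bar> * \<bar>sin (t * ?r)\<bar> / sinh ?r \<le> 1 / (1 + x\<^sup>2) * (2 * (1 + t\<^sup>2))"
        using r by (simp add: field_simps add_pos_nonneg)
      then have "\<bar>t * sin (t * ?r) / sinh ?r\<bar> \<le> 1 / (1 + x\<^sup>2) * \<bar>2 * (1 + t\<^sup>2)\<bar>"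
        using r by (simp add: abs_mult)
      from mult_left_mono[OF this, of "norm (cosft g t)"]
      have "norm (cosft g t) * \<bar>t * sin (t * ?r) / sinh ?r\<bar> \<le> norm (cosft g t) * (1 / (1 + x\<^sup>2) * \<bar>2 * (1 + t\<^sup>2)\<bar>)"
        by simp
      moreover have kx: "?k x t = cosft g t * of_real (t * sin (t * ?r) / sinh ?r)"
        using True by (simp del: of_real_mult of_real_divide)
      moreover have nl: "norm (cosft g t * of_real y) = norm (cosft g t) * \<bar>y\<bar>" for y
        by (simp only: norm_mult norm_of_real)
      ultimately show ?thesis unfolding kx nl by (simp only: mult.left_commute)
    next
      case False
      then show ?thesis by simp
    qed
  qed measurable
  also have "(LBINT t. LBINT x. ?k x t) = (LBINT t. of_real (pi / 4) * (cosft g t * (phi 1 t u * of_real (t * tanh (pi * t)))))"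
  proof (intro Bochner_Integration.integral_cong refl)
    fix t
    have "(LBINT x. ?k x t) = (LBINT x. cosft g t * (indicator {0<..} x *\<^sub>R of_real (t * sin (t * rho (u + x\<^sup>2)) / sinh (rho (u + x\<^sup>2)))))"
      by (intro Bochner_Integration.integral_cong) auto
    also have "\<dots> = cosft g t * (LBINT x:{0<..}. of_real (t * sin (t * rho (u + x\<^sup>2)) / sinh (rho (u + x\<^sup>2))))"
      unfolding set_lebesgue_integral_def by (rule integral_mult_right_zero)
    also have "\<dots> = of_real (pi / 4) * (cosft g t * (phi 1 t u * of_real (t * tanh (pi * t))))"
      unfolding mehler_second[OF u] of_real_mult[of "pi / 4"] by (simp only: mult_ac)
    finally show "(LBINT x. ?k x t) = of_real (pi / 4) * (cosft g t * (phi 1 t u * of_real (t * tanh (pi * t))))" .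
  qed
  also have "\<dots> = of_real (pi / 4) * (LBINT t. cosft g t * (phi 1 t u * of_real (t * tanh (pi * t))))"
    by (rule integral_mult_right_zero)
  finally show ?thesis unfolding abel_def by (simp add: field_simps)
qed

text \<open>Continuity is read off from the right side of \<open>abel_inversion\<close>, which can
  be differentiated in u up to the endpoint 0: \<open>phi 2\<close> is bounded by 1 and the rapid
  decay of \<open>cosft\<close> absorbs the factors growing in t.\<close>

lemma abel_continuous:
  assumes g: "test_fun 1 g"
  shows "continuous_on {0..} (abel g)"
proof -
  have h2: "half_integer 2" using half_integer_Suc[of 1] by simp
  have [measurable]: "cosft g \<in> borel_measurable borel" by (rule cosft_measurable[OF g])
  let ?f = "\<lambda>u t. cosft g t * (phi 1 t u * of_real (t * tanh (pi * t)))"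
  let ?f' = "\<lambda>u t. cosft g t * ((- of_real (((1 - 1/2)\<^sup>2 + t\<^sup>2) / 1) * phi (1 + 1) t u) * of_real (t * tanh (pi * t)))"
  have tt: "\<bar>t * tanh (pi * t)\<bar> \<le> 1 + t\<^sup>2" for t
  proof -
    have "\<bar>t * tanh (pi * t)\<bar> \<le> \<bar>t\<bar> * 1"
      unfolding abs_mult using tanh_real_bounds[of "pi * t"] by (intro mult_left_mono) (auto simp: abs_le_iff less_imp_le)
    also have "\<dots> \<le> 1 + t\<^sup>2"
    proof -
      have "0 \<le> (\<bar>t\<bar> - 1)\<^sup>2 + \<bar>t\<bar>" by simp
      then show ?thesis by (simp add: power2_eq_square algebra_simps flip: abs_mult)
    qed
    finally show ?thesis .
  qed
  have meas: "(\<lambda>t. phi c t u) \<in> borel_measurable borel" if "half_integer c" "u \<ge> 0" for c u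
    using phi_measurable[OF that] .
  have tanhm [measurable]: "(tanh :: real \<Rightarrow> real) \<in> borel_measurable borel"
    by (intro borel_measurable_continuous_onI continuous_intros) auto
  have int: "integrable lborel (?f u)" if u: "u \<ge> 0" for u
  proof (rule cosft_integrable_mult[OF g, of _ 1 1])
    show "(\<lambda>t. phi 1 t u * of_real (t * tanh (pi * t))) \<in> borel_measurable borel"
      using meas[of 1 u] u by measurable
    show "norm (phi 1 t u * of_real (t * tanh (pi * t))) \<le> 1 * (1 + t\<^sup>2) ^ 1" for t
      unfolding norm_mult norm_of_real power_one_right using phi_bound[of 1 u t] u tt[of t] by (intro mult_mono) auto
  qed
  have "((\<lambda>u. LBINT t. ?f u t) has_vector_derivative (LBINT t. ?f' u t)) (at u within {0..})" if u: "u \<ge> 0" for u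
  proof (rule leibniz_dominated(1))
    show "integrable lborel (\<lambda>t. norm (cosft g t * of_real ((1 + t\<^sup>2) * (1 + t\<^sup>2))))"
      by (intro integrable_norm cosft_integrable_mult[OF g, of _ 1 2])
         (auto simp: power2_eq_square abs_mult simp del: of_real_mult of_real_add)
    fix v t :: real assume v: "v \<in> {0..}"
    have "(phi 1 t has_vector_derivative - of_real (((1 - 1/2)\<^sup>2 + t\<^sup>2) / 1) * phi (1 + 1) t v) (at v within {0..})"
      by (rule has_vector_derivative_at_within[OF phi_vderiv(1)]) (use v in auto)
    then show "((\<lambda>v. ?f v t) has_vector_derivative ?f' v t) (at v within {0..})"
      by (intro has_vector_derivative_mult_right has_vector_derivative_mult_left)
    have "norm ((- of_real (((1 - 1/2)\<^sup>2 + t\<^sup>2) / 1) * phi (1 + 1) t v) * of_real (t * tanh (pi * t))) \<le> ((1 + t\<^sup>2) * 1) * (1 + t\<^sup>2)"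
    proof -
      have "\<bar>((1 - 1/2)\<^sup>2 + t\<^sup>2) / 1\<bar> \<le> 1 + t\<^sup>2"
        by (simp add: power2_eq_square abs_le_iff)
      then show ?thesis
        unfolding norm_mult norm_minus_cancel norm_of_real using phi_bound[of "1 + 1" v t] h2 v tt[of t]
        by (intro mult_mono mult_nonneg_nonneg) auto
    qed
    then have "norm (cosft g t) * norm ((- of_real (((1 - 1/2)\<^sup>2 + t\<^sup>2) / 1) * phi (1 + 1) t v) * of_real (t * tanh (pi * t)))
      \<le> norm (cosft g t) * \<bar>(1 + t\<^sup>2) * (1 + t\<^sup>2)\<bar>"
      by (intro mult_left_mono order_trans[OF _ abs_ge_self]) auto
    then show "norm (?f' v t) \<le> norm (cosft g t * of_real ((1 + t\<^sup>2) * (1 + t\<^sup>2)))"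
      by (simp only: norm_mult norm_of_real)
  next
    show "?f' u \<in> borel_measurable lborel"
      using meas[of "1 + 1" u] u h2 by simp
  qed (use u int in \<open>auto simp: convex_real_interval\<close>)
  then have "continuous_on {0..} (\<lambda>u. LBINT t. ?f u t)"
    by (auto simp: continuous_on_eq_continuous_within intro: has_vector_derivative_continuous)
  then have "continuous_on {0..} (\<lambda>u. 1/8 * (LBINT t. ?f u t))"
    by (intro continuous_intros)
  then show ?thesis
    by (subst continuous_on_cong[OF refl]) (use abel_inversion[OF g] in auto)
qed

lemma abel_adm:
  assumes g: "test_fun 1 g"
  shows "admissible (abel g)"
proof -
  obtain M B where MB: "M \<ge> 0" "B > 0" "\<And>v. norm (deriv_rho g v) \<le> M" "\<And>v. v > B \<Longrightarrow> deriv_rho g v = 0" "\<And>v. v > B \<Longrightarrow> g (rho v) = 0"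
    using deriv_rho_bounded[OF g] by metis
  have "deriv_rho g (u + x\<^sup>2) = 0" if "u > B" for u x
  proof -
    have "u + x\<^sup>2 > B" using that zero_le_power2[of x] by linarith
    then show ?thesis by (rule MB(4))
  qed
  then have "abel g u = 0" if "u > B" for u using that by (simp add: abel_def)
  then show ?thesis unfolding admissible_def using abel_continuous[OF g] MB(2) by blast
qed

section \<open>The Jacobi transform of an Abel transform\<close>

lemma chi_bound:
  assumes y: "y \<ge> 0" shows "norm (chi t y) \<le> 1"
proof -
  have "norm (integral {0..1} (\<lambda>x. phi 1 t (y * (1 - x\<^sup>2)))) \<le> 1 * (1 - 0)"
  proof (rule integral_bound)
    have p: "0 \<le> y * (1 - x\<^sup>2)" if "x \<in> {0..1}" for x
      using y that by (auto intro!: mult_nonneg_nonneg simp: power_le_one)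
    then show "continuous_on {0..1} (\<lambda>x. phi 1 t (y * (1 - x\<^sup>2)))"
      by (intro continuous_on_compose2[OF phi_continuous_on[of 1 "{0..}" t]]) (auto intro!: continuous_intros)
    show "norm (phi 1 t (y * (1 - x\<^sup>2))) \<le> 1" if "x \<in> {0..1}" for x
      using p[OF that] by (intro phi_bound) auto
  qed simp
  then show ?thesis by (simp add: chi_def)
qed

lemma chi_half_integral:
  assumes y: "y > 0"
  shows "(LBINT x. indicator {0<..} x *\<^sub>R (indicator {0<..} (y - x\<^sup>2) *\<^sub>R phi 1 t (y - x\<^sup>2))) = of_real (sqrt y) * chi t y"
proof -
  let ?s = "sqrt y"
  have s: "?s > 0" "?s * ?s = y" using y by auto
  have "(LBINT x. indicator {0<..} x *\<^sub>R (indicator {0<..} (y - x\<^sup>2) *\<^sub>R phi 1 t (y - x\<^sup>2)))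
    = \<bar>?s\<bar> *\<^sub>R (LBINT x. indicator {0<..} (0 + ?s * x) *\<^sub>R (indicator {0<..} (y - (0 + ?s * x)\<^sup>2) *\<^sub>R phi 1 t (y - (0 + ?s * x)\<^sup>2)))"
    by (rule lborel_integral_real_affine) (use s in auto)
  also have "(LBINT x. indicator {0<..} (0 + ?s * x) *\<^sub>R (indicator {0<..} (y - (0 + ?s * x)\<^sup>2) *\<^sub>R phi 1 t (y - (0 + ?s * x)\<^sup>2)))
    = (LBINT x. indicator {0<..<1} x *\<^sub>R phi 1 t (y * (1 - x\<^sup>2)))"
  proof (intro Bochner_Integration.integral_cong refl)
    fix x :: real
    have e: "y - (0 + ?s * x)\<^sup>2 = y * (1 - x\<^sup>2)" using y by (simp add: power_mult_distrib algebra_simps)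
    have "0 < ?s * x \<longleftrightarrow> 0 < x" using s by (simp add: zero_less_mult_iff)
    moreover have "0 < y * (1 - x\<^sup>2) \<longleftrightarrow> x < 1" if "0 < x"
      using y that by (simp add: zero_less_mult_iff power_less_one_iff abs_square_less_1)
    ultimately show "indicator {0<..} (0 + ?s * x) *\<^sub>R (indicator {0<..} (y - (0 + ?s * x)\<^sup>2) *\<^sub>R phi 1 t (y - (0 + ?s * x)\<^sup>2))
      = indicator {0<..<1} x *\<^sub>R phi 1 t (y * (1 - x\<^sup>2))"
      unfolding e by (auto simp: indicator_def)
  qed
  also have "\<dots> = (LBINT x:{0..1}. phi 1 t (y * (1 - x\<^sup>2)))"
    unfolding set_lebesgue_integral_def
  proof (rule integral_cong_AE)
    have c: "continuous_on {0..1} (\<lambda>x. phi 1 t (y * (1 - x\<^sup>2)))"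
      by (intro continuous_on_compose2[OF phi_continuous_on[of 1 "{0..}" t]])
         (use y in \<open>auto intro!: continuous_intros mult_nonneg_nonneg simp: power_le_one\<close>)
    show "(\<lambda>x. indicator {0..1} x *\<^sub>R phi 1 t (y * (1 - x\<^sup>2))) \<in> borel_measurable lborel"
      using borel_measurable_continuous_on_indicator[OF _ c] by simp
    show "(\<lambda>x. indicator {0<..<1} x *\<^sub>R phi 1 t (y * (1 - x\<^sup>2))) \<in> borel_measurable lborel"
    proof -
      have "continuous_on {0<..<1} (\<lambda>x. phi 1 t (y * (1 - x\<^sup>2)))"
        by (rule continuous_on_subset[OF c]) auto
      then show ?thesis using borel_measurable_continuous_on_indicator[of "{0<..<1::real}"] by simp
    qed
    show "AE x in lborel. indicator {0<..<1} x *\<^sub>R phi 1 t (y * (1 - x\<^sup>2)) = indicator {0..1} x *\<^sub>R phi 1 t (y * (1 - x\<^sup>2))"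
      using AE_lborel_singleton[of 0] AE_lborel_singleton[of 1] by eventually_elim (auto simp: indicator_def)
  qed
  also have "\<dots> = chi t y"
    unfolding chi_def
    by (intro set_borel_integral_eq_integral(2) borel_integrable_atLeastAtMost' continuous_on_compose2[OF phi_continuous_on[of 1 "{0..}" t]])
       (use y in \<open>auto intro!: continuous_intros mult_nonneg_nonneg simp: power_le_one\<close>)
  finally show ?thesis using s by (simp add: scaleR_conv_of_real)
qed

text \<open>Integrate by parts: 2 \<open>deriv_rho g\<close> is the derivative of g(rho(y)), and
  sqrt y times \<open>chi\<close> has half the weighted cosine as derivative. The left side is thus
  -1/4 of the transform at 1/2, which is half of \<open>cosft\<close>.\<close>

lemma deriv_rho_chi_integral:
  assumes g: "test_fun 1 g"
  shows "(LBINT y:{0<..}. deriv_rho g y * (of_real (sqrt y) * chi t y)) = - cosft g t / 8"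
proof -
  obtain M B where MB: "M \<ge> 0" "B > 0" "\<And>v. norm (deriv_rho g v) \<le> M" "\<And>v. v > B \<Longrightarrow> deriv_rho g v = 0" "\<And>v. v > B \<Longrightarrow> g (rho v) = 0"
    using deriv_rho_bounded[OF g] by metis
  let ?h = "\<lambda>v. g (rho v)" and ?X = "\<lambda>y. of_real (sqrt y) * chi t y"
  let ?X' = "\<lambda>y. complex_of_real (cos (t * rho y) / (2 * sqrt (y\<^sup>2 + y)))"
  let ?p = "\<lambda>y. 2 * (deriv_rho g y * ?X y) + (1/2) * (?h y * phi (1/2) t y * of_real (weight (1/2) y))"
  note dX = chi_vderiv[of _ t]
  have cX: "continuous_on {0<..} ?X"
    by (intro continuous_at_imp_continuous_on ballI has_vector_derivative_continuous[OF dX]) simp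
  have cgs: "continuous_on {0<..} (deriv_rho g)"
  proof -
    have "continuous_on {0<..} (\<lambda>v. D g (rho v) / of_real (sinh (rho v)))"
      using rho_pos
      by (intro continuous_intros continuous_on_compose2[OF test_fun_continuous[OF test_fun_deriv(1)[OF g], of UNIV]]) (auto simp: less_imp_neq[symmetric])
    then show ?thesis by (rule continuous_on_eq) (simp add: deriv_rho_def)
  qed
  have c1: "continuous_on {0<..} (\<lambda>y. deriv_rho g y * ?X y)" by (intro continuous_on_mult cX cgs)
  have h: "admissible ?h" by (rule test_fun_rho_adm[OF g])
  have Xb: "norm (?X y) \<le> sqrt y" if "y \<ge> 0" for y
    using chi_bound[OF that, of t] that by (simp add: norm_mult mult_left_le)
  have i1: "set_integrable lborel {0<..} (\<lambda>y. deriv_rho g y * ?X y)"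
    unfolding set_integrable_def
  proof (rule Bochner_Integration.integrable_bound[OF integrable_const_indicator[of "M * sqrt B" 0 B]])
    show "(\<lambda>y. indicator {0<..} y *\<^sub>R (deriv_rho g y * ?X y)) \<in> borel_measurable lborel"
      using borel_measurable_continuous_on_indicator[OF _ c1] by simp
    have "norm (indicator {0<..} y *\<^sub>R (deriv_rho g y * ?X y)) \<le> (M * sqrt B) * indicator {0..B} y" for y
    proof (cases "0 < y \<and> y \<le> B")
      case True
      have "norm (deriv_rho g y) * norm (?X y) \<le> M * sqrt B"
        using True MB Xb[of y] by (intro mult_mono order_trans[OF Xb]) auto
      then show ?thesis using True by (simp add: norm_mult)
    next
      case False
      then show ?thesis using MB by (auto simp: indicator_def)
    qed
    then have "norm (indicator {0<..} y *\<^sub>R (deriv_rho g y * ?X y)) \<le> norm ((M * sqrt B) * indicator {0..B} y)" for y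
      using MB(1,2) by (simp del: norm_scaleR)
    then show "AE y in lborel. norm (indicator {0<..} y *\<^sub>R (deriv_rho g y * ?X y)) \<le> norm ((M * sqrt B) * indicator {0..B} y)"
      by blast
  qed
  have i2: "set_integrable lborel {0<..} (\<lambda>y. ?h y * phi (1/2) t y * of_real (weight (1/2) y))"
    by (rule jacobi_transform_integrable[OF h]) simp
  have ei: "einterval 0 \<infinity> = {0<..}" by (auto simp: einterval_def)
  have "(LBINT y=0..\<infinity>. ?p y) = 0 - 0"
  proof (rule interval_integral_FTC_integrable)
    fix y assume "0 < ereal y"
    then have y: "y > 0" by simp
    have "((\<lambda>y. ?h y * ?X y) has_vector_derivative (?h y * ?X' y + 2 * (D g (rho y) / of_real (sinh (rho y))) * ?X y)) (at y)"
      by (intro has_vector_derivative_mult test_fun_rho_vderiv[OF g y] dX y)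
    moreover have "?h y * ?X' y + 2 * (D g (rho y) / of_real (sinh (rho y))) * ?X y = ?p y"
    proof -
      have "weight (1/2) y = 1 / sqrt (y\<^sup>2 + y)"
        using sq_plus_pos[OF y] by (simp add: weight_def powr_minus powr_half_sqrt inverse_eq_divide)
      then show ?thesis using y by (simp add: deriv_rho_def phi_half)
    qed
    ultimately show "((\<lambda>y. ?h y * ?X y) has_vector_derivative ?p y) (at y)" by (simp only:)
    have "continuous_on {0<..} ?p"
      by (intro continuous_on_add continuous_on_mult continuous_on_const c1[unfolded] admissible_integrand_continuous[OF h]) (auto intro: cX cgs)
    then show "isCont ?p y" using y by (simp add: continuous_on_eq_continuous_at)
  next
    show "set_integrable lborel (einterval 0 \<infinity>) ?p"
      unfolding ei by (intro set_integral_add(1) set_integrable_mult_right i1 i2)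
    obtain M' where M': "M' \<ge> 0" "\<And>x. norm (g x) \<le> M'" using test_fun_bounded[OF g] by blast
    have "((\<lambda>y. M' * sqrt y) \<longlongrightarrow> M' * sqrt 0) (at_right 0)" by (intro tendsto_intros)
    then have lim0: "((\<lambda>y. M' * sqrt y) \<longlongrightarrow> 0) (at_right 0)" by simp
    have b: "norm (?h y * ?X y) \<le> M' * sqrt y" if "y > 0" for y
      unfolding norm_mult[of "?h y"] using M' Xb[of y] that by (intro mult_mono) auto
    have "\<forall>\<^sub>F y in at_right 0. norm (?h y * ?X y) \<le> M' * sqrt y"
      using eventually_at_right_less[of "0::real"] by eventually_elim (rule b)
    from Lim_null_comparison[OF this lim0] have "((\<lambda>y. ?h y * ?X y) \<longlongrightarrow> 0) (at_right 0)" .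
    then show "(((\<lambda>y. ?h y * ?X y) \<circ> real_of_ereal) \<longlongrightarrow> 0) (at_right 0)"
      unfolding zero_ereal_def ereal_tendsto_simps .
    have "eventually (\<lambda>y. ?h y * ?X y = 0) at_top"
      using eventually_gt_at_top[of B] by eventually_elim (simp add: MB)
    then have "((\<lambda>y. ?h y * ?X y) \<longlongrightarrow> 0) at_top" by (rule tendsto_eventually)
    then show "(((\<lambda>y. ?h y * ?X y) \<circ> real_of_ereal) \<longlongrightarrow> 0) (at_left \<infinity>)"
      unfolding ereal_tendsto_simps .
  qed simp
  then have "(LBINT y:{0<..}. ?p y) = 0"
    by (simp add: interval_lebesgue_integral_def ei)
  moreover have "(LBINT y:{0<..}. ?p y) = 2 * (LBINT y:{0<..}. deriv_rho g y * ?X y) + (1/2) * jacobi_transform (1/2) ?h t"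
    unfolding jacobi_transform_def using i1 i2 by (subst set_integral_add(2)) (auto intro: set_integrable_mult_right simp: set_integral_mult_right)
  ultimately have "2 * (LBINT y:{0<..}. deriv_rho g y * ?X y) + (1/2) * jacobi_transform (1/2) ?h t = 0" by (simp only:)
  then have "- (2 * (LBINT y:{0<..}. deriv_rho g y * ?X y)) = (1/2) * jacobi_transform (1/2) ?h t"
    by (simp only: minus_unique)
  then have "(-1/2) * - (2 * (LBINT y:{0<..}. deriv_rho g y * ?X y)) = (-1/2) * ((1/2) * jacobi_transform (1/2) ?h t)"
    by (simp only:)
  then show ?thesis by (simp add: jacobi_transform_half[OF g, of t])
qed

text \<open>The weight at c = 1 is the constant 1, so Fubini and the shift y = u + x^2 move the
  half-order integration from \<open>deriv_rho g\<close> to \<open>phi 1\<close>, where it produces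
  sqrt y times \<open>chi\<close>.\<close>

lemma jacobi_transform_one_abel:
  assumes g: "test_fun 1 g"
  shows "jacobi_transform 1 (abel g) t = cosft g t / 8"
proof -
  obtain M B where MB: "M \<ge> 0" "B > 0" "\<And>v. norm (deriv_rho g v) \<le> M" "\<And>v. v > B \<Longrightarrow> deriv_rho g v = 0" "\<And>v. v > B \<Longrightarrow> g (rho v) = 0"
    using deriv_rho_bounded[OF g] by metis
  have [measurable]: "deriv_rho g \<in> borel_measurable borel" by (rule deriv_rho_measurable[OF g])
  \<comment> \<open>Extending \<open>phi 1\<close> by 0 lets the shift be carried out on the whole
    line.\<close>
  define P where "P u = indicator {0<..} u *\<^sub>R phi 1 t u" for u
  have Pm [measurable]: "P \<in> borel_measurable borel"
    unfolding P_def[abs_def]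
    by (rule borel_measurable_continuous_on_indicator) (auto intro: phi_continuous_on)
  have Pb: "norm (P u) \<le> 1" for u
    using phi_bound[of 1 u t] by (simp add: P_def indicator_def)
  let ?k = "\<lambda>u x. P u * (indicator {0<..} x *\<^sub>R deriv_rho g (u + x\<^sup>2))"
  let ?l = "\<lambda>x y. (indicator {0<..} x *\<^sub>R P (y - x\<^sup>2)) * deriv_rho g y"
  have "jacobi_transform 1 (abel g) t = (LBINT u. P u * abel g u)"
    unfolding jacobi_transform_def set_lebesgue_integral_def
  proof (intro Bochner_Integration.integral_cong refl)
    fix u :: real
    show "indicator {0<..} u *\<^sub>R (abel g u * phi 1 t u * of_real (weight 1 u)) = P u * abel g u"
      using sq_plus_pos[of u] by (auto simp: P_def weight_def indicator_def)
  qed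
  also have "\<dots> = (LBINT u. - (LBINT x. ?k u x))"
    unfolding abel_def by (simp only: integral_mult_right_zero mult_minus_right)
  also have "\<dots> = - (LBINT u. LBINT x. ?k u x)" by simp
  also have "(LBINT u. LBINT x. ?k u x) = (LBINT x. LBINT u. ?k u x)"
  proof (rule Fubini_dominated)
    show "integrable lborel (\<lambda>u::real. M * indicator {0..B} u :: real)" "integrable lborel (\<lambda>x::real. 1 * indicator {0..B+1} x :: real)"
      by (rule integrable_const_indicator)+
    fix u x :: real
    show "norm (?k u x) \<le> M * indicator {0..B} u * (1 * indicator {0..B+1} x)"
    proof (cases "0 < u \<and> u \<le> B")
      case True
      have "norm (P u) * norm (indicator {0<..} x *\<^sub>R deriv_rho g (u + x\<^sup>2)) \<le> 1 * (M * indicator {0..B+1} x)"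
        using True MB by (intro mult_mono Pb shifted_square_bound) auto
      moreover have iu: "indicator {0..B} u = (1::real)" using True by simp
      ultimately show ?thesis unfolding norm_mult iu by (simp only: mult_1_left mult_1_right)
    next
      case False
      have "deriv_rho g (u + x\<^sup>2) = 0" if "u > B"
        using that zero_le_power2[of x] by (intro MB(4)) linarith
      with False have "?k u x = 0" by (auto simp: P_def)
      moreover have "0 \<le> M * indicator {0..B} u * (1 * indicator {0..B+1} x)" using MB(1) by simp
      ultimately show ?thesis by (simp only: norm_zero)
    qed
  qed measurable
  also have "\<dots> = (LBINT x. LBINT y. ?l x y)"
  proof (rule Bochner_Integration.integral_cong[OF refl])
    fix x :: real
    have "(LBINT u. ?k u x) = \<bar>1\<bar> *\<^sub>R (LBINT y. ?k (- x\<^sup>2 + 1 * y) x)"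
      by (rule lborel_integral_real_affine) simp
    moreover have "?k (- x\<^sup>2 + 1 * y) x = ?l x y" for y
    proof -
      have "- x\<^sup>2 + 1 * y = y - x\<^sup>2" "y - x\<^sup>2 + x\<^sup>2 = y" by simp_all
      then show ?thesis by (simp only: mult_scaleR_left mult_scaleR_right)
    qed
    ultimately show "(LBINT u. ?k u x) = (LBINT y. ?l x y)"
      by simp
  qed
  also have "\<dots> = (LBINT y. LBINT x. ?l x y)"
  proof (rule Fubini_dominated)
    show "integrable lborel (\<lambda>x::real. 1 * indicator {0..B+1} x :: real)" "integrable lborel (\<lambda>u::real. M * indicator {0..B} u :: real)"
      by (rule integrable_const_indicator)+
    fix x y :: real
    show "norm (?l x y) \<le> 1 * indicator {0..B+1} x * (M * indicator {0..B} y)"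
    proof (cases "0 < y \<and> y \<le> B")
      case True
      have "norm (indicator {0<..} x *\<^sub>R P (y - x\<^sup>2)) \<le> 1 * indicator {0..B+1} x"
      proof (cases "0 < x \<and> x \<le> B + 1")
        case True
        then show ?thesis using Pb[of "y - x\<^sup>2"] by simp
      next
        case False
        have "P (y - x\<^sup>2) = 0" if "x > B + 1"
        proof -
          have "x * 1 \<le> x * x" using that MB(2) by (intro mult_left_mono) auto
          then have "y - x\<^sup>2 < 0" using that True unfolding power2_eq_square by linarith
          then show ?thesis by (simp add: P_def)
        qed
        with False show ?thesis by (auto simp: indicator_def)
      qed
      then have "norm (indicator {0<..} x *\<^sub>R P (y - x\<^sup>2)) * norm (deriv_rho g y) \<le> (1 * indicator {0..B+1} x) * M"
        using MB by (intro mult_mono) auto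
      moreover have iy: "indicator {0..B} y = (1::real)" using True by simp
      ultimately show ?thesis unfolding norm_mult iy by (simp only: mult_1_right)
    next
      case False
      have "deriv_rho g y = 0"
      proof (cases "y > B")
        case False
        with \<open>\<not> (0 < y \<and> y \<le> B)\<close> have "\<not> 0 < y" by simp
        then show ?thesis by (simp add: deriv_rho_def)
      qed (rule MB(4))
      moreover have "0 \<le> 1 * indicator {0..B+1} x * (M * indicator {0..B} y)" using MB(1) by simp
      ultimately show ?thesis by (simp only: norm_zero mult_zero_right)
    qed
  qed measurable
  also have "\<dots> = (LBINT y:{0<..}. deriv_rho g y * (of_real (sqrt y) * chi t y))"
    unfolding set_lebesgue_integral_def
  proof (intro Bochner_Integration.integral_cong refl)
    fix y :: real
    have e: "(LBINT x. ?l x y) = (LBINT x. indicator {0<..} x *\<^sub>R P (y - x\<^sup>2)) * deriv_rho g y"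
      by (rule integral_mult_left_zero)
    show "(LBINT x. ?l x y) = indicator {0<..} y *\<^sub>R (deriv_rho g y * (of_real (sqrt y) * chi t y))"
    proof (cases "y > 0")
      case True
      then show ?thesis unfolding e unfolding P_def chi_half_integral[OF True] by (simp add: mult.commute)
    next
      case False
      then show ?thesis unfolding e by (simp add: deriv_rho_def)
    qed
  qed
  finally show ?thesis using deriv_rho_chi_integral[OF g, of t] by simp
qed

text \<open>The factor 1/8 of the transform and the 1/8 of \<open>abel_inversion\<close> agree, and
  Gamma(1) = 1, so no constant remains.\<close>

lemma inversion_family_even:
  "inversion_family 1 (\<lambda>t. t * tanh (pi * t)) {abel g | g. test_fun 1 g}"
  unfolding inversion_family_def
proof (intro conjI ballI)
  have "\<bar>t * tanh (pi * t)\<bar> \<le> 1 * (1 + t\<^sup>2) ^ 1" for t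
  proof -
    have "\<bar>t * tanh (pi * t)\<bar> \<le> \<bar>t\<bar> * 1"
      unfolding abs_mult using tanh_real_bounds[of "pi * t"] by (intro mult_left_mono) (auto simp: abs_le_iff less_imp_le)
    also have "\<dots> \<le> 1 + t\<^sup>2"
    proof -
      have "0 \<le> (\<bar>t\<bar> - 1)\<^sup>2 + \<bar>t\<bar>" by simp
      then show ?thesis by (simp add: power2_eq_square algebra_simps flip: abs_mult)
    qed
    finally show ?thesis by simp
  qed
  then show "\<exists>K N. \<forall>t. \<bar>t * tanh (pi * t)\<bar> \<le> K * (1 + t\<^sup>2) ^ N" by blast
  have [measurable]: "(tanh :: real \<Rightarrow> real) \<in> borel_measurable borel"
    by (intro borel_measurable_continuous_onI continuous_intros) auto
  show "(\<lambda>t. t * tanh (pi * t)) \<in> borel_measurable borel" by measurable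
  fix f assume "f \<in> {abel g | g. test_fun 1 g}"
  then obtain g where g: "test_fun 1 g" and f: "f = abel g" by auto
  have jacobi_transform: "jacobi_transform 1 f = (\<lambda>t. cosft g t / 8)"
    unfolding f using jacobi_transform_one_abel[OF g] by auto
  have [measurable]: "cosft g \<in> borel_measurable borel" by (rule cosft_measurable[OF g])
  show "jacobi_transform 1 f \<in> borel_measurable borel" unfolding jacobi_transform by measurable
  show "\<forall>N. \<exists>C. \<forall>t. norm (jacobi_transform 1 f t) * (1 + t\<^sup>2) ^ N \<le> C"
  proof
    fix N
    obtain C where "\<And>t. norm (cosft g t) * (1 + t\<^sup>2) ^ N \<le> C" using cosft_rapid[OF g] by blast
    then have "norm (jacobi_transform 1 f t) * (1 + t\<^sup>2) ^ N \<le> C / 8" for t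
      unfolding jacobi_transform by (simp add: norm_divide)
    then show "\<exists>C. \<forall>t. norm (jacobi_transform 1 f t) * (1 + t\<^sup>2) ^ N \<le> C" by blast
  qed
  show "\<forall>u\<ge>0. f u = 1 / (Gamma (of_real 1))\<^sup>2 * (LBINT t. jacobi_transform 1 f t * (phi 1 t u * of_real (t * tanh (pi * t))))"
  proof (intro allI impI)
    fix u :: real assume u: "u \<ge> 0"
    have "(LBINT t. jacobi_transform 1 f t * (phi 1 t u * of_real (t * tanh (pi * t)))) = (LBINT t. 1/8 * (cosft g t * (phi 1 t u * of_real (t * tanh (pi * t)))))"
      unfolding jacobi_transform by simp
    also have "\<dots> = 1/8 * (LBINT t. cosft g t * (phi 1 t u * of_real (t * tanh (pi * t))))"
      by (rule integral_mult_right_zero)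
    also have "\<dots> = f u" using abel_inversion[OF g u] f by simp
    finally show "f u = 1 / (Gamma (of_real 1))\<^sup>2 * (LBINT t. jacobi_transform 1 f t * (phi 1 t u * of_real (t * tanh (pi * t))))"
      by simp
  qed
qed

subsection \<open>The inversion formulae\<close>

lemma inversion_family_add:
  assumes inv: "inversion_family c q \<F>" and c: "half_integer c"
    and admissible: "\<And>f. f \<in> \<F> \<Longrightarrow> admissible f"
    and prim: "\<And>f. f \<in> \<F> \<Longrightarrow> \<exists>F\<in>\<F>. \<forall>u\<ge>0. (F has_vector_derivative f u) (at u within {0..})"
  shows "inversion_family (c + real m) (\<lambda>t. q t * (\<Prod>k<m. (c + real k - 1/2)\<^sup>2 + t\<^sup>2)) \<F>"
proof (induction m)
  case 0
  then show ?case using inv by simp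
next
  case (Suc m)
  have "inversion_family (c + real m + 1) (\<lambda>t. q t * (\<Prod>k<m. (c + real k - 1/2)\<^sup>2 + t\<^sup>2) * ((c + real m - 1/2)\<^sup>2 + t\<^sup>2)) \<F>"
    by (rule inversion_family_step[OF Suc half_integer_add[OF c] admissible prim])
  then show ?case by (simp add: mult.assoc add_ac)
qed

lemma inversion_familyD:
  assumes "inversion_family c q \<F>" "f \<in> \<F>" "u \<ge> 0"
  shows "f u = 1 / (Gamma (of_real c))\<^sup>2 * (LBINT t. jacobi_transform c f t * (phi c t u * of_real (q t)))"
  using assms unfolding inversion_family_def by blast

lemma pochhammer_conj_prod:
  "pochhammer (complex_of_real a + \<i> * of_real t) m * pochhammer (of_real a - \<i> * of_real t) m
    = of_real (\<Prod>k<m. (a + real k)\<^sup>2 + t\<^sup>2)"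
proof -
  have "(of_real a + \<i> * of_real t + of_nat k) * (of_real a - \<i> * of_real t + of_nat k) = complex_of_real ((a + real k)\<^sup>2 + t\<^sup>2)" for k
    by (simp add: complex_eq_iff power2_eq_square algebra_simps)
  then show ?thesis
    unfolding pochhammer_prod prod.distrib[symmetric] by (simp add: lessThan_atLeast0)
qed

lemma test_fun_rho_primitive_Ici:
  assumes g: "test_fun 1 g"
  shows "\<exists>G. test_fun 1 G \<and> (\<forall>u\<ge>0. ((\<lambda>v. G (rho v)) has_vector_derivative g (rho u)) (at u within {0..}))"
proof -
  obtain G where G: "test_fun 1 G" "\<And>x. (G has_vector_derivative g x * of_real (sinh x / 2)) (at x)"
    using test_fun_primitive[OF g] by blast
  have "((\<lambda>v. G (rho v)) has_vector_derivative g (rho u)) (at u within {0..})" if "u \<ge> 0" for u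
    using test_fun_rho_adm[OF g] test_fun_rho_adm[OF G(1)] that
    by (intro has_vector_derivative_Ici[where f = "\<lambda>v. g (rho v)"] test_fun_rho_primitive[OF g G]) (auto simp: admissible_def)
  with G(1) show ?thesis by blast
qed

text \<open>At v = 0 conventions differ: for m = 0 the even integrand has the factor
  \<open>(v^2 + v) ^ 0 = 1\<close>, whereas \<open>weight 1 0 = 0 powr 0 = 0\<close>. A single point
  is a null set.\<close>

lemma set_integral_Ici:
  fixes f f' :: "real \<Rightarrow> complex"
  assumes f: "set_integrable lborel {0<..} f" and eq: "\<And>v. v > 0 \<Longrightarrow> f' v = f v"
  shows "set_integrable lborel {0..} f'" "(LBINT v:{0..}. f' v) = (LBINT v:{0<..}. f v)"
proof -
  let ?F = "\<lambda>v. indicator {0<..} v *\<^sub>R f v" and ?G = "\<lambda>v. indicator {0} v *\<^sub>R f' 0"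
  have e: "indicator {0..} v *\<^sub>R f' v = ?F v + ?G v" for v
    using eq[of v] by (auto simp: indicator_def)
  have F: "integrable lborel ?F" using f by (simp add: set_integrable_def)
  have G: "integrable lborel ?G" by (intro integrable_scaleR_left integrable_real_indicator) auto
  have "(LBINT v. ?G v) = 0"
    by (rule integral_eq_zero_AE) (use AE_lborel_singleton[of 0] in \<open>eventually_elim, simp\<close>)
  then show "set_integrable lborel {0..} f'" "(LBINT v:{0..}. f' v) = (LBINT v:{0<..}. f v)"
    unfolding set_integrable_def set_lebesgue_integral_def e using F G by simp_all
qed

theorem theorem2p4:
  fixes g :: "real \<Rightarrow> complex" and m :: nat and u :: real
  assumes "test_function g"
    and "\<And>x. g (- x) = g x"
    and "u \<ge> 0"
  shows "(\<forall>t. set_integrable lborel {0..} (inner_even m (f_even g) t))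
       \<and> integrable lborel (outer_even m (f_even g) u)
       \<and> f_even g u = 1 / (Gamma (of_nat m + 1))\<^sup>2 * (LBINT t. outer_even m (f_even g) u t)
       \<and> (\<forall>t. set_integrable lborel {0..} (inner_odd m (f_odd g) t))
       \<and> integrable lborel (outer_odd m (f_odd g) u)
       \<and> f_odd g u = 1 / (Gamma (of_nat m + 1/2))\<^sup>2 * (LBINT t. outer_odd m (f_odd g) u t)"
proof -
  have g: "test_fun 1 g" by (rule test_fun_test_function[OF assms(1,2)])
  let ?c = "1 + real m" and ?d = "1/2 + real m"
  \<comment> \<open>The factors are left in the form c + k - 1/2 delivered by
    \<open>inversion_family_add\<close>; they equal 1/2 + k here and k in \<open>?qo\<close>, the
    entries of the Pochhammer products.\<close>
  let ?qe = "\<lambda>t. t * tanh (pi * t) * (\<Prod>k<m. (1 + real k - 1/2)\<^sup>2 + t\<^sup>2)"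
  let ?qo = "\<lambda>t. 1 * (\<Prod>k<m. (1/2 + real k - 1/2)\<^sup>2 + t\<^sup>2)"
  have hi: "half_integer ?c" "half_integer ?d" by (intro half_integer_add half_integer_basic)+
  have inv_even: "inversion_family ?c ?qe {abel g | g. test_fun 1 g}"
  proof (rule inversion_family_add[OF inversion_family_even])
    fix f assume "f \<in> {abel g | g. test_fun 1 g}"
    then obtain h where h: "test_fun 1 h" "f = abel h" by blast
    show "admissible f" unfolding h(2) by (rule abel_adm[OF h(1)])
    obtain G where G: "test_fun 1 G" "\<And>x. (G has_vector_derivative h x * of_real (sinh x / 2)) (at x)"
      using test_fun_primitive[OF h(1)] by blast
    then show "\<exists>F\<in>{abel g | g. test_fun 1 g}. \<forall>u\<ge>0. (F has_vector_derivative f u) (at u within {0..})"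
      unfolding h(2) by (intro bexI[of _ "abel G"] allI impI abel_primitive[OF h(1)]) auto
  qed simp
  have inv_odd: "inversion_family ?d ?qo {\<lambda>v. g (rho v) | g. test_fun 1 g}"
  proof (rule inversion_family_add[OF inversion_family_odd])
    fix f assume "f \<in> {\<lambda>v. g (rho v) | g. test_fun 1 g}"
    then obtain h where h: "test_fun 1 h" "f = (\<lambda>v. h (rho v))" by blast
    show "admissible f" unfolding h(2) by (rule test_fun_rho_adm[OF h(1)])
    obtain G where G: "test_fun 1 G" "\<And>u. u \<ge> 0 \<Longrightarrow> ((\<lambda>v. G (rho v)) has_vector_derivative h (rho u)) (at u within {0..})"
      using test_fun_rho_primitive_Ici[OF h(1)] by blast
    then show "\<exists>F\<in>{\<lambda>v. g (rho v) | g. test_fun 1 g}. \<forall>u\<ge>0. (F has_vector_derivative f u) (at u within {0..})"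
      unfolding h(2) by (intro bexI[of _ "\<lambda>v. G (rho v)"] allI impI) auto
  qed simp
  have he: "hyp_even m t v = phi ?c t v" and ho: "hyp_odd m t v = phi ?d t v" for t v
    by (simp_all add: hyp_even_def hyp_odd_def phi_def algebra_simps)
  have we: "inner_even m (f_even g) t v = abel g v * phi ?c t v * of_real (weight ?c v)" if "v > 0" for t v
    using f_even_eq_abel[OF g, of v] that sq_plus_pos[OF that]
    by (simp add: inner_even_def he weight_def powr_realpow)
  have wo: "inner_odd m (f_odd g) t v = g (rho v) * phi ?d t v * of_real (weight ?d v)" for t v
    by (simp add: inner_odd_def ho weight_def f_odd_def algebra_simps)
  have je: "set_integrable lborel {0..} (inner_even m (f_even g) t)" "(LBINT v:{0..}. inner_even m (f_even g) t v) = jacobi_transform ?c (abel g) t" for t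
    using set_integral_Ici[OF jacobi_transform_integrable[OF abel_adm[OF g] hi(1)] we] unfolding jacobi_transform_def by blast+
  have jo: "set_integrable lborel {0..} (inner_odd m (f_odd g) t)" "(LBINT v:{0..}. inner_odd m (f_odd g) t v) = jacobi_transform ?d (\<lambda>v. g (rho v)) t" for t
    using set_integral_Ici[OF jacobi_transform_integrable[OF test_fun_rho_adm[OF g] hi(2)] wo] unfolding jacobi_transform_def by blast+
  have oe: "outer_even m (f_even g) u = (\<lambda>t. jacobi_transform ?c (abel g) t * (phi ?c t u * of_real (?qe t)))"
  proof
    fix t
    have "pochhammer (1/2 + \<i> * of_real t) m * pochhammer (1/2 - \<i> * of_real t) m = complex_of_real (\<Prod>k<m. (1 + real k - 1/2)\<^sup>2 + t\<^sup>2)"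
      using pochhammer_conj_prod[of "1/2" t m] by (simp add: algebra_simps)
    then show "outer_even m (f_even g) u t = jacobi_transform ?c (abel g) t * (phi ?c t u * of_real (?qe t))"
      unfolding outer_even_def je he mult.assoc by (simp add: mult_ac)
  qed
  have oo: "outer_odd m (f_odd g) u = (\<lambda>t. jacobi_transform ?d (\<lambda>v. g (rho v)) t * (phi ?d t u * of_real (?qo t)))"
  proof
    fix t
    have "pochhammer (\<i> * of_real t) m * pochhammer (- (\<i> * of_real t)) m = complex_of_real (\<Prod>k<m. (1/2 + real k - 1/2)\<^sup>2 + t\<^sup>2)"
      using pochhammer_conj_prod[of 0 t m] by simp
    then show "outer_odd m (f_odd g) u t = jacobi_transform ?d (\<lambda>v. g (rho v)) t * (phi ?d t u * of_real (?qo t))"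
      unfolding outer_odd_def jo ho mult.assoc by simp
  qed
  have me: "abel g \<in> {abel g | g. test_fun 1 g}" and mo: "(\<lambda>v. g (rho v)) \<in> {\<lambda>v. g (rho v) | g. test_fun 1 g}"
    using g by auto
  have ce: "complex_of_real ?c = of_nat m + 1" and co: "complex_of_real ?d = of_nat m + 1/2" by simp_all
  have "f_even g u = 1 / (Gamma (of_nat m + 1))\<^sup>2 * (LBINT t. outer_even m (f_even g) u t)"
    unfolding f_even_eq_abel[OF g assms(3)] oe
    by (rule inversion_familyD[OF inv_even me assms(3), unfolded ce])
  moreover have "f_odd g u = 1 / (Gamma (of_nat m + 1/2))\<^sup>2 * (LBINT t. outer_odd m (f_odd g) u t)"
    unfolding f_odd_def oo[unfolded f_odd_def[abs_def]]
    by (rule inversion_familyD[OF inv_odd mo assms(3), unfolded co])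
  moreover have "integrable lborel (outer_even m (f_even g) u)"
    unfolding oe by (rule inversion_family_integrable[OF inv_even hi(1) me assms(3)])
  moreover have "integrable lborel (outer_odd m (f_odd g) u)"
    unfolding oo by (rule inversion_family_integrable[OF inv_odd hi(2) mo assms(3)])
  ultimately show ?thesis using je(1) jo(1) by blast
qed

end
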